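(* Let $\mathbb{K}$ be a field, let $\Gamma$ be a finite, connected, simple graph, and let $\mathsf{C}\neq\emptyset$ be a set of vertices of $\Gamma$. Then the zigzag algebra $Z^{\mathsf{C}}(\Gamma)$ over $\mathbb{K}$ with vertex condition for $\mathsf{C}$ is Koszul.
   Context: Zigzag algebra. Let $\Gamma$ be a finite, connected, simple graph. Let $Q$ be the double quiver of $\Gamma$: same vertices, and for each edge between $i$ and $j$ two arrows $i\to j$ and $j\to i$. Paths are composed from left to right, so $(i\to j)\cdot(j\to k)=(i\to j\to k)$; $e_i$ denotes the length-zero path at $i$. If $\Gamma$ has at least three vertices, $Z(\Gamma)$ is the quotient of the path algebra $\mathbb{K}Q$ by the relations $i\to j\to k=0$ for $i\neq k$, and $i\to j\to i=i\to k\to i$ for all neighbors $j,k$ of $i$. If $\Gamma$ has two vertices, $Z(\Gamma)$ is $\mathbb{K}Q$ modulo all paths of length three. In these cases put $x_i=i\to j\to i$ for any neighbor $j$ of $i$. If $\Gamma$ has one vertex $i$, $Z(\Gamma)=\mathbb{K}[x_i]/(x_i^2)$. In all cases $Z(\Gamma)$ has $\mathbb{K}$-basis consisting of all $e_i$, all $x_i$ and all arrows $i\to j$. It is graded with $e_i$ in degree $0$, arrows $i\to j$ in degree $1$ and $x_i$ in degree $2$. For a non-empty set $\mathsf{C}$ of vertices, $Z^{\mathsf{C}}(\Gamma)$ is the (graded) quotient of $Z(\Gamma)$ by the ideal generated by (equivalently, the span of) the elements $x_c$, $c\in\mathsf{C}$. Koszul. Let $R$ be a finite-dimensional, non-negatively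 graded algebra. A linear projective resolution of a graded $R$-module $M$ is an exact sequence $\cdots\to P_2\to P_1\to P_0\to M\to 0$ of graded modules and degree $0$ maps, with each $P_t$ graded projective and generated in degree $t$ (possibly $P_t=0$). $R$ is Koszul if its degree $0$ part is semisimple and each simple graded $R$-module concentrated in degree $0$ admits a linear projective resolution. Modules are left modules. *)

theory Defs
  imports "Graph_Theory.Pair_Digraph" "Graph_Theory.Vertex_Walk"
    "Graph_Theory.Digraph_Component" "HOL-Algebra.QuotRing" "HOL-Algebra.Module"
begin

section \<open>Graded algebras and graded left modules\<close>

text \<open>
  As in \<^locale>\<open>module\<close>, the ring multiplication and the unit of a record that is only used as
  a module are irrelevant.  For an algebra, \<^const>\<open>smult\<close> is the action of the ground field.
\<close>

record ('a, 'b) graded_module = "('a, 'b) module" +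
  grade :: "int \<Rightarrow> 'b set"

locale graded_abelian_group = abelian_group M
  for M :: "('a, 'b, 'c) graded_module_scheme" (structure) +
  assumes grade_subgroup: "subgroup (grade M n) (add_monoid M)"
    and grade_decomposition: "x \<in> carrier M \<Longrightarrow>
      \<exists>!c. (\<forall>n. c n \<in> grade M n) \<and> finite {n. c n \<noteq> \<zero>} \<and> x = (\<Oplus>n \<in> {n. c n \<noteq> \<zero>}. c n)"

locale graded_ring = ring A + graded_abelian_group A
  for A :: "('k, 'a, 'c) graded_module_scheme" (structure) +
  assumes one_grade: "\<one> \<in> grade A 0"
    and mult_grade: "\<lbrakk>a \<in> grade A m; b \<in> grade A n\<rbrakk> \<Longrightarrow> a \<otimes> b \<in> grade A (m + n)"

locale graded_algebra = K: field K + Module.module K A + graded_ring A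
  for K :: "('k, 'd) ring_scheme" and A :: "('k, 'a, 'c) graded_module_scheme" (structure) +
  assumes smult_mult_left: "\<lbrakk>k \<in> carrier K; a \<in> carrier A; b \<in> carrier A\<rbrakk> \<Longrightarrow>
      (k \<odot> a) \<otimes> b = k \<odot> (a \<otimes> b)"
    and smult_mult_right: "\<lbrakk>k \<in> carrier K; a \<in> carrier A; b \<in> carrier A\<rbrakk> \<Longrightarrow>
      a \<otimes> (k \<odot> b) = k \<odot> (a \<otimes> b)"
    and grade_subspace: "submodule (grade A n) K A"

definition finite_dimensional ::
    "('k, 'd) ring_scheme \<Rightarrow> ('k, 'a, 'c) module_scheme \<Rightarrow> bool" where
  "finite_dimensional K A \<longleftrightarrow>
    (\<exists>B. finite B \<and> B \<subseteq> carrier A \<and>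
      (\<forall>x \<in> carrier A. \<exists>c \<in> B \<rightarrow> carrier K. x = (\<Oplus>\<^bsub>A\<^esub>b \<in> B. c b \<odot>\<^bsub>A\<^esub> b)))"

definition nonneg_graded :: "('k, 'a, 'c) graded_module_scheme \<Rightarrow> bool" where
  "nonneg_graded A \<longleftrightarrow> (\<forall>n < 0. grade A n = {\<zero>\<^bsub>A\<^esub>})"

text \<open>The library locale \<^locale>\<open>module\<close> is restricted to commutative rings.\<close>

locale left_module = R: ring R + M: abelian_group M
  for R :: "('a, 'd) ring_scheme" (structure) and M :: "('a, 'b, 'c) module_scheme" (structure) +
  assumes smult_closed:
      "\<lbrakk>a \<in> carrier R; x \<in> carrier M\<rbrakk> \<Longrightarrow> a \<odot>\<^bsub>M\<^esub> x \<in> carrier M"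
    and smult_l_distr: "\<lbrakk>a \<in> carrier R; b \<in> carrier R; x \<in> carrier M\<rbrakk> \<Longrightarrow>
      (a \<oplus> b) \<odot>\<^bsub>M\<^esub> x = a \<odot>\<^bsub>M\<^esub> x \<oplus>\<^bsub>M\<^esub> b \<odot>\<^bsub>M\<^esub> x"
    and smult_r_distr: "\<lbrakk>a \<in> carrier R; x \<in> carrier M; y \<in> carrier M\<rbrakk> \<Longrightarrow>
      a \<odot>\<^bsub>M\<^esub> (x \<oplus>\<^bsub>M\<^esub> y) = a \<odot>\<^bsub>M\<^esub> x \<oplus>\<^bsub>M\<^esub> a \<odot>\<^bsub>M\<^esub> y"
    and smult_assoc: "\<lbrakk>a \<in> carrier R; b \<in> carrier R; x \<in> carrier M\<rbrakk> \<Longrightarrow>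
      (a \<otimes> b) \<odot>\<^bsub>M\<^esub> x = a \<odot>\<^bsub>M\<^esub> (b \<odot>\<^bsub>M\<^esub> x)"
    and smult_one: "x \<in> carrier M \<Longrightarrow> \<one> \<odot>\<^bsub>M\<^esub> x = x"

locale graded_left_module = R: graded_ring R + left_module R M + M: graded_abelian_group M
  for R :: "('k, 'a, 'd) graded_module_scheme" (structure)
    and M :: "('a, 'b, 'c) graded_module_scheme" (structure) +
  assumes smult_grade: "\<lbrakk>a \<in> grade R m; x \<in> grade M n\<rbrakk> \<Longrightarrow> a \<odot>\<^bsub>M\<^esub> x \<in> grade M (m + n)"

text \<open>Degree \<open>0\<close> homomorphisms of graded left modules.\<close>

definition graded_hom :: "('a, 'd) ring_scheme \<Rightarrow> ('a, 'b, 'e) graded_module_scheme \<Rightarrow>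
    ('a, 'c, 'f) graded_module_scheme \<Rightarrow> ('b \<Rightarrow> 'c) set" where
  "graded_hom R M N = {f \<in> hom (add_monoid M) (add_monoid N).
     (\<forall>a \<in> carrier R. \<forall>x \<in> carrier M. f (a \<odot>\<^bsub>M\<^esub> x) = a \<odot>\<^bsub>N\<^esub> f x) \<and>
     (\<forall>n. f ` grade M n \<subseteq> grade N n)}"

section \<open>Semisimplicity, simple modules, projective modules\<close>

definition regular_module :: "('a, 'd) ring_scheme \<Rightarrow> ('a, 'a) module" where
  "regular_module R = \<lparr>carrier = carrier R, mult = mult R, one = one R, zero = zero R,
     add = add R, smult = mult R\<rparr>"

definition semisimple_module ::
    "('a, 'd) ring_scheme \<Rightarrow> ('a, 'b, 'c) module_scheme \<Rightarrow> bool" where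
  "semisimple_module R M \<longleftrightarrow> left_module R M \<and>
     (\<forall>H. submodule H R M \<longrightarrow>
       (\<exists>H'. submodule H' R M \<and> H \<inter> H' = {\<zero>\<^bsub>M\<^esub>} \<and> H <+>\<^bsub>M\<^esub> H' = carrier M))"

definition semisimple_ring :: "('a, 'd) ring_scheme \<Rightarrow> bool" where
  "semisimple_ring R \<longleftrightarrow> ring R \<and> semisimple_module R (regular_module R)"

definition graded_submodule :: "'b set \<Rightarrow> ('k, 'a, 'd) graded_module_scheme \<Rightarrow>
    ('a, 'b, 'c) graded_module_scheme \<Rightarrow> bool" where
  "graded_submodule H R M \<longleftrightarrow> submodule H R M \<and>
     graded_left_module R (M\<lparr>carrier := H, grade := \<lambda>n. grade M n \<inter> H\<rparr>)"

definition simple_graded_module :: "('k, 'a, 'd) graded_module_scheme \<Rightarrow>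
    ('a, 'b, 'c) graded_module_scheme \<Rightarrow> bool" where
  "simple_graded_module R M \<longleftrightarrow> graded_left_module R M \<and> carrier M \<noteq> {\<zero>\<^bsub>M\<^esub>} \<and>
     (\<forall>H. graded_submodule H R M \<longrightarrow> H = {\<zero>\<^bsub>M\<^esub>} \<or> H = carrier M)"

definition concentrated_in_degree :: "int \<Rightarrow> ('a, 'b, 'c) graded_module_scheme \<Rightarrow> bool" where
  "concentrated_in_degree n M \<longleftrightarrow> (\<forall>m. m \<noteq> n \<longrightarrow> grade M m = {\<zero>\<^bsub>M\<^esub>})"

definition generated_in_degree :: "int \<Rightarrow> ('a, 'd) ring_scheme \<Rightarrow>
    ('a, 'b, 'c) graded_module_scheme \<Rightarrow> bool" where
  "generated_in_degree n R M \<longleftrightarrow>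
     (\<forall>H. submodule H R M \<and> grade M n \<subseteq> H \<longrightarrow> H = carrier M)"

text \<open>
  Projectivity is the lifting property against surjections \<open>M \<rightarrow> N\<close> of graded modules.
  A definition cannot quantify over types, so the elements of \<open>M\<close> and \<open>N\<close> are taken from two
  fixed types, chosen large enough to contain the free graded module on the homogeneous
  elements of \<open>P\<close>, and \<open>P\<close> itself, respectively.  This is no restriction: lemma
  \<open>graded_projective_lift\<close> below derives lifting against graded modules over arbitrary types.
\<close>

definition graded_projective :: "('k, 'a, 'd) graded_module_scheme \<Rightarrow>
    ('a, 'p) graded_module \<Rightarrow> bool" where
  "graded_projective R P \<longleftrightarrow> graded_left_module R P \<and>
     (\<forall>(M :: ('a, 'p \<Rightarrow> 'a) graded_module) (N :: ('a, 'p) graded_module) g f.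
       graded_left_module R M \<and> graded_left_module R N \<and>
       g \<in> graded_hom R M N \<and> g ` carrier M = carrier N \<and> f \<in> graded_hom R P N \<longrightarrow>
       (\<exists>h \<in> graded_hom R P M. \<forall>x \<in> carrier P. g (h x) = f x))"

section \<open>Free graded modules and the lifting property\<close>

lemma (in graded_abelian_group) grade_closed: "x \<in> grade M n \<Longrightarrow> x \<in> carrier M"
  using subgroup.subset[OF grade_subgroup] by auto

lemma (in graded_abelian_group) zero_grade: "\<zero> \<in> grade M n"
  using subgroup.one_closed[OF grade_subgroup] by simp

lemma (in graded_abelian_group) add_grade:
  "x \<in> grade M n \<Longrightarrow> y \<in> grade M n \<Longrightarrow> x \<oplus> y \<in> grade M n"
  using subgroup.m_closed[OF grade_subgroup] by simp

lemma (in graded_abelian_group) finsum_grade: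
  assumes "finite S" "\<And>i. i \<in> S \<Longrightarrow> c i \<in> grade M n"
  shows "(\<Oplus>i \<in> S. c i) \<in> grade M n"
  using assms
proof (induction S rule: finite_induct)
  case (insert i S)
  then have "c \<in> S \<rightarrow> carrier M" "c i \<in> carrier M" by (auto intro: grade_closed)
  then show ?case using insert by (simp add: add_grade)
qed (simp add: zero_grade)

definition component :: "('a, 'b, 'c) graded_module_scheme \<Rightarrow> 'b \<Rightarrow> int \<Rightarrow> 'b" where
  "component M x = (THE c. (\<forall>n. c n \<in> grade M n) \<and> finite {n. c n \<noteq> \<zero>\<^bsub>M\<^esub>} \<and>
     x = (\<Oplus>\<^bsub>M\<^esub>n \<in> {n. c n \<noteq> \<zero>\<^bsub>M\<^esub>}. c n))"

lemma (in graded_abelian_group) component: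
  assumes "x \<in> carrier M"
  shows component_grade: "component M x n \<in> grade M n"
    and finite_component: "finite {n. component M x n \<noteq> \<zero>}"
    and sum_component: "(\<Oplus>n \<in> {n. component M x n \<noteq> \<zero>}. component M x n) = x"
  using theI'[OF grade_decomposition[OF assms]] unfolding component_def by auto

lemma (in graded_abelian_group) component_unique:
  assumes c: "\<And>n. c n \<in> grade M n" and S: "finite S" "\<And>n. n \<notin> S \<Longrightarrow> c n = \<zero>"
    and x: "x = (\<Oplus>n \<in> S. c n)"
  shows "component M x = c"
proof -
  have cc: "c n \<in> carrier M" for n using c grade_closed by blast
  have "{n. c n \<noteq> \<zero>} \<subseteq> S" using S(2) by auto
  then have "(\<Oplus>n \<in> {n. c n \<noteq> \<zero>}. c n) = x" "finite {n. c n \<noteq> \<zero>}"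
    unfolding x using S(1) cc
    by (auto intro!: add.finprod_mono_neutral_cong_left finite_subset[of _ S])
  moreover have "x \<in> carrier M" unfolding x using cc by (simp add: Pi_def)
  ultimately show ?thesis
    unfolding component_def using c by (intro the1_equality grade_decomposition) auto
qed

lemma (in graded_abelian_group) component_homogeneous:
  assumes "x \<in> grade M n"
  shows "component M x = (\<lambda>m. if m = n then x else \<zero>)"
  by (rule component_unique[where S = "{n}"])
    (use assms grade_closed[OF assms] in \<open>auto simp: zero_grade\<close>)

lemma (in graded_abelian_group) grade_unique:
  assumes "x \<in> grade M m" "x \<in> grade M n" "x \<noteq> \<zero>"
  shows "m = n"
  using component_homogeneous[OF assms(1)] component_homogeneous[OF assms(2)] assms(3) by metis

lemma hom_add_finsum:
  assumes M: "abelian_group M" and N: "abelian_group N"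
    and f: "f \<in> hom (add_monoid M) (add_monoid N)"
    and S: "finite S" and c: "\<And>i. i \<in> S \<Longrightarrow> c i \<in> carrier M"
  shows "f (\<Oplus>\<^bsub>M\<^esub>i \<in> S. c i) = (\<Oplus>\<^bsub>N\<^esub>i \<in> S. f (c i))"
proof -
  interpret M: abelian_group M by (rule M)
  interpret N: abelian_group N by (rule N)
  interpret group_hom "add_monoid M" "add_monoid N" f
    by (intro group_hom.intro group_hom_axioms.intro f M.a_group N.a_group)
  show ?thesis using S c
  proof (induction S rule: finite_induct)
    case empty
    show ?case using hom_one by simp
  next
    case (insert i S)
    then have "c \<in> S \<rightarrow> carrier M" "c i \<in> carrier M" by auto
    moreover have "(\<lambda>i. f (c i)) \<in> S \<rightarrow> carrier N" "f (c i) \<in> carrier N"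
      using insert hom_closed by auto
    ultimately show ?case using insert hom_mult by simp
  qed
qed

lemma graded_homD:
  assumes "f \<in> graded_hom R M N"
  shows "f \<in> hom (add_monoid M) (add_monoid N)"
    and "x \<in> carrier M \<Longrightarrow> f x \<in> carrier N"
    and "x \<in> carrier M \<Longrightarrow> y \<in> carrier M \<Longrightarrow> f (x \<oplus>\<^bsub>M\<^esub> y) = f x \<oplus>\<^bsub>N\<^esub> f y"
    and "a \<in> carrier R \<Longrightarrow> x \<in> carrier M \<Longrightarrow> f (a \<odot>\<^bsub>M\<^esub> x) = a \<odot>\<^bsub>N\<^esub> f x"
    and "x \<in> grade M n \<Longrightarrow> f x \<in> grade N n"
  using assms unfolding graded_hom_def hom_def by (auto simp: Pi_def image_subset_iff)

lemma graded_hom_component: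
  assumes "graded_left_module R M" "graded_left_module R N" "f \<in> graded_hom R M N"
    and x: "x \<in> carrier M"
  shows "component N (f x) n = f (component M x n)"
proof -
  interpret M: graded_left_module R M by fact
  interpret N: graded_left_module R N by fact
  interpret group_hom "add_monoid M" "add_monoid N" f
    by (intro group_hom.intro group_hom_axioms.intro graded_homD(1)[OF assms(3)]
        M.M.a_group N.M.a_group)
  let ?c = "component M x"
  have "component N (f x) = (\<lambda>n. f (?c n))"
  proof (rule N.M.component_unique)
    show "f (?c n) \<in> grade N n" for n
      using graded_homD(5)[OF assms(3)] M.M.component_grade[OF x] by blast
    show "finite {n. ?c n \<noteq> \<zero>\<^bsub>M\<^esub>}" by (rule M.M.finite_component[OF x])
    show "f (?c n) = \<zero>\<^bsub>N\<^esub>" if "n \<notin> {n. ?c n \<noteq> \<zero>\<^bsub>M\<^esub>}" for n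
      using that hom_one by simp
    show "f x = (\<Oplus>\<^bsub>N\<^esub>n \<in> {n. ?c n \<noteq> \<zero>\<^bsub>M\<^esub>}. f (?c n))"
      using hom_add_finsum[OF M.M.abelian_group_axioms N.M.abelian_group_axioms
          graded_homD(1)[OF assms(3)] M.M.finite_component[OF x], of ?c]
        M.M.sum_component[OF x] M.M.grade_closed[OF M.M.component_grade[OF x]] by simp
  qed
  then show ?thesis by simp
qed

text \<open>The free graded module on a set \<open>B\<close> whose element \<open>b\<close> has degree \<open>\<delta> b\<close>.\<close>

definition free_graded_module :: "('k, 'a, 'd) graded_module_scheme \<Rightarrow> 'i set \<Rightarrow> ('i \<Rightarrow> int) \<Rightarrow>
    ('a, 'i \<Rightarrow> 'a) graded_module" where
  "free_graded_module R B \<delta> =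
     (let C = {\<phi>. (\<forall>b. \<phi> b \<in> carrier R) \<and> finite {b. \<phi> b \<noteq> \<zero>\<^bsub>R\<^esub>} \<and> {b. \<phi> b \<noteq> \<zero>\<^bsub>R\<^esub>} \<subseteq> B}
      in \<lparr>carrier = C, mult = undefined, one = undefined, zero = (\<lambda>b. \<zero>\<^bsub>R\<^esub>),
          add = (\<lambda>\<phi> \<psi> b. \<phi> b \<oplus>\<^bsub>R\<^esub> \<psi> b), smult = (\<lambda>a \<phi> b. a \<otimes>\<^bsub>R\<^esub> \<phi> b),
          grade = (\<lambda>n. {\<phi> \<in> C. \<forall>b. \<phi> b \<in> grade R (n - \<delta> b)})\<rparr>)"

context graded_ring
begin

lemma free_graded_module_sel:
  "carrier (free_graded_module A B \<delta>) =
     {\<phi>. (\<forall>b. \<phi> b \<in> carrier A) \<and> finite {b. \<phi> b \<noteq> \<zero>} \<and> {b. \<phi> b \<noteq> \<zero>} \<subseteq> B}"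
  "zero (free_graded_module A B \<delta>) = (\<lambda>b. \<zero>)"
  "add (free_graded_module A B \<delta>) = (\<lambda>\<phi> \<psi> b. \<phi> b \<oplus> \<psi> b)"
  "smult (free_graded_module A B \<delta>) = (\<lambda>a \<phi> b. a \<otimes> \<phi> b)"
  "grade (free_graded_module A B \<delta>) n =
     {\<phi> \<in> carrier (free_graded_module A B \<delta>). \<forall>b. \<phi> b \<in> grade A (n - \<delta> b)}"
  by (simp_all add: free_graded_module_def Let_def)

lemma free_add_closed:
  assumes "\<phi> \<in> carrier (free_graded_module A B \<delta>)" "\<psi> \<in> carrier (free_graded_module A B \<delta>)"
  shows "(\<lambda>b. \<phi> b \<oplus> \<psi> b) \<in> carrier (free_graded_module A B \<delta>)"
proof -
  have "{b. \<phi> b \<oplus> \<psi> b \<noteq> \<zero>} \<subseteq> {b. \<phi> b \<noteq> \<zero>} \<union> {b. \<psi> b \<noteq> \<zero>}" by auto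
  then show ?thesis using assms unfolding free_graded_module_sel
    by (auto intro: finite_subset)
qed

lemma free_neg_closed:
  assumes "\<phi> \<in> carrier (free_graded_module A B \<delta>)"
  shows "(\<lambda>b. \<ominus> \<phi> b) \<in> carrier (free_graded_module A B \<delta>)"
proof -
  have "{b. \<ominus> \<phi> b \<noteq> \<zero>} \<subseteq> {b. \<phi> b \<noteq> \<zero>}" by auto
  then show ?thesis using assms unfolding free_graded_module_sel
    by (auto intro: finite_subset)
qed

lemma free_smult_closed:
  assumes "a \<in> carrier A" "\<phi> \<in> carrier (free_graded_module A B \<delta>)"
  shows "(\<lambda>b. a \<otimes> \<phi> b) \<in> carrier (free_graded_module A B \<delta>)"
proof -
  have "{b. a \<otimes> \<phi> b \<noteq> \<zero>} \<subseteq> {b. \<phi> b \<noteq> \<zero>}" using assms(1) by auto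
  then show ?thesis using assms unfolding free_graded_module_sel
    by (auto intro: finite_subset)
qed

lemma free_abelian_group: "abelian_group (free_graded_module A B \<delta>)"
proof (rule abelian_groupI, goal_cases)
  case (1 x y)
  then show ?case using free_add_closed by (simp add: free_graded_module_sel(3))
next
  case (6 x)
  have "(\<lambda>b. \<ominus> x b) \<oplus>\<^bsub>free_graded_module A B \<delta>\<^esub> x = \<zero>\<^bsub>free_graded_module A B \<delta>\<^esub>"
    using 6 by (auto simp: free_graded_module_sel l_neg)
  then show ?case using free_neg_closed[OF 6] by blast
qed (auto simp: free_graded_module_sel fun_eq_iff a_ac)

lemma free_finsum:
  assumes "finite S" "\<And>i. i \<in> S \<Longrightarrow> c i \<in> carrier (free_graded_module A B \<delta>)"
  shows "(\<Oplus>\<^bsub>free_graded_module A B \<delta>\<^esub>i \<in> S. c i) b = (\<Oplus>i \<in> S. c i b)"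
proof -
  interpret F: abelian_group "free_graded_module A B \<delta>" by (rule free_abelian_group)
  show ?thesis using assms
  proof (induction S rule: finite_induct)
    case empty
    show ?case by (simp add: free_graded_module_sel)
  next
    case (insert i S)
    then have "c \<in> S \<rightarrow> carrier (free_graded_module A B \<delta>)"
      "(\<lambda>i. c i b) \<in> S \<rightarrow> carrier A" "c i b \<in> carrier A"
      by (auto simp: free_graded_module_sel)
    then show ?case using insert by (simp add: free_graded_module_sel(3))
  qed
qed

lemma free_graded_left_module: "graded_left_module A (free_graded_module A B \<delta>)"
proof -
  let ?F = "free_graded_module A B \<delta>"
  interpret F: abelian_group ?F by (rule free_abelian_group)
  have neg: "\<ominus>\<^bsub>?F\<^esub> x = (\<lambda>b. \<ominus> x b)" if "x \<in> carrier ?F" for x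
    using that free_neg_closed[OF that]
    by (intro F.minus_equality) (auto simp: free_graded_module_sel l_neg)
  have neg_grade: "\<ominus> x \<in> grade A n" if "x \<in> grade A n" for x n
    using subgroup.m_inv_closed[OF grade_subgroup that] by (simp add: a_inv_def)
  have sub: "subgroup (grade ?F n) (add_monoid ?F)" for n
  proof (rule group.subgroupI[OF F.a_group])
    have "\<zero>\<^bsub>?F\<^esub> \<in> grade ?F n" using F.zero_closed
      by (simp add: free_graded_module_sel(2,5) zero_grade)
    then show "grade ?F n \<noteq> {}" by auto
    show "inv\<^bsub>add_monoid ?F\<^esub> x \<in> grade ?F n" if "x \<in> grade ?F n" for x
    proof -
      have "x \<in> carrier ?F" using that unfolding free_graded_module_sel(5) by auto
      from neg[OF this] free_neg_closed[OF this] that show ?thesis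
        unfolding free_graded_module_sel(5) by (auto simp: a_inv_def[symmetric] neg_grade)
    qed
    show "x \<otimes>\<^bsub>add_monoid ?F\<^esub> y \<in> grade ?F n" if "x \<in> grade ?F n" "y \<in> grade ?F n" for x y
      using that free_add_closed[of x B \<delta> y] unfolding free_graded_module_sel(5)
      by (auto simp: free_graded_module_sel(3) add_grade)
  qed (auto simp: free_graded_module_sel(5))
  have dec: "\<exists>!c. (\<forall>n. c n \<in> grade ?F n) \<and> finite {n. c n \<noteq> \<zero>\<^bsub>?F\<^esub>} \<and>
      x = (\<Oplus>\<^bsub>?F\<^esub>n \<in> {n. c n \<noteq> \<zero>\<^bsub>?F\<^esub>}. c n)" if x: "x \<in> carrier ?F" for x
  proof -
    have xb: "x b \<in> carrier A" for b using x by (simp add: free_graded_module_sel)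
    have fin: "finite {b. x b \<noteq> \<zero>}" and xB: "{b. x b \<noteq> \<zero>} \<subseteq> B"
      using x by (auto simp: free_graded_module_sel)
    let ?c = "\<lambda>n b. component A (x b) (n - \<delta> b)"
    have c0: "component A \<zero> m = \<zero>" for m
      using component_homogeneous[OF zero_grade[of 0]] by simp
    have c: "?c n \<in> grade ?F n" for n
    proof -
      have "{b. ?c n b \<noteq> \<zero>} \<subseteq> {b. x b \<noteq> \<zero>}" using c0 by auto
      then have "finite {b. ?c n b \<noteq> \<zero>}" "{b. ?c n b \<noteq> \<zero>} \<subseteq> B"
        using fin xB by (auto intro: finite_subset)
      then show ?thesis using component_grade[OF xb] grade_closed
        unfolding free_graded_module_sel by blast
    qed
    have "{n. ?c n \<noteq> \<zero>\<^bsub>?F\<^esub>} \<subseteq>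
        (\<Union>b \<in> {b. x b \<noteq> \<zero>}. (\<lambda>m. m + \<delta> b) ` {m. component A (x b) m \<noteq> \<zero>})"
    proof
      fix n assume "n \<in> {n. ?c n \<noteq> \<zero>\<^bsub>?F\<^esub>}"
      then obtain b where b: "component A (x b) (n - \<delta> b) \<noteq> \<zero>"
        by (auto simp: free_graded_module_sel fun_eq_iff)
      then have "x b \<noteq> \<zero>" using c0 by auto
      moreover have "n = (n - \<delta> b) + \<delta> b" by simp
      ultimately show "n \<in> (\<Union>b \<in> {b. x b \<noteq> \<zero>}.
          (\<lambda>m. m + \<delta> b) ` {m. component A (x b) m \<noteq> \<zero>})" using b by blast
    qed
    then have finc: "finite {n. ?c n \<noteq> \<zero>\<^bsub>?F\<^esub>}"
      by (rule finite_subset) (use fin finite_component[OF xb] in auto)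
    have main: "x b = (\<Oplus>n \<in> S. c n b) \<longleftrightarrow> (\<forall>n. c n b = ?c n b)"
      if S: "finite S" "\<And>n. n \<notin> S \<Longrightarrow> c n b = \<zero>" and cg: "\<And>n. c n b \<in> grade A (n - \<delta> b)"
      for S c b
    proof -
      have inj: "inj_on (\<lambda>n. n - \<delta> b) S" by (auto simp: inj_on_def)
      have cl: "c n b \<in> carrier A" for n using cg grade_closed by blast
      have re: "(\<Oplus>m \<in> (\<lambda>n. n - \<delta> b) ` S. c (m + \<delta> b) b) = (\<Oplus>n \<in> S. c n b)"
        by (subst add.finprod_reindex[OF _ inj]) (use cl in auto)
      show ?thesis
      proof
        assume "x b = (\<Oplus>n \<in> S. c n b)"
        then have "component A (x b) = (\<lambda>m. c (m + \<delta> b) b)"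
        proof (intro component_unique[where S = "(\<lambda>n. n - \<delta> b) ` S"])
          show "c (m + \<delta> b) b \<in> grade A m" for m using cg[of "m + \<delta> b"] by simp
          show "c (m + \<delta> b) b = \<zero>" if "m \<notin> (\<lambda>n. n - \<delta> b) ` S" for m
          proof (rule S(2))
            show "m + \<delta> b \<notin> S" using that by (metis add_diff_cancel_right' imageI)
          qed
        qed (use S(1) re in simp_all)
        then show "\<forall>n. c n b = ?c n b" by simp
      next
        assume *: "\<forall>n. c n b = ?c n b"
        have "component A (x b) m = c (m + \<delta> b) b" for m using * by simp
        moreover have "{m. component A (x b) m \<noteq> \<zero>} \<subseteq> (\<lambda>n. n - \<delta> b) ` S"
        proof
          fix m assume "m \<in> {m. component A (x b) m \<noteq> \<zero>}"
          then have "c (m + \<delta> b) b \<noteq> \<zero>" using spec[OF *, of "m + \<delta> b"] by simp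
          then have "m + \<delta> b \<in> S" using S(2) by blast
          then show "m \<in> (\<lambda>n. n - \<delta> b) ` S" by (metis add_diff_cancel_right' imageI)
        qed
        ultimately have "(\<Oplus>m \<in> {m. component A (x b) m \<noteq> \<zero>}. component A (x b) m) =
            (\<Oplus>m \<in> (\<lambda>n. n - \<delta> b) ` S. c (m + \<delta> b) b)"
          using S(1) cl by (intro add.finprod_mono_neutral_cong_left) auto
        then show "x b = (\<Oplus>n \<in> S. c n b)" using sum_component[OF xb] re by simp
      qed
    qed
    show ?thesis
    proof (rule ex1I[of _ ?c], intro conjI allI)
      show "?c n \<in> grade ?F n" for n by (rule c)
      show "finite {n. ?c n \<noteq> \<zero>\<^bsub>?F\<^esub>}" by (rule finc)
      show "x = (\<Oplus>\<^bsub>?F\<^esub>n \<in> {n. ?c n \<noteq> \<zero>\<^bsub>?F\<^esub>}. ?c n)"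
      proof
        fix b
        have "x b = (\<Oplus>n \<in> {n. ?c n \<noteq> \<zero>\<^bsub>?F\<^esub>}. ?c n b)"
          by (subst main) (use finc component_grade[OF xb] in \<open>auto simp: free_graded_module_sel dest: fun_cong\<close>)
        also have "\<dots> = (\<Oplus>\<^bsub>?F\<^esub>n \<in> {n. ?c n \<noteq> \<zero>\<^bsub>?F\<^esub>}. ?c n) b"
          using finc c by (intro free_finsum[symmetric]) (auto simp: free_graded_module_sel(5))
        finally show "x b = (\<Oplus>\<^bsub>?F\<^esub>n \<in> {n. ?c n \<noteq> \<zero>\<^bsub>?F\<^esub>}. ?c n) b" .
      qed
    next
      fix c' assume c': "(\<forall>n. c' n \<in> grade ?F n) \<and> finite {n. c' n \<noteq> \<zero>\<^bsub>?F\<^esub>} \<and>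
          x = (\<Oplus>\<^bsub>?F\<^esub>n \<in> {n. c' n \<noteq> \<zero>\<^bsub>?F\<^esub>}. c' n)"
      have cg: "c' n \<in> grade ?F n" for n using c' by blast
      have S: "finite {n. c' n \<noteq> \<zero>\<^bsub>?F\<^esub>}" using c' by blast
      have x_eq: "x = (\<Oplus>\<^bsub>?F\<^esub>n \<in> {n. c' n \<noteq> \<zero>\<^bsub>?F\<^esub>}. c' n)" using c' by blast
      have "c' n b = ?c n b" for n b
      proof -
        have "x b = (\<Oplus>n \<in> {n. c' n \<noteq> \<zero>\<^bsub>?F\<^esub>}. c' n b)"
          using cg by (subst fun_cong[OF x_eq], intro free_finsum[OF S])
            (simp add: free_graded_module_sel(5))
        moreover have "c' n b = \<zero>" if "n \<notin> {n. c' n \<noteq> \<zero>\<^bsub>?F\<^esub>}" for n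
          using that by (simp add: free_graded_module_sel(2))
        moreover have "c' n b \<in> grade A (n - \<delta> b)" for n
          using cg[of n] by (simp add: free_graded_module_sel(5))
        ultimately show ?thesis using main[OF S, of c' b] by blast
      qed
      then show "c' = ?c" by (intro ext)
    qed
  qed
  interpret F: graded_abelian_group ?F
    by (intro graded_abelian_group.intro graded_abelian_group_axioms.intro free_abelian_group sub dec)
  show ?thesis
  proof (unfold_locales, goal_cases)
    case (1 a x)
    then show ?case using free_smult_closed by (simp add: free_graded_module_sel(4))
  next
    case (6 a m x n)
    have "a \<otimes> x b \<in> grade A (m + n - \<delta> b)" for b
      using mult_grade[OF 6(1), of "x b" "n - \<delta> b"] 6(2)
      by (simp add: free_graded_module_sel(5) add_diff_eq)
    moreover have "(\<lambda>b. a \<otimes> x b) \<in> carrier ?F"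
      using free_smult_closed[OF grade_closed[OF 6(1)]] F.grade_closed[OF 6(2)] .
    ultimately show ?case by (simp add: free_graded_module_sel(4,5))
  qed (auto simp: free_graded_module_sel l_distr r_distr m_assoc)
qed

end

definition free_extension :: "('k, 'a, 'd) graded_module_scheme \<Rightarrow>
    ('a, 'b, 'c) graded_module_scheme \<Rightarrow> ('i \<Rightarrow> 'b) \<Rightarrow> ('i \<Rightarrow> 'a) \<Rightarrow> 'b" where
  "free_extension R M m \<phi> = (\<Oplus>\<^bsub>M\<^esub>b \<in> {b. \<phi> b \<noteq> \<zero>\<^bsub>R\<^esub>}. \<phi> b \<odot>\<^bsub>M\<^esub> m b)"

context graded_left_module
begin

lemma smult_zero_left: "x \<in> carrier M \<Longrightarrow> \<zero> \<odot>\<^bsub>M\<^esub> x = \<zero>\<^bsub>M\<^esub>"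
  using smult_l_distr[of \<zero> \<zero> x] smult_closed[of \<zero> x]
  by (metis M.add.r_cancel_one' R.r_zero R.zero_closed)

lemma smult_zero_right: "a \<in> carrier R \<Longrightarrow> a \<odot>\<^bsub>M\<^esub> \<zero>\<^bsub>M\<^esub> = \<zero>\<^bsub>M\<^esub>"
  using smult_r_distr[of a "\<zero>\<^bsub>M\<^esub>" "\<zero>\<^bsub>M\<^esub>"] smult_closed[of a "\<zero>\<^bsub>M\<^esub>"]
  by (metis M.add.r_cancel_one' M.r_zero M.zero_closed)

lemma smult_finsum:
  assumes "a \<in> carrier R" "finite S" "\<And>i. i \<in> S \<Longrightarrow> c i \<in> carrier M"
  shows "a \<odot>\<^bsub>M\<^esub> (\<Oplus>\<^bsub>M\<^esub>i \<in> S. c i) = (\<Oplus>\<^bsub>M\<^esub>i \<in> S. a \<odot>\<^bsub>M\<^esub> c i)"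
  using assms(2,3)
proof (induction S rule: finite_induct)
  case empty
  show ?case using smult_zero_right[OF assms(1)] by simp
next
  case (insert i S)
  then have "c \<in> S \<rightarrow> carrier M" "c i \<in> carrier M"
    "(\<lambda>i. a \<odot>\<^bsub>M\<^esub> c i) \<in> S \<rightarrow> carrier M" "a \<odot>\<^bsub>M\<^esub> c i \<in> carrier M"
    using smult_closed[OF assms(1)] by auto
  then show ?case using insert smult_r_distr[OF assms(1)] by simp
qed

lemma free_extension_superset:
  assumes \<phi>: "\<phi> \<in> carrier (free_graded_module R B \<delta>)"
    and m: "\<And>b. b \<in> B \<Longrightarrow> m b \<in> carrier M"
    and S: "finite S" "S \<subseteq> B" "{b. \<phi> b \<noteq> \<zero>} \<subseteq> S"
  shows "free_extension R M m \<phi> = (\<Oplus>\<^bsub>M\<^esub>b \<in> S. \<phi> b \<odot>\<^bsub>M\<^esub> m b)"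
proof -
  have \<phi>b: "\<phi> b \<in> carrier R" for b using \<phi> by (simp add: R.free_graded_module_sel)
  show ?thesis unfolding free_extension_def
  proof (rule M.add.finprod_mono_neutral_cong_left[OF S(1,3)])
    show "\<phi> b \<odot>\<^bsub>M\<^esub> m b = \<zero>\<^bsub>M\<^esub>" if "b \<in> S - {b. \<phi> b \<noteq> \<zero>}" for b
    proof -
      have "\<phi> b = \<zero>" "m b \<in> carrier M" using that S(2) m by auto
      then show ?thesis by (simp add: smult_zero_left)
    qed
    show "(\<lambda>b. \<phi> b \<odot>\<^bsub>M\<^esub> m b) \<in> S \<rightarrow> carrier M"
      using S(2) smult_closed[OF \<phi>b m] by blast
  qed simp
qed

lemma free_extension_hom:
  assumes m: "\<And>b. b \<in> B \<Longrightarrow> m b \<in> grade M (\<delta> b)"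
  shows "free_extension R M m \<in> graded_hom R (free_graded_module R B \<delta>) M"
proof -
  let ?F = "free_graded_module R B \<delta>" and ?h = "free_extension R M m"
  interpret F: graded_left_module R ?F by (rule R.free_graded_left_module)
  have mc: "m b \<in> carrier M" if "b \<in> B" for b using m[OF that] M.grade_closed by blast
  have fin: "finite {b. \<phi> b \<noteq> \<zero>}" and sub: "{b. \<phi> b \<noteq> \<zero>} \<subseteq> B" and cl: "\<phi> b \<in> carrier R"
    if "\<phi> \<in> carrier ?F" for \<phi> b using that by (auto simp: R.free_graded_module_sel)
  have sm: "\<phi> b \<odot>\<^bsub>M\<^esub> m b \<in> carrier M" if "\<phi> \<in> carrier ?F" "b \<in> B" for \<phi> b
    using smult_closed[OF cl[OF that(1)] mc[OF that(2)]] .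
  have hc: "?h \<phi> \<in> carrier M" if "\<phi> \<in> carrier ?F" for \<phi>
    unfolding free_extension_def using sub[OF that] sm[OF that] by (intro M.finsum_closed) auto
  have "?h (\<phi> \<oplus>\<^bsub>?F\<^esub> \<psi>) = ?h \<phi> \<oplus>\<^bsub>M\<^esub> ?h \<psi>"
    if \<phi>: "\<phi> \<in> carrier ?F" and \<psi>: "\<psi> \<in> carrier ?F" for \<phi> \<psi>
  proof -
    let ?S = "{b. \<phi> b \<noteq> \<zero>} \<union> {b. \<psi> b \<noteq> \<zero>}"
    have S: "finite ?S" "?S \<subseteq> B" using fin sub \<phi> \<psi> by auto
    have "{b. (\<phi> \<oplus>\<^bsub>?F\<^esub> \<psi>) b \<noteq> \<zero>} \<subseteq> ?S" by (auto simp: R.free_graded_module_sel)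
    then have "?h (\<phi> \<oplus>\<^bsub>?F\<^esub> \<psi>) = (\<Oplus>\<^bsub>M\<^esub>b \<in> ?S. (\<phi> \<oplus>\<^bsub>?F\<^esub> \<psi>) b \<odot>\<^bsub>M\<^esub> m b)"
      using S mc F.M.a_closed[OF \<phi> \<psi>] by (intro free_extension_superset)
    also have "\<dots> = (\<Oplus>\<^bsub>M\<^esub>b \<in> ?S. \<phi> b \<odot>\<^bsub>M\<^esub> m b \<oplus>\<^bsub>M\<^esub> \<psi> b \<odot>\<^bsub>M\<^esub> m b)"
      using S sm[OF \<phi>] sm[OF \<psi>] cl[OF \<phi>] cl[OF \<psi>] mc
      by (intro M.finsum_cong') (auto simp: R.free_graded_module_sel(3) smult_l_distr)
    also have "\<dots> = (\<Oplus>\<^bsub>M\<^esub>b \<in> ?S. \<phi> b \<odot>\<^bsub>M\<^esub> m b) \<oplus>\<^bsub>M\<^esub> (\<Oplus>\<^bsub>M\<^esub>b \<in> ?S. \<psi> b \<odot>\<^bsub>M\<^esub> m b)"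
      using S sm[OF \<phi>] sm[OF \<psi>] by (intro M.finsum_addf) auto
    also have "(\<Oplus>\<^bsub>M\<^esub>b \<in> ?S. \<phi> b \<odot>\<^bsub>M\<^esub> m b) = ?h \<phi>"
      using S mc \<phi> by (intro free_extension_superset[symmetric]) auto
    also have "(\<Oplus>\<^bsub>M\<^esub>b \<in> ?S. \<psi> b \<odot>\<^bsub>M\<^esub> m b) = ?h \<psi>"
      using S mc \<psi> by (intro free_extension_superset[symmetric]) auto
    finally show ?thesis .
  qed
  moreover have "?h (a \<odot>\<^bsub>?F\<^esub> \<phi>) = a \<odot>\<^bsub>M\<^esub> ?h \<phi>" if a: "a \<in> carrier R" and \<phi>: "\<phi> \<in> carrier ?F" for a \<phi>
  proof -
    let ?S = "{b. \<phi> b \<noteq> \<zero>}"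
    have "{b. (a \<odot>\<^bsub>?F\<^esub> \<phi>) b \<noteq> \<zero>} \<subseteq> ?S" using a by (auto simp: R.free_graded_module_sel)
    then have "?h (a \<odot>\<^bsub>?F\<^esub> \<phi>) = (\<Oplus>\<^bsub>M\<^esub>b \<in> ?S. (a \<odot>\<^bsub>?F\<^esub> \<phi>) b \<odot>\<^bsub>M\<^esub> m b)"
      using fin[OF \<phi>] sub[OF \<phi>] mc F.smult_closed[OF a \<phi>] by (intro free_extension_superset)
    also have "\<dots> = (\<Oplus>\<^bsub>M\<^esub>b \<in> ?S. a \<odot>\<^bsub>M\<^esub> (\<phi> b \<odot>\<^bsub>M\<^esub> m b))"
      using a sub[OF \<phi>] cl[OF \<phi>] mc smult_closed[OF a sm[OF \<phi>]]
      by (intro M.finsum_cong') (auto simp: R.free_graded_module_sel(4) smult_assoc)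
    also have "\<dots> = a \<odot>\<^bsub>M\<^esub> ?h \<phi>" unfolding free_extension_def
      using fin[OF \<phi>] sub[OF \<phi>] sm[OF \<phi>] by (intro smult_finsum[OF a, symmetric]) auto
    finally show ?thesis .
  qed
  moreover have "?h \<phi> \<in> grade M n" if "\<phi> \<in> grade ?F n" for \<phi> n
  proof -
    have \<phi>: "\<phi> \<in> carrier ?F" and g: "\<phi> b \<in> grade R (n - \<delta> b)" for b
      using that by (auto simp: R.free_graded_module_sel(5))
    show ?thesis unfolding free_extension_def
    proof (rule M.finsum_grade[OF fin[OF \<phi>]])
      fix b assume "b \<in> {b. \<phi> b \<noteq> \<zero>}"
      then have "b \<in> B" using sub[OF \<phi>] by auto
      from smult_grade[OF g[of b] m[OF this]] show "\<phi> b \<odot>\<^bsub>M\<^esub> m b \<in> grade M n" by simp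
    qed
  qed
  ultimately show ?thesis using hc unfolding graded_hom_def hom_def by (auto simp: Pi_def image_subset_iff)
qed

end

lemma graded_hom_free_extension:
  assumes "graded_left_module R M" "graded_left_module R N" "g \<in> graded_hom R M N"
    and \<phi>: "\<phi> \<in> carrier (free_graded_module R B \<delta>)"
    and m: "\<And>b. b \<in> B \<Longrightarrow> m b \<in> carrier M"
  shows "g (free_extension R M m \<phi>) = free_extension R N (\<lambda>b. g (m b)) \<phi>"
proof -
  interpret M: graded_left_module R M by fact
  interpret N: graded_left_module R N by fact
  have fin: "finite {b. \<phi> b \<noteq> \<zero>\<^bsub>R\<^esub>}" and sub: "{b. \<phi> b \<noteq> \<zero>\<^bsub>R\<^esub>} \<subseteq> B" and cl: "\<phi> b \<in> carrier R" for b
    using \<phi> by (auto simp: M.R.free_graded_module_sel)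
  have "g (free_extension R M m \<phi>) = (\<Oplus>\<^bsub>N\<^esub>b \<in> {b. \<phi> b \<noteq> \<zero>\<^bsub>R\<^esub>}. g (\<phi> b \<odot>\<^bsub>M\<^esub> m b))"
    unfolding free_extension_def using sub M.smult_closed[OF cl m]
    by (intro hom_add_finsum[OF M.M.abelian_group_axioms N.M.abelian_group_axioms
          graded_homD(1)[OF assms(3)] fin]) auto
  also have "\<dots> = free_extension R N (\<lambda>b. g (m b)) \<phi>"
    unfolding free_extension_def
  proof (rule N.M.finsum_cong'[OF refl])
    have b: "b \<in> B" if "b \<in> {b. \<phi> b \<noteq> \<zero>\<^bsub>R\<^esub>}" for b using sub that by blast
    show "g (\<phi> b \<odot>\<^bsub>M\<^esub> m b) = \<phi> b \<odot>\<^bsub>N\<^esub> g (m b)" if "b \<in> {b. \<phi> b \<noteq> \<zero>\<^bsub>R\<^esub>}" for b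
      by (rule graded_homD(4)[OF assms(3) cl m[OF b[OF that]]])
    show "(\<lambda>b. \<phi> b \<odot>\<^bsub>N\<^esub> g (m b)) \<in> {b. \<phi> b \<noteq> \<zero>\<^bsub>R\<^esub>} \<rightarrow> carrier N"
    proof (rule Pi_I)
      fix b assume "b \<in> {b. \<phi> b \<noteq> \<zero>\<^bsub>R\<^esub>}"
      from graded_homD(2)[OF assms(3) m[OF b[OF this]]]
      show "\<phi> b \<odot>\<^bsub>N\<^esub> g (m b) \<in> carrier N" by (rule N.smult_closed[OF cl])
    qed
  qed
  finally show ?thesis .
qed

lemma graded_projective_lift:
  assumes P: "graded_projective R P"
    and M: "graded_left_module R M" and N: "graded_left_module R N"
    and g: "g \<in> graded_hom R M N" "g ` carrier M = carrier N" and f: "f \<in> graded_hom R P N"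
  shows "\<exists>h \<in> graded_hom R P M. \<forall>x \<in> carrier P. g (h x) = f x"
proof -
  interpret P: graded_left_module R P using P unfolding graded_projective_def by blast
  interpret M: graded_left_module R M by (rule M)
  interpret N: graded_left_module R N by (rule N)
  let ?B = "{p. p \<noteq> \<zero>\<^bsub>P\<^esub> \<and> (\<exists>n. p \<in> grade P n)}"
  define \<delta> where "\<delta> p = (THE n. p \<in> grade P n)" for p
  have \<delta>: "p \<in> grade P (\<delta> p)" if p: "p \<in> ?B" for p
  proof -
    obtain n where n: "p \<in> grade P n" "p \<noteq> \<zero>\<^bsub>P\<^esub>" using p by blast
    have "(THE n. p \<in> grade P n) = n"
      by (rule the_equality) (use n P.M.grade_unique[of p] in auto)
    then show ?thesis using n(1) by (simp add: \<delta>_def)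
  qed
  define F where "F = free_graded_module R ?B \<delta>"
  have F: "graded_left_module R F" unfolding F_def by (rule P.R.free_graded_left_module)
  interpret F: graded_left_module R F by (rule F)
  let ?\<pi> = "free_extension R P (\<lambda>p. p)"
  have \<pi>: "?\<pi> \<in> graded_hom R F P" unfolding F_def by (rule P.free_extension_hom) (rule \<delta>)
  have hit: "p \<in> ?\<pi> ` carrier F" if "p \<in> grade P n" for p n
  proof (cases "p = \<zero>\<^bsub>P\<^esub>")
    case True
    have "?\<pi> \<zero>\<^bsub>F\<^esub> = \<zero>\<^bsub>P\<^esub>" unfolding free_extension_def F_def
      by (simp add: P.R.free_graded_module_sel)
    then show ?thesis using True F.M.zero_closed by force
  next
    case False
    then have pB: "p \<in> ?B" using that by auto
    let ?\<phi> = "\<lambda>q. if q = p then \<one>\<^bsub>R\<^esub> else \<zero>\<^bsub>R\<^esub>"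
    have pc: "p \<in> carrier P" using that P.M.grade_closed by blast
    have sub: "{q. ?\<phi> q \<noteq> \<zero>\<^bsub>R\<^esub>} \<subseteq> {p}" by auto
    then have \<phi>: "?\<phi> \<in> carrier F" unfolding F_def P.R.free_graded_module_sel
      using pB by (auto intro: finite_subset)
    have "?\<pi> ?\<phi> = (\<Oplus>\<^bsub>P\<^esub>q \<in> {p}. ?\<phi> q \<odot>\<^bsub>P\<^esub> q)"
      by (rule P.free_extension_superset[OF \<phi>[unfolded F_def]])
        (use pB sub in \<open>auto intro: P.M.grade_closed\<close>)
    also have "\<dots> = p" using pc P.smult_one[OF pc] by simp
    finally show ?thesis using \<phi> by (metis imageI)
  qed
  have surj: "?\<pi> ` carrier F = carrier P"
  proof
    show "?\<pi> ` carrier F \<subseteq> carrier P" using graded_homD(2)[OF \<pi>] by blast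
    have sum: "(\<Oplus>\<^bsub>P\<^esub>i \<in> S. c i) \<in> ?\<pi> ` carrier F"
      if fin: "finite S" and cg: "\<And>i. c i \<in> grade P i" for S c
      using fin
    proof (induction S rule: finite_induct)
      case empty
      then show ?case using hit[OF P.M.zero_grade] by simp
    next
      case (insert i S)
      obtain x y where "x \<in> carrier F" "y \<in> carrier F" "c i = ?\<pi> x" "(\<Oplus>\<^bsub>P\<^esub>i \<in> S. c i) = ?\<pi> y"
        using insert.IH hit[OF cg] by blast
      moreover have "c \<in> S \<rightarrow> carrier P" "c i \<in> carrier P" using cg P.M.grade_closed by blast+
      ultimately have "(\<Oplus>\<^bsub>P\<^esub>i \<in> insert i S. c i) = ?\<pi> (x \<oplus>\<^bsub>F\<^esub> y)"
        using insert.hyps graded_homD(3)[OF \<pi>] by simp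
      then show ?case using \<open>x \<in> carrier F\<close> \<open>y \<in> carrier F\<close> by blast
    qed
    show "carrier P \<subseteq> ?\<pi> ` carrier F"
    proof
      fix x assume x: "x \<in> carrier P"
      show "x \<in> ?\<pi> ` carrier F"
        using sum[OF P.M.finite_component[OF x] P.M.component_grade[OF x]]
        by (simp add: P.M.sum_component[OF x])
    qed
  qed
  have id: "(\<lambda>x. x) \<in> graded_hom R P P" unfolding graded_hom_def hom_def by auto
  obtain s where s: "s \<in> graded_hom R P F" "\<forall>x \<in> carrier P. ?\<pi> (s x) = x"
    using P \<pi> surj id F P.graded_left_module_axioms unfolding graded_projective_def by blast
  have "\<exists>y \<in> grade M (\<delta> p). g y = f p" if p: "p \<in> ?B" for p
  proof -
    have fp: "f p \<in> grade N (\<delta> p)" using graded_homD(5)[OF f \<delta>[OF p]] .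
    then obtain y where y: "y \<in> carrier M" "g y = f p" using g(2) N.M.grade_closed by (metis imageE)
    have "g (component M y (\<delta> p)) = component N (f p) (\<delta> p)"
      using graded_hom_component[OF M N g(1) y(1)] y(2) by simp
    also have "\<dots> = f p" using N.M.component_homogeneous[OF fp] by simp
    finally show ?thesis using M.M.component_grade[OF y(1)] by blast
  qed
  then have "\<forall>p \<in> ?B. \<exists>y. y \<in> grade M (\<delta> p) \<and> g y = f p" by blast
  from bchoice[OF this] obtain m
    where m: "\<And>p. p \<in> ?B \<Longrightarrow> m p \<in> grade M (\<delta> p)" "\<And>p. p \<in> ?B \<Longrightarrow> g (m p) = f p"
    by blast
  let ?h = "free_extension R M m"
  have h: "?h \<in> graded_hom R F M" unfolding F_def by (rule M.free_extension_hom) (rule m(1))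
  show ?thesis
  proof (rule bexI[of _ "\<lambda>x. ?h (s x)"], intro ballI)
    fix x assume x: "x \<in> carrier P"
    then have sx: "s x \<in> carrier F" using graded_homD(2)[OF s(1)] by blast
    have "g (?h (s x)) = free_extension R N (\<lambda>b. g (m b)) (s x)"
      by (rule graded_hom_free_extension[OF M N g(1) sx[unfolded F_def]])
        (rule M.M.grade_closed[OF m(1)])
    also have "\<dots> = free_extension R N f (s x)"
    proof -
      have sub: "{b. s x b \<noteq> \<zero>\<^bsub>R\<^esub>} \<subseteq> ?B" and cl: "s x b \<in> carrier R" for b
        using sx unfolding F_def P.R.free_graded_module_sel by auto
      have fN: "f b \<in> carrier N" if "b \<in> ?B" for b
        using graded_homD(2)[OF f] P.M.grade_closed[OF \<delta>[OF that]] by blast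
      show ?thesis unfolding free_extension_def
      proof (rule N.M.finsum_cong'[OF refl])
        show "s x b \<odot>\<^bsub>N\<^esub> g (m b) = s x b \<odot>\<^bsub>N\<^esub> f b" if "b \<in> {b. s x b \<noteq> \<zero>\<^bsub>R\<^esub>}" for b
          using m(2)[OF subsetD[OF sub that]] by simp
        show "(\<lambda>b. s x b \<odot>\<^bsub>N\<^esub> f b) \<in> {b. s x b \<noteq> \<zero>\<^bsub>R\<^esub>} \<rightarrow> carrier N"
        proof (rule Pi_I)
          fix b assume "b \<in> {b. s x b \<noteq> \<zero>\<^bsub>R\<^esub>}"
          from fN[OF subsetD[OF sub this]]
          show "s x b \<odot>\<^bsub>N\<^esub> f b \<in> carrier N" by (rule N.smult_closed[OF cl])
        qed
      qed
    qed
    also have "\<dots> = f (?\<pi> (s x))"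
      by (rule graded_hom_free_extension[OF P.graded_left_module_axioms N f sx[unfolded F_def],
            symmetric]) (rule P.M.grade_closed[OF \<delta>])
    also have "\<dots> = f x" using s(2) x by simp
    finally show "g (?h (s x)) = f x" .
  next
    show "(\<lambda>x. ?h (s x)) \<in> graded_hom R P M"
      using graded_homD[OF s(1)] graded_homD[OF h]
      unfolding graded_hom_def hom_def by (auto simp: Pi_def image_subset_iff)
  qed
qed

section \<open>Koszul algebras\<close>

text \<open>\<open>\<dots> \<rightarrow> P 2 \<rightarrow> P 1 \<rightarrow> P 0 \<rightarrow> M \<rightarrow> 0\<close> with maps \<open>d t : P (t + 1) \<rightarrow> P t\<close> and \<open>e : P 0 \<rightarrow> M\<close>.\<close>

definition linear_projective_resolution :: "('k, 'a, 'd) graded_module_scheme \<Rightarrow>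
    ('a, 'm) graded_module \<Rightarrow> (nat \<Rightarrow> ('a, 'p) graded_module) \<Rightarrow> (nat \<Rightarrow> 'p \<Rightarrow> 'p) \<Rightarrow>
    ('p \<Rightarrow> 'm) \<Rightarrow> bool" where
  "linear_projective_resolution R M P d e \<longleftrightarrow>
     (\<forall>t. graded_projective R (P t) \<and> generated_in_degree (int t) R (P t)) \<and>
     (\<forall>t. d t \<in> graded_hom R (P (Suc t)) (P t)) \<and>
     e \<in> graded_hom R (P 0) M \<and>
     e ` carrier (P 0) = carrier M \<and>
     d 0 ` carrier (P 1) = {x \<in> carrier (P 0). e x = \<zero>\<^bsub>M\<^esub>} \<and>
     (\<forall>t. d (Suc t) ` carrier (P (Suc (Suc t))) =
        {x \<in> carrier (P (Suc t)). d t x = \<zero>\<^bsub>P t\<^esub>})"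

text \<open>
  The argument \<open>TYPE('s)\<close> is the type over which the simple modules range; in a theorem it is
  a free type variable, so that all simple modules are covered.

  The modules of the resolution are carried by sequences of elements of \<open>A\<close>.  As \<open>A\<close> is
  finite-dimensional, this is no restriction: if a simple module concentrated in degree \<open>0\<close> has
  a linear projective resolution at all, then its minimal graded projective resolution is
  linear, and the terms of the latter are direct summands of modules \<open>A\<^sup>n\<close> with shifted grading.
\<close>

definition koszul :: "'s itself \<Rightarrow> ('k, 'd) ring_scheme \<Rightarrow>
    ('k, 'a, 'c) graded_module_scheme \<Rightarrow> bool" where
  "koszul TYPE('s) K A \<longleftrightarrow>
     graded_algebra K A \<and> finite_dimensional K A \<and> nonneg_graded A \<and>
     semisimple_ring (A\<lparr>carrier := grade A 0\<rparr>) \<and>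
     (\<forall>S :: ('a, 's) graded_module.
        simple_graded_module A S \<and> concentrated_in_degree 0 S \<longrightarrow>
        (\<exists>(P :: nat \<Rightarrow> ('a, nat \<Rightarrow> 'a) graded_module) d e.
           linear_projective_resolution A S P d e))"

section \<open>Path algebras and quotients\<close>

text \<open>
  In a quiver without multiple arrows, a path is determined by the list of vertices it passes
  through; in particular \<open>[i]\<close> is the path \<open>e\<^sub>i\<close>.  The value of a product at \<open>p\<close> is the sum over all
  ways to cut \<open>p\<close> at one of its vertices into an initial path and a final path.  All arrows are
  given the same degree \<open>w\<close>.
\<close>

definition path_algebra :: "('k, 'd) ring_scheme \<Rightarrow> int \<Rightarrow> 'v pair_pre_digraph \<Rightarrow>
    ('k, 'v list \<Rightarrow> 'k) graded_module" where
  "path_algebra K w Q =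
     (let C = {f. (\<forall>p. f p \<in> carrier K) \<and> finite {p. f p \<noteq> \<zero>\<^bsub>K\<^esub>} \<and>
                  (\<forall>p. f p \<noteq> \<zero>\<^bsub>K\<^esub> \<longrightarrow> vwalk p (with_proj Q))}
      in \<lparr>carrier = C,
          mult = (\<lambda>f g p. \<Oplus>\<^bsub>K\<^esub>n \<in> {..<length p}. f (take (Suc n) p) \<otimes>\<^bsub>K\<^esub> g (drop n p)),
          one = (\<lambda>p. if \<exists>i \<in> pverts Q. p = [i] then \<one>\<^bsub>K\<^esub> else \<zero>\<^bsub>K\<^esub>),
          zero = (\<lambda>p. \<zero>\<^bsub>K\<^esub>),
          add = (\<lambda>f g p. f p \<oplus>\<^bsub>K\<^esub> g p),
          smult = (\<lambda>k f p. k \<otimes>\<^bsub>K\<^esub> f p),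
          grade = (\<lambda>n. {f \<in> C. \<forall>p. f p \<noteq> \<zero>\<^bsub>K\<^esub> \<longrightarrow> w * int (vwalk_length p) = n})\<rparr>)"

definition path_element :: "('k, 'd) ring_scheme \<Rightarrow> 'v list \<Rightarrow> 'v list \<Rightarrow> 'k" where
  "path_element K p = (\<lambda>q. if q = p then \<one>\<^bsub>K\<^esub> else \<zero>\<^bsub>K\<^esub>)"

definition quotient_algebra :: "('k, 'a, 'c) graded_module_scheme \<Rightarrow> 'a set \<Rightarrow>
    ('k, 'a set) graded_module" where
  "quotient_algebra A I =
     \<lparr>carrier = carrier (A Quot I), mult = mult (A Quot I), one = one (A Quot I),
      zero = zero (A Quot I), add = add (A Quot I),
      smult = (\<lambda>k X. \<Union>x \<in> X. I +>\<^bsub>A\<^esub> (k \<odot>\<^bsub>A\<^esub> x)),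
      grade = (\<lambda>n. (\<lambda>x. I +>\<^bsub>A\<^esub> x) ` grade A n)\<rparr>"

section \<open>Zigzag algebras\<close>

text \<open>
  A \<^locale>\<open>pair_graph\<close> is a finite simple graph, given as a symmetric loop-free digraph, which
  thus is its own double quiver.  If the graph has a single vertex \<open>i\<close>, a loop at \<open>i\<close> of degree \<open>2\<close>
  is added: its path algebra is the polynomial ring in the variable \<open>x\<^sub>i\<close>, the path \<open>[i, i]\<close>.
\<close>

definition zigzag_quiver :: "'v pair_pre_digraph \<Rightarrow> 'v pair_pre_digraph" where
  "zigzag_quiver G =
     (if card (pverts G) = 1 then G\<lparr>parcs := Id_on (pverts G)\<rparr> else G)"

definition zigzag_path_algebra :: "('k, 'd) ring_scheme \<Rightarrow> 'v pair_pre_digraph \<Rightarrow>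
    ('k, 'v list \<Rightarrow> 'k) graded_module" where
  "zigzag_path_algebra K G =
     path_algebra K (if card (pverts G) = 1 then 2 else 1) (zigzag_quiver G)"

definition zigzag_relations :: "('k, 'd) ring_scheme \<Rightarrow> 'v pair_pre_digraph \<Rightarrow>
    ('v list \<Rightarrow> 'k) set" where
  "zigzag_relations K G =
     (if card (pverts G) = 1 then {path_element K [i, i, i] | i. i \<in> pverts G}
      else if card (pverts G) = 2 then
        {path_element K p | p. vwalk p (with_proj G) \<and> vwalk_length p = 3}
      else
        {path_element K [i, j, k] | i j k. (i, j) \<in> parcs G \<and> (j, k) \<in> parcs G \<and> i \<noteq> k} \<union>
        {path_element K [i, j, i] \<ominus>\<^bsub>zigzag_path_algebra K G\<^esub> path_element K [i, k, i] | i j k.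
           (i, j) \<in> parcs G \<and> (i, k) \<in> parcs G})"

definition zigzag_ideal :: "('k, 'd) ring_scheme \<Rightarrow> 'v pair_pre_digraph \<Rightarrow>
    ('v list \<Rightarrow> 'k) set" where
  "zigzag_ideal K G = genideal (zigzag_path_algebra K G) (zigzag_relations K G)"

definition zigzag_algebra :: "('k, 'd) ring_scheme \<Rightarrow> 'v pair_pre_digraph \<Rightarrow>
    ('k, ('v list \<Rightarrow> 'k) set) graded_module" where
  "zigzag_algebra K G = quotient_algebra (zigzag_path_algebra K G) (zigzag_ideal K G)"

text \<open>
  The set of all representatives \<open>i \<rightarrow> j \<rightarrow> i\<close> of \<open>x\<^sub>i\<close>; their classes in the zigzag algebra coincide.
\<close>

definition zigzag_loop_paths :: "'v pair_pre_digraph \<Rightarrow> 'v \<Rightarrow> 'v list set" where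
  "zigzag_loop_paths G i =
     (if card (pverts G) = 1 then {[i, i]} else {[i, j, i] | j. (i, j) \<in> parcs G})"

definition zigzag_vertex_ideal :: "('k, 'd) ring_scheme \<Rightarrow> 'v pair_pre_digraph \<Rightarrow> 'v set \<Rightarrow>
    ('v list \<Rightarrow> 'k) set set" where
  "zigzag_vertex_ideal K G C = genideal (zigzag_algebra K G)
     {zigzag_ideal K G +>\<^bsub>zigzag_path_algebra K G\<^esub> path_element K p | p c.
        c \<in> C \<and> p \<in> zigzag_loop_paths G c}"

definition zigzag_algebra_vc :: "('k, 'd) ring_scheme \<Rightarrow> 'v pair_pre_digraph \<Rightarrow> 'v set \<Rightarrow>
    ('k, ('v list \<Rightarrow> 'k) set set) graded_module" where
  "zigzag_algebra_vc K G C = quotient_algebra (zigzag_algebra K G) (zigzag_vertex_ideal K G C)"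

end

theory Submission
  imports Defs "HOL-Library.Countable_Set"
begin

text \<open>
  Fix coordinates: the zigzag algebra with vertex condition has as basis the vertices \<open>e\<^sub>i\<close>, the
  arrows and the loops \<open>x\<^sub>i\<close> with \<open>i\<close> outside \<open>C\<close>.  Since the graph is connected and \<open>C\<close> is not
  empty, each vertex \<open>i\<close> outside \<open>C\<close> has a neighbour \<open>parent i\<close> that is closer to \<open>C\<close>.  The Koszul
  dual has one quadratic relation at each such \<open>i\<close>, namely that the sum of all \<open>i \<rightarrow> j \<rightarrow> i\<close>
  vanishes; taking \<open>i \<rightarrow> parent i \<rightarrow> i\<close> as its leading term gives a basis of normal words, because
  leading terms do not overlap: \<open>parent (parent i) \<noteq> i\<close>.  The normal words ending at \<open>r\<close> index
  a linear complex of modules \<open>A e\<^sub>i\<close> that resolves the simple module at \<open>r\<close>.  Its differential has an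
  explicit formula with at most two terms on each generator, and its exactness is a coordinate
  computation which uses of \<open>parent\<close> only that it has no two-cycles.
\<close>

text \<open>The single arrow from \<open>hd w\<close> to \<open>hd (tl w)\<close> does not define a
  complex: for a word \<open>q # j # q # a\<close> with \<open>q\<close> outside \<open>C\<close>,
  two such steps multiply to x_q, which is not 0. The correction subtracts the detour through
  \<open>parent q\<close>; a correction made for one word can in turn spoil the square for a longer
  word, whence the recursion in \<open>correction\<close>. Exactness survives because the
  corrections are triangular: a correction term \<open>z\<close> of \<open>w\<close> always makes
  \<open>hd w # z\<close> an excluded word, whereas \<open>hd w # tl w\<close> is a word. So
  coordinates are eliminated one after another and no matrix has to be inverted. A nonempty
  \<open>C\<close> is what makes \<open>parent\<close> possible. In a finite graph a walk along
  parents that never stops must enter a cycle, and in a tree only a two-cycle is available. Here the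
  walk stops at \<open>C\<close>, and the decreasing distance to \<open>C\<close> rules out
  two-cycles. Coordinates are chosen because the algebra is a quotient of a quotient of a path
  algebra, so that its elements are sets of sets of functions; an isomorphism onto functions on the
  basis keeps cosets out of the homological part.\<close>

no_notation vwalk_join (infixr "\<oplus>" 65)

section \<open>A coordinate model of zigzag algebras\<close>

datatype 'v zbasis = Vertex 'v | Arrow 'v 'v | Loop 'v

primrec zdegree :: "'v zbasis \<Rightarrow> int" where
  "zdegree (Vertex i) = 0"
| "zdegree (Arrow i j) = 1"
| "zdegree (Loop i) = 2"

definition zigzag_basis :: "'v pair_pre_digraph \<Rightarrow> 'v set \<Rightarrow> 'v zbasis set" where
  "zigzag_basis G C = Vertex ` pverts G \<union> case_prod Arrow ` parcs G \<union> Loop ` (pverts G - C)"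

text \<open>The guard in the loop case imposes x_c = 0 for \<open>c\<close> in \<open>C\<close>. In
  the other cases the coordinates of the factors already vanish outside the basis. A product of
  arrows from \<open>i\<close> to \<open>j\<close> to \<open>k\<close> with
  \<open>k \<noteq> i\<close> has no coordinate to land in, which makes it 0.\<close>

definition zigzag_mult :: "('k, 'd) ring_scheme \<Rightarrow> 'v pair_pre_digraph \<Rightarrow> 'v set \<Rightarrow>
    ('v zbasis \<Rightarrow> 'k) \<Rightarrow> ('v zbasis \<Rightarrow> 'k) \<Rightarrow> 'v zbasis \<Rightarrow> 'k" where
  "zigzag_mult K G C f g b = (case b of
     Vertex i \<Rightarrow> f b \<otimes>\<^bsub>K\<^esub> g b
   | Arrow i j \<Rightarrow> f (Vertex i) \<otimes>\<^bsub>K\<^esub> g b \<oplus>\<^bsub>K\<^esub> f b \<otimes>\<^bsub>K\<^esub> g (Vertex j)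
   | Loop i \<Rightarrow> (if i \<in> pverts G - C
       then f (Vertex i) \<otimes>\<^bsub>K\<^esub> g b \<oplus>\<^bsub>K\<^esub> f b \<otimes>\<^bsub>K\<^esub> g (Vertex i) \<oplus>\<^bsub>K\<^esub>
         (\<Oplus>\<^bsub>K\<^esub>j \<in> {j. (i, j) \<in> parcs G}. f (Arrow i j) \<otimes>\<^bsub>K\<^esub> g (Arrow j i))
       else \<zero>\<^bsub>K\<^esub>))"

definition zigzag_model :: "('k, 'd) ring_scheme \<Rightarrow> 'v pair_pre_digraph \<Rightarrow> 'v set \<Rightarrow>
    ('k, 'v zbasis \<Rightarrow> 'k) graded_module" where
  "zigzag_model K G C =
     (let B = {f. (\<forall>b. f b \<in> carrier K) \<and> (\<forall>b. b \<notin> zigzag_basis G C \<longrightarrow> f b = \<zero>\<^bsub>K\<^esub>)}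
      in \<lparr>carrier = B, mult = zigzag_mult K G C,
          one = (\<lambda>b. if b \<in> Vertex ` pverts G then \<one>\<^bsub>K\<^esub> else \<zero>\<^bsub>K\<^esub>),
          zero = (\<lambda>b. \<zero>\<^bsub>K\<^esub>),
          add = (\<lambda>f g b. f b \<oplus>\<^bsub>K\<^esub> g b),
          smult = (\<lambda>k f b. k \<otimes>\<^bsub>K\<^esub> f b),
          grade = (\<lambda>n. {f \<in> B. \<forall>b. f b \<noteq> \<zero>\<^bsub>K\<^esub> \<longrightarrow> zdegree b = n})\<rparr>)"

locale zigzag_graph = field K for K :: "('k, 'd) ring_scheme" (structure) +
  fixes G :: "'v pair_pre_digraph"
  assumes finite_verts: "finite (pverts G)"
    and arcs_in_verts: "(i, j) \<in> parcs G \<Longrightarrow> i \<in> pverts G \<and> j \<in> pverts G"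
    and arc_sym: "(i, j) \<in> parcs G \<Longrightarrow> (j, i) \<in> parcs G"
    and arc_irrefl: "(i, i) \<notin> parcs G"
begin

abbreviation Z :: "'v set \<Rightarrow> ('k, 'v zbasis \<Rightarrow> 'k) graded_module" where
  "Z C \<equiv> zigzag_model K G C"

section \<open>Ring structure, scalars and grading of the model\<close>

lemma finite_nbrs: "finite {j. (i, j) \<in> parcs G}"
  using finite_verts arcs_in_verts by (auto intro: finite_subset)

lemma finite_arcs: "finite (parcs G)"
  by (rule finite_subset[of _ "pverts G \<times> pverts G"]) (use finite_verts arcs_in_verts in auto)

lemma finite_basis: "finite (zigzag_basis G C)"
  unfolding zigzag_basis_def using finite_verts finite_arcs by auto

lemma basis_iff [simp]:
  "Vertex i \<in> zigzag_basis G C \<longleftrightarrow> i \<in> pverts G"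
  "Arrow i j \<in> zigzag_basis G C \<longleftrightarrow> (i, j) \<in> parcs G"
  "Loop i \<in> zigzag_basis G C \<longleftrightarrow> i \<in> pverts G \<and> i \<notin> C"
  unfolding zigzag_basis_def by auto

lemma model_sel:
  "carrier (Z C) = {f. (\<forall>b. f b \<in> carrier K) \<and> (\<forall>b. b \<notin> zigzag_basis G C \<longrightarrow> f b = \<zero>)}"
  "mult (Z C) = zigzag_mult K G C"
  "one (Z C) = (\<lambda>b. if b \<in> Vertex ` pverts G then \<one> else \<zero>)"
  "zero (Z C) = (\<lambda>b. \<zero>)"
  "add (Z C) = (\<lambda>f g b. f b \<oplus> g b)"
  "smult (Z C) = (\<lambda>k f b. k \<otimes> f b)"
  "grade (Z C) n = {f \<in> carrier (Z C). \<forall>b. f b \<noteq> \<zero> \<longrightarrow> zdegree b = n}"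
  by (simp_all add: zigzag_model_def Let_def)

lemma model_closed: "f \<in> carrier (Z C) \<Longrightarrow> f b \<in> carrier K"
  by (simp add: model_sel)

lemma model_outside: "f \<in> carrier (Z C) \<Longrightarrow> b \<notin> zigzag_basis G C \<Longrightarrow> f b = \<zero>"
  by (simp add: model_sel)

text \<open>For the unit laws: the unit has coefficient 0 at a vertex outside the graph, so an arrow
  touching such a vertex must have coefficient 0 as well.\<close>

lemma model_arrow_outside: "f \<in> carrier (Z C) \<Longrightarrow> i \<notin> pverts G \<or> j \<notin> pverts G \<Longrightarrow> f (Arrow i j) = \<zero>"
  using arcs_in_verts by (auto intro: model_outside)

lemma zigzag_mult_simps:
  "zigzag_mult K G C f g (Vertex i) = f (Vertex i) \<otimes> g (Vertex i)"
  "zigzag_mult K G C f g (Arrow i j) = f (Vertex i) \<otimes> g (Arrow i j) \<oplus> f (Arrow i j) \<otimes> g (Vertex j)"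
  "zigzag_mult K G C f g (Loop i) = (if i \<in> pverts G \<and> i \<notin> C
       then f (Vertex i) \<otimes> g (Loop i) \<oplus> f (Loop i) \<otimes> g (Vertex i) \<oplus>
         (\<Oplus>j \<in> {j. (i, j) \<in> parcs G}. f (Arrow i j) \<otimes> g (Arrow j i))
       else \<zero>)"
  by (simp_all add: zigzag_mult_def)

lemma model_mult_closed:
  assumes "f \<in> carrier (Z C)" "g \<in> carrier (Z C)"
  shows "zigzag_mult K G C f g \<in> carrier (Z C)"
proof -
  have "zigzag_mult K G C f g b \<in> carrier K" for b
    using assms[THEN model_closed] by (cases b) (auto simp: zigzag_mult_simps)
  moreover have "zigzag_mult K G C f g b = \<zero>" if "b \<notin> zigzag_basis G C" for b
    using that assms[THEN model_closed] assms[THEN model_outside]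
    by (cases b) (auto simp: zigzag_mult_simps)
  ultimately show ?thesis by (simp add: model_sel)
qed

lemma model_abelian_group: "abelian_group (Z C)"
proof (rule abelian_groupI, goal_cases)
  case (6 x)
  have "(\<lambda>b. \<ominus> x b) \<oplus>\<^bsub>Z C\<^esub> x = \<zero>\<^bsub>Z C\<^esub>" "(\<lambda>b. \<ominus> x b) \<in> carrier (Z C)"
    using 6 by (auto simp: model_sel l_neg)
  then show ?case by blast
qed (auto simp: model_sel fun_eq_iff a_ac)

lemma model_mult_assoc:
  assumes x: "x \<in> carrier (Z C)" and y: "y \<in> carrier (Z C)" and z: "z \<in> carrier (Z C)"
  shows "zigzag_mult K G C (zigzag_mult K G C x y) z = zigzag_mult K G C x (zigzag_mult K G C y z)"
proof
  fix b
  note [simp] = model_closed[OF x] model_closed[OF y] model_closed[OF z]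
  show "zigzag_mult K G C (zigzag_mult K G C x y) z b = zigzag_mult K G C x (zigzag_mult K G C y z) b"
  proof (cases b)
    case (Loop i)
    let ?N = "{j. (i, j) \<in> parcs G}"
    \<comment> \<open>The neighbour sums of the two bracketings are expanded so that both contain
      the sum over \<open>j\<close> of arrow times vertex times arrow; the remaining terms then
      match up to order.\<close>
    have 1: "(\<Oplus>j \<in> ?N. (x (Vertex i) \<otimes> y (Arrow i j) \<oplus> x (Arrow i j) \<otimes> y (Vertex j)) \<otimes> z (Arrow j i)) =
        x (Vertex i) \<otimes> (\<Oplus>j \<in> ?N. y (Arrow i j) \<otimes> z (Arrow j i)) \<oplus>
        (\<Oplus>j \<in> ?N. x (Arrow i j) \<otimes> (y (Vertex j) \<otimes> z (Arrow j i)))"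
      by (simp add: l_distr m_assoc finsum_addf finsum_rdistr finite_nbrs Pi_def)
    have 2: "(\<Oplus>j \<in> ?N. x (Arrow i j) \<otimes> (y (Vertex j) \<otimes> z (Arrow j i) \<oplus> y (Arrow j i) \<otimes> z (Vertex i))) =
        (\<Oplus>j \<in> ?N. x (Arrow i j) \<otimes> (y (Vertex j) \<otimes> z (Arrow j i))) \<oplus>
        (\<Oplus>j \<in> ?N. x (Arrow i j) \<otimes> y (Arrow j i)) \<otimes> z (Vertex i)"
      by (simp add: r_distr m_assoc finsum_addf finsum_ldistr finite_nbrs Pi_def)
    have "(\<Oplus>j \<in> ?N. x (Arrow i j) \<otimes> (y (Vertex j) \<otimes> z (Arrow j i))) \<in> carrier K"
      "(\<Oplus>j \<in> ?N. x (Arrow i j) \<otimes> y (Arrow j i)) \<in> carrier K"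
      "(\<Oplus>j \<in> ?N. y (Arrow i j) \<otimes> z (Arrow j i)) \<in> carrier K" by auto
    then show ?thesis unfolding Loop zigzag_mult_simps 1 2
      by (simp add: l_distr r_distr m_assoc a_ac)
  qed (simp_all add: zigzag_mult_simps l_distr r_distr m_assoc a_ac)
qed

lemma model_ring: "ring (Z C)"
proof (rule ringI[OF model_abelian_group])
  show "Group.monoid (Z C)"
  proof (rule monoidI, goal_cases)
    case 1 then show ?case by (simp add: model_sel(2) model_mult_closed)
  next
    case 2 show ?case by (auto simp: model_sel)
  next
    case 3 then show ?case by (simp add: model_sel(2) model_mult_assoc)
  next
    case (4 x)
    show ?case
    proof
      fix b show "(\<one>\<^bsub>Z C\<^esub> \<otimes>\<^bsub>Z C\<^esub> x) b = x b"
        using model_closed[OF 4] model_outside[OF 4, of b] model_arrow_outside[OF 4]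
        by (cases b) (auto simp: model_sel(2,3) zigzag_mult_simps image_iff)
    qed
  next
    case (5 x)
    show ?case
    proof
      fix b show "(x \<otimes>\<^bsub>Z C\<^esub> \<one>\<^bsub>Z C\<^esub>) b = x b"
        using model_closed[OF 5] model_outside[OF 5, of b] model_arrow_outside[OF 5]
        by (cases b) (auto simp: model_sel(2,3) zigzag_mult_simps image_iff)
    qed
  qed
next
  fix x y z assume x: "x \<in> carrier (Z C)" and y: "y \<in> carrier (Z C)" and z: "z \<in> carrier (Z C)"
  note [simp] = model_closed[OF x] model_closed[OF y] model_closed[OF z]
  show "(x \<oplus>\<^bsub>Z C\<^esub> y) \<otimes>\<^bsub>Z C\<^esub> z = x \<otimes>\<^bsub>Z C\<^esub> z \<oplus>\<^bsub>Z C\<^esub> y \<otimes>\<^bsub>Z C\<^esub> z"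
  proof
    fix b show "((x \<oplus>\<^bsub>Z C\<^esub> y) \<otimes>\<^bsub>Z C\<^esub> z) b = (x \<otimes>\<^bsub>Z C\<^esub> z \<oplus>\<^bsub>Z C\<^esub> y \<otimes>\<^bsub>Z C\<^esub> z) b"
      by (cases b) (auto simp: model_sel(2,5) zigzag_mult_simps l_distr a_ac finsum_addf Pi_def)
  qed
  show "z \<otimes>\<^bsub>Z C\<^esub> (x \<oplus>\<^bsub>Z C\<^esub> y) = z \<otimes>\<^bsub>Z C\<^esub> x \<oplus>\<^bsub>Z C\<^esub> z \<otimes>\<^bsub>Z C\<^esub> y"
  proof
    fix b show "(z \<otimes>\<^bsub>Z C\<^esub> (x \<oplus>\<^bsub>Z C\<^esub> y)) b = (z \<otimes>\<^bsub>Z C\<^esub> x \<oplus>\<^bsub>Z C\<^esub> z \<otimes>\<^bsub>Z C\<^esub> y) b"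
      by (cases b) (auto simp: model_sel(2,5) zigzag_mult_simps r_distr a_ac finsum_addf Pi_def)
  qed
qed

lemma model_module: "Module.module K (Z C)"
  by (rule moduleI[OF is_cring model_abelian_group])
    (auto simp: model_sel fun_eq_iff l_distr r_distr m_assoc)

lemma model_finsum:
  assumes "finite S" "\<And>s. s \<in> S \<Longrightarrow> f s \<in> carrier (Z C)"
  shows "(\<Oplus>\<^bsub>Z C\<^esub>s \<in> S. f s) b = (\<Oplus>s \<in> S. f s b)"
proof -
  interpret B: abelian_group "Z C" by (rule model_abelian_group)
  show ?thesis using assms
  proof (induction S rule: finite_induct)
    case empty
    show ?case by (simp add: model_sel)
  next
    case (insert s S)
    then have "f \<in> S \<rightarrow> carrier (Z C)" "(\<lambda>s. f s b) \<in> S \<rightarrow> carrier K" "f s b \<in> carrier K"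
      by (auto intro: model_closed)
    then show ?case using insert by (simp add: model_sel(5))
  qed
qed

lemma model_a_inv: "x \<in> carrier (Z C) \<Longrightarrow> \<ominus>\<^bsub>Z C\<^esub> x = (\<lambda>b. \<ominus> x b)"
  by (intro abelian_group.minus_equality[OF model_abelian_group]) (auto simp: model_sel l_neg)

lemma model_submodule: "submodule (grade (Z C) n) K (Z C)"
  by (rule module.submoduleI[OF model_module])
    (auto simp: model_a_inv model_sel, (metis l_zero r_null zero_closed)+)

lemma finsum_eq_single:
  assumes "finite S" "s \<in> S" "f s \<in> carrier K" "\<And>t. t \<in> S \<Longrightarrow> t \<noteq> s \<Longrightarrow> f t = \<zero>"
  shows "(\<Oplus>t \<in> S. f t) = f s"
proof -
  have "(\<Oplus>t \<in> S. f t) = (\<Oplus>t \<in> {s}. f t)"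
    using assms by (intro add.finprod_mono_neutral_cong_right) (auto, metis zero_closed)
  then show ?thesis using assms(3) by simp
qed

lemma model_graded_abelian_group: "graded_abelian_group (Z C)"
proof -
  interpret B: abelian_group "Z C" by (rule model_abelian_group)
  have dec: "\<exists>!c. (\<forall>n. c n \<in> grade (Z C) n) \<and> finite {n. c n \<noteq> \<zero>\<^bsub>Z C\<^esub>} \<and>
      x = (\<Oplus>\<^bsub>Z C\<^esub>n \<in> {n. c n \<noteq> \<zero>\<^bsub>Z C\<^esub>}. c n)" if x: "x \<in> carrier (Z C)" for x
  proof -
    let ?c = "\<lambda>n b. if zdegree b = n then x b else \<zero>"
    have c: "?c n \<in> grade (Z C) n" for n using x by (auto simp: model_sel)
    \<comment> \<open>At \<open>b\<close>, a sum of homogeneous elements only sees the summand of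
      degree \<open>zdegree b\<close>. This yields existence for \<open>?c\<close> and uniqueness
      for any other decomposition.\<close>
    have eval: "(\<Oplus>\<^bsub>Z C\<^esub>n \<in> {n. c n \<noteq> \<zero>\<^bsub>Z C\<^esub>}. c n) b = c (zdegree b) b"
      if cg: "\<And>n. c n \<in> grade (Z C) n" and S: "finite {n. c n \<noteq> \<zero>\<^bsub>Z C\<^esub>}" for c b
    proof -
      have cc: "c n \<in> carrier (Z C)" for n using cg[of n] by (simp add: model_sel(7))
      have "(\<Oplus>\<^bsub>Z C\<^esub>n \<in> {n. c n \<noteq> \<zero>\<^bsub>Z C\<^esub>}. c n) b = (\<Oplus>n \<in> {n. c n \<noteq> \<zero>\<^bsub>Z C\<^esub>}. c n b)"
        by (rule model_finsum[OF S cc])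
      also have "\<dots> = c (zdegree b) b"
      proof (cases "c (zdegree b) = \<zero>\<^bsub>Z C\<^esub>")
        case True
        then have "c n b = \<zero>" if "n \<in> {n. c n \<noteq> \<zero>\<^bsub>Z C\<^esub>}" for n
          using cg[of n] that by (auto simp: model_sel(7))
        moreover have "c (zdegree b) b = \<zero>" using True by (simp add: model_sel)
        ultimately show ?thesis by (simp only: add.finprod_one_eqI)
      next
        case False
        have "c n b = \<zero>" if "n \<noteq> zdegree b" for n
          using cg[of n] that by (auto simp: model_sel(7))
        with False S show ?thesis
          by (intro finsum_eq_single) (auto simp: model_closed[OF cc])
      qed
      finally show ?thesis .
    qed
    have fin: "finite {n. ?c n \<noteq> \<zero>\<^bsub>Z C\<^esub>}"
    proof (rule finite_subset)
      show "{n. ?c n \<noteq> \<zero>\<^bsub>Z C\<^esub>} \<subseteq> zdegree ` zigzag_basis G C"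
        using model_outside[OF x] by (auto simp: model_sel(4) fun_eq_iff)
    qed (simp add: finite_basis)
    show ?thesis
    proof (rule ex1I[of _ ?c], intro conjI allI c fin)
      show "x = (\<Oplus>\<^bsub>Z C\<^esub>n \<in> {n. ?c n \<noteq> \<zero>\<^bsub>Z C\<^esub>}. ?c n)"
        by (rule ext, subst eval[OF c fin]) simp
    next
      fix c assume c': "(\<forall>n. c n \<in> grade (Z C) n) \<and> finite {n. c n \<noteq> \<zero>\<^bsub>Z C\<^esub>} \<and>
        x = (\<Oplus>\<^bsub>Z C\<^esub>n \<in> {n. c n \<noteq> \<zero>\<^bsub>Z C\<^esub>}. c n)"
      then have xb: "x b = c (zdegree b) b" for b using eval[of c b] by metis
      have "c n b = ?c n b" for n b
      proof (cases "zdegree b = n")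
        case False
        then show ?thesis using c' by (auto simp: model_sel(7))
      qed (simp add: xb)
      then show "c = ?c" by (intro ext)
    qed
  qed
  show ?thesis
    by (intro graded_abelian_group.intro graded_abelian_group_axioms.intro dec)
      (rule model_abelian_group, rule submodule.axioms(1)[OF model_submodule])
qed

lemma model_mult_grade:
  assumes "f \<in> grade (Z C) m" "g \<in> grade (Z C) n"
  shows "f \<otimes>\<^bsub>Z C\<^esub> g \<in> grade (Z C) (m + n)"
proof -
  have f: "f \<in> carrier (Z C)" "f b \<noteq> \<zero> \<Longrightarrow> zdegree b = m" for b
    using assms(1) by (auto simp: model_sel(7))
  have g: "g \<in> carrier (Z C)" "g b \<noteq> \<zero> \<Longrightarrow> zdegree b = n" for b
    using assms(2) by (auto simp: model_sel(7))
  note [simp] = model_closed[OF f(1)] model_closed[OF g(1)]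
  \<comment> \<open>In the coefficient of a product at a basis element, the degrees of the two
    factors of every term add up to the degree of that element. Outside degree \<open>m + n\<close>
    all terms therefore vanish.\<close>
  have "f b \<otimes> g b' = \<zero>" if "m + n \<noteq> zdegree b + zdegree b'" for b b'
    using f(2)[of b] g(2)[of b'] that by (cases "f b = \<zero>"; cases "g b' = \<zero>") auto
  then have "zigzag_mult K G C f g b = \<zero>" if "m + n \<noteq> zdegree b" for b
    using that by (cases b) (auto simp: zigzag_mult_simps intro!: add.finprod_one_eqI)
  then have "zigzag_mult K G C f g b \<noteq> \<zero> \<Longrightarrow> zdegree b = m + n" for b by metis
  then show ?thesis using model_mult_closed[OF f(1) g(1)] unfolding model_sel(2,7) by blast
qed

lemma model_graded_algebra: "graded_algebra K (Z C)"
proof -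
  interpret B: ring "Z C" by (rule model_ring)
  interpret B: graded_abelian_group "Z C" by (rule model_graded_abelian_group)
  interpret B: module K "Z C" by (rule model_module)
  show ?thesis
  proof (unfold_locales, goal_cases)
    case 1 show ?case by (auto simp: model_sel)
  next
    case 2 then show ?case by (rule model_mult_grade)
  next
    case (3 k a b)
    note [simp] = 3(1) model_closed[OF 3(2)] model_closed[OF 3(3)]
    show ?case
    proof
      fix c show "(k \<odot>\<^bsub>Z C\<^esub> a \<otimes>\<^bsub>Z C\<^esub> b) c = (k \<odot>\<^bsub>Z C\<^esub> (a \<otimes>\<^bsub>Z C\<^esub> b)) c"
        by (cases c) (auto simp: model_sel(2,6) zigzag_mult_simps r_distr m_assoc finsum_rdistr
            finite_nbrs Pi_def)
    qed
  next
    case (4 k a b)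
    note [simp] = 4(1) model_closed[OF 4(2)] model_closed[OF 4(3)]
    show ?case
    proof
      fix c show "(a \<otimes>\<^bsub>Z C\<^esub> (k \<odot>\<^bsub>Z C\<^esub> b)) c = (k \<odot>\<^bsub>Z C\<^esub> (a \<otimes>\<^bsub>Z C\<^esub> b)) c"
        by (cases c) (auto simp: model_sel(2,6) zigzag_mult_simps r_distr m_lcomm finsum_rdistr
            finite_nbrs Pi_def)
    qed
  next
  next
    case 5
    show ?case by (rule subgroup.subset[OF submodule.axioms(1)[OF model_submodule]])
  next
    case 6
    then show ?case by (intro subgroup.m_closed[OF submodule.axioms(1)[OF model_submodule]])
  next
    case 7
    show ?case by (rule subgroup.one_closed[OF submodule.axioms(1)[OF model_submodule]])
  next
    case 8
    then show ?case by (intro subgroup.m_inv_closed[OF submodule.axioms(1)[OF model_submodule]])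
  next
    case 9
    then show ?case by (rule submodule.smult_closed[OF model_submodule])
  qed
qed

end

section \<open>Transport of structure and quotients by kernels\<close>

text \<open>The closure conditions on scalar multiples and on \<open>grade A n\<close> are included
  because \<open>A\<close> is not yet known to be a graded algebra when this notion is applied; that
  is to be transported from \<open>B\<close>.\<close>

definition graded_epi :: "('k, 'd) ring_scheme \<Rightarrow> ('k, 'a, 'c) graded_module_scheme \<Rightarrow>
    ('k, 'b, 'e) graded_module_scheme \<Rightarrow> ('a \<Rightarrow> 'b) \<Rightarrow> bool" where
  "graded_epi K A B h \<longleftrightarrow> h \<in> ring_hom A B \<and> h ` carrier A = carrier B \<and>
     (\<forall>k \<in> carrier K. \<forall>x \<in> carrier A. k \<odot>\<^bsub>A\<^esub> x \<in> carrier A \<and> h (k \<odot>\<^bsub>A\<^esub> x) = k \<odot>\<^bsub>B\<^esub> h x) \<and>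
     (\<forall>n. grade A n \<subseteq> carrier A \<and> h ` grade A n = grade B n)"

lemma graded_epiD:
  assumes "graded_epi K A B h"
  shows "h \<in> ring_hom A B" and "h ` carrier A = carrier B"
    and "x \<in> carrier A \<Longrightarrow> h x \<in> carrier B"
    and "k \<in> carrier K \<Longrightarrow> x \<in> carrier A \<Longrightarrow> k \<odot>\<^bsub>A\<^esub> x \<in> carrier A"
    and "k \<in> carrier K \<Longrightarrow> x \<in> carrier A \<Longrightarrow> h (k \<odot>\<^bsub>A\<^esub> x) = k \<odot>\<^bsub>B\<^esub> h x"
    and "x \<in> grade A n \<Longrightarrow> x \<in> carrier A" and "h ` grade A n = grade B n"
    and "x \<in> carrier A \<Longrightarrow> y \<in> carrier A \<Longrightarrow> h (x \<oplus>\<^bsub>A\<^esub> y) = h x \<oplus>\<^bsub>B\<^esub> h y"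
    and "x \<in> carrier A \<Longrightarrow> y \<in> carrier A \<Longrightarrow> h (x \<otimes>\<^bsub>A\<^esub> y) = h x \<otimes>\<^bsub>B\<^esub> h y"
    and "h \<one>\<^bsub>A\<^esub> = \<one>\<^bsub>B\<^esub>"
  using assms unfolding graded_epi_def ring_hom_def by blast+

lemma graded_epi_comp:
  assumes f: "graded_epi K A B f" and g: "graded_epi K B D g"
  shows "graded_epi K A D (\<lambda>x. g (f x))"
  unfolding graded_epi_def
proof (intro conjI allI ballI)
  show "(\<lambda>x. g (f x)) \<in> ring_hom A D"
    by (rule ring_hom_memI) (simp_all add: graded_epiD[OF f] graded_epiD[OF g])
  show "(\<lambda>x. g (f x)) ` carrier A = carrier D"
    using graded_epiD(2)[OF f] graded_epiD(2)[OF g] by (metis image_image)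
  show "(\<lambda>x. g (f x)) ` grade A n = grade D n" for n
    using graded_epiD(7)[OF f] graded_epiD(7)[OF g] by (metis image_image)
qed (use graded_epiD[OF f] graded_epiD[OF g] in auto)

text \<open>Identities can be tested after applying the injective map \<open>h\<close>, and the
  homogeneous components of \<open>x\<close> are the preimages of those of
  \<open>h x\<close>.\<close>

lemma graded_algebra_transport:
  assumes B: "graded_algebra K B" and A: "ring A" and h: "graded_epi K A B h"
    and inj: "inj_on h (carrier A)"
  shows "graded_algebra K A"
proof -
  interpret B: graded_algebra K B by (rule B)
  interpret A: ring A by (rule A)
  note hD [simp] = graded_epiD[OF h]
  interpret ring_hom_ring A B h by (rule ring_hom_ringI2[OF A B.ring_axioms hD(1)])
  have eqI: "x = y" if "h x = h y" "x \<in> carrier A" "y \<in> carrier A" for x y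
    using inj that by (auto dest: inj_onD)
  \<comment> \<open>Surjectivity on each homogeneous part together with injectivity shows that
    \<open>h\<close> reflects degrees.\<close>
  have mem: "x \<in> grade A n" if "h x \<in> grade B n" "x \<in> carrier A" for x n
  proof -
    have "h x \<in> h ` grade A n" using that(1) by (simp only: hD(7))
    then obtain y where y: "h x = h y" "y \<in> grade A n" by (rule imageE)
    from eqI[OF y(1) that(2) hD(6)[OF y(2)]] y(2) show ?thesis by simp
  qed
  have hg: "h x \<in> grade B n" if "x \<in> grade A n" for x n using that hD(7) by blast
  have "Module.module K A"
    by (rule moduleI[OF B.K.is_cring A.is_abelian_group])
      (auto intro!: eqI simp: B.smult_l_distr B.smult_r_distr B.smult_assoc1 B.smult_one)
  then interpret module K A .
  have sub: "submodule (grade A n) K A" for n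
  proof (rule submoduleI)
    show "\<zero>\<^bsub>A\<^esub> \<in> grade A n" by (rule mem) (simp_all add: B.zero_grade)
    show "\<ominus>\<^bsub>A\<^esub> x \<in> grade A n" if "x \<in> grade A n" for x
      using module.submoduleE(3)[OF B.module_axioms B.grade_subspace hg[OF that]] hD(6)[OF that]
      by (intro mem) simp_all
    show "x \<oplus>\<^bsub>A\<^esub> y \<in> grade A n" if "x \<in> grade A n" "y \<in> grade A n" for x y
      using B.add_grade[OF hg[OF that(1)] hg[OF that(2)]] hD(6)[OF that(1)] hD(6)[OF that(2)]
      by (intro mem) simp_all
    show "k \<odot>\<^bsub>A\<^esub> x \<in> grade A n" if "k \<in> carrier K" "x \<in> grade A n" for k x
      using submodule.smult_closed[OF B.grade_subspace that(1) hg[OF that(2)]] hD(6)[OF that(2)] that(1)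
      by (intro mem) simp_all
  qed (use hD(6) in blast)
  have dec: "\<exists>!c. (\<forall>n. c n \<in> grade A n) \<and> finite {n. c n \<noteq> \<zero>\<^bsub>A\<^esub>} \<and>
      x = (\<Oplus>\<^bsub>A\<^esub>n \<in> {n. c n \<noteq> \<zero>\<^bsub>A\<^esub>}. c n)" if x: "x \<in> carrier A" for x
  proof -
    let ?g = "inv_into (carrier A) h"
    have g: "?g y \<in> carrier A" "h (?g y) = y" if "y \<in> carrier B" for y
      using that hD(2) by (metis inv_into_into, metis f_inv_into_f)
    let ?c = "\<lambda>n. ?g (component B (h x) n)"
    have hx: "h x \<in> carrier B" using x by simp
    have cB: "component B (h x) n \<in> grade B n" for n by (rule B.component_grade[OF hx])
    note cBc = B.grade_closed[OF cB]
    have nz: "u = \<zero>\<^bsub>A\<^esub> \<longleftrightarrow> h u = \<zero>\<^bsub>B\<^esub>" if "u \<in> carrier A" for u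
      using eqI[of u "\<zero>\<^bsub>A\<^esub>"] that by auto
    have hsum: "h (\<Oplus>\<^bsub>A\<^esub>n \<in> S. c n) = (\<Oplus>\<^bsub>B\<^esub>n \<in> S. h (c n))"
      if "finite S" "\<And>n. c n \<in> carrier A" for S :: "int set" and c
      by (rule hom_add_finsum[OF A.is_abelian_group B.abelian_group_axioms _ that])
        (simp add: hom_def)
    have S: "{n. ?c n \<noteq> \<zero>\<^bsub>A\<^esub>} = {n. component B (h x) n \<noteq> \<zero>\<^bsub>B\<^esub>}"
      using nz[OF g(1)[OF cBc]] g(2)[OF cBc] by simp
    show ?thesis
    proof (rule ex1I[of _ ?c], intro conjI allI)
      show "?c n \<in> grade A n" for n by (rule mem) (simp_all add: g cBc cB)
      show fin: "finite {n. ?c n \<noteq> \<zero>\<^bsub>A\<^esub>}" unfolding S by (rule B.finite_component[OF hx])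
      show "x = (\<Oplus>\<^bsub>A\<^esub>n \<in> {n. ?c n \<noteq> \<zero>\<^bsub>A\<^esub>}. ?c n)"
      proof (rule eqI)
        show "h x = h (\<Oplus>\<^bsub>A\<^esub>n \<in> {n. ?c n \<noteq> \<zero>\<^bsub>A\<^esub>}. ?c n)"
          using fin B.sum_component[OF hx] by (subst hsum) (auto simp: g cBc S)
      qed (use x g(1)[OF cBc] in auto)
    next
      fix c assume c: "(\<forall>n. c n \<in> grade A n) \<and> finite {n. c n \<noteq> \<zero>\<^bsub>A\<^esub>} \<and>
        x = (\<Oplus>\<^bsub>A\<^esub>n \<in> {n. c n \<noteq> \<zero>\<^bsub>A\<^esub>}. c n)"
      then have cc: "c n \<in> carrier A" for n using hD(6) by blast
      have "component B (h x) = (\<lambda>n. h (c n))"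
      proof (rule B.component_unique)
        show "h (c n) \<in> grade B n" for n using c hg by blast
        show "finite {n. c n \<noteq> \<zero>\<^bsub>A\<^esub>}" using c by blast
        show "h (c n) = \<zero>\<^bsub>B\<^esub>" if "n \<notin> {n. c n \<noteq> \<zero>\<^bsub>A\<^esub>}" for n using that by simp
        have "h (\<Oplus>\<^bsub>A\<^esub>n \<in> {n. c n \<noteq> \<zero>\<^bsub>A\<^esub>}. c n) = (\<Oplus>\<^bsub>B\<^esub>n \<in> {n. c n \<noteq> \<zero>\<^bsub>A\<^esub>}. h (c n))"
          using c cc by (intro hsum) auto
        then show "h x = (\<Oplus>\<^bsub>B\<^esub>n \<in> {n. c n \<noteq> \<zero>\<^bsub>A\<^esub>}. h (c n))" using c by simp
      qed
      then show "c = ?c" using cc inj by (auto simp: inv_into_f_f)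
    qed
  qed
  interpret graded_abelian_group A
    by (intro graded_abelian_group.intro graded_abelian_group_axioms.intro A.is_abelian_group
        submodule.axioms(1)[OF sub] dec)
  have "graded_ring_axioms A"
  proof
    show "\<one>\<^bsub>A\<^esub> \<in> grade A 0" by (rule mem) (simp_all add: B.one_grade)
    show "a \<otimes>\<^bsub>A\<^esub> b \<in> grade A (m + n)" if "a \<in> grade A m" "b \<in> grade A n" for a b m n
      using B.mult_grade[OF hg[OF that(1)] hg[OF that(2)]] hD(6)[OF that(1)] hD(6)[OF that(2)]
      by (intro mem) simp_all
  qed
  then interpret graded_ring A by (intro graded_ring.intro A graded_abelian_group_axioms)
  have "graded_algebra_axioms K A"
  proof (intro graded_algebra_axioms.intro sub)
    fix k a b assume "k \<in> carrier K" "a \<in> carrier A" "b \<in> carrier A"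
    then show "(k \<odot>\<^bsub>A\<^esub> a) \<otimes>\<^bsub>A\<^esub> b = k \<odot>\<^bsub>A\<^esub> (a \<otimes>\<^bsub>A\<^esub> b)"
      "a \<otimes>\<^bsub>A\<^esub> (k \<odot>\<^bsub>A\<^esub> b) = k \<odot>\<^bsub>A\<^esub> (a \<otimes>\<^bsub>A\<^esub> b)"
      by (auto intro!: eqI simp: B.smult_mult_left B.smult_mult_right)
  qed
  then show ?thesis
    by (intro graded_algebra.intro B.K.field_axioms module_axioms graded_ring_axioms)
qed

text \<open>Meant for \<open>quotient_algebra A I\<close>, which copies the ring fields of
  \<open>A Quot I\<close> into a record with further fields.\<close>

lemma ring_cong:
  assumes R: "ring R" and eq: "carrier S = carrier R" "mult S = mult R" "one S = one R"
    "zero S = zero R" "add S = add R"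
  shows "ring S"
proof -
  interpret R: ring R by (rule R)
  have "abelian_group S"
    by (rule abelian_groupI) (auto simp: eq R.a_ac intro: R.l_neg)
  moreover have "Group.monoid S"
    by (rule monoidI) (simp_all add: eq R.m_assoc)
  ultimately show ?thesis
    by (rule ringI) (simp_all add: eq R.l_distr R.r_distr)
qed

text \<open>The first isomorphism theorem for graded quotients, with the ideal given as a kernel;
  the isomorphism takes a coset to the common value of \<open>h\<close> on it. It serves both for
  the relations and for the vertex condition, so in each case the work lies in identifying a
  generated ideal with a kernel.\<close>

lemma quotient_algebra_iso:
  assumes B: "ring B" and A: "ring A" and h: "graded_epi K A B h"
    and I: "I = {x \<in> carrier A. h x = \<zero>\<^bsub>B\<^esub>}"
  shows "ideal I A" and "ring (quotient_algebra A I)"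
    and "graded_epi K (quotient_algebra A I) B (\<lambda>X. the_elem (h ` X))"
    and "inj_on (\<lambda>X. the_elem (h ` X)) (carrier (quotient_algebra A I))"
    and "x \<in> carrier A \<Longrightarrow> the_elem (h ` (I +>\<^bsub>A\<^esub> x)) = h x"
    and "x \<in> carrier A \<Longrightarrow> I +>\<^bsub>A\<^esub> x \<in> carrier (quotient_algebra A I)"
proof -
  interpret A: ring A by (rule A)
  note hD = graded_epiD[OF h]
  interpret ring_hom_ring A B h by (rule ring_hom_ringI2[OF A B hD(1)])
  have I': "I = a_kernel A B h" unfolding I a_kernel_def' by auto
  show id: "ideal I A" unfolding I' by (rule kernel_is_ideal)
  interpret I: ideal I A by (rule id)
  let ?Q = "quotient_algebra A I" and ?h = "\<lambda>X. the_elem (h ` X)"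
  have sel: "carrier ?Q = carrier (A Quot I)" "mult ?Q = mult (A Quot I)" "one ?Q = one (A Quot I)"
    "zero ?Q = zero (A Quot I)" "add ?Q = add (A Quot I)"
    "smult ?Q = (\<lambda>k X. \<Union>x \<in> X. I +>\<^bsub>A\<^esub> (k \<odot>\<^bsub>A\<^esub> x))"
    "\<And>n. grade ?Q n = (\<lambda>x. I +>\<^bsub>A\<^esub> x) ` grade A n"
    by (simp_all add: quotient_algebra_def)
  show Q: "ring ?Q" by (rule ring_cong[OF I.quotient_is_ring]) (simp_all add: sel)
  have car: "carrier ?Q = (\<lambda>x. I +>\<^bsub>A\<^esub> x) ` carrier A"
    unfolding sel FactRing_simps by auto
  have hc: "?h (I +>\<^bsub>A\<^esub> x) = h x" if "x \<in> carrier A" for x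
    unfolding I' by (rule the_elem_simp[OF that])
  then show "x \<in> carrier A \<Longrightarrow> ?h (I +>\<^bsub>A\<^esub> x) = h x" .
  show cq: "x \<in> carrier A \<Longrightarrow> I +>\<^bsub>A\<^esub> x \<in> carrier ?Q" for x unfolding car by blast
  have iso: "?h \<in> ring_iso (A Quot I) B" unfolding I' by (rule FactRing_iso_set[OF hD(2)])
  then have hom: "?h \<in> ring_hom (A Quot I) B" and bij: "bij_betw ?h (carrier (A Quot I)) (carrier B)"
    by (auto simp: ring_iso_def)
  show inj: "inj_on ?h (carrier ?Q)" using bij by (simp add: bij_betw_def sel)
  have eqI: "I +>\<^bsub>A\<^esub> x = I +>\<^bsub>A\<^esub> y" if "h x = h y" "x \<in> carrier A" "y \<in> carrier A" for x y
    using inj_onD[OF inj, of "I +>\<^bsub>A\<^esub> x" "I +>\<^bsub>A\<^esub> y"] that by (simp add: hc cq)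
  have sm: "k \<odot>\<^bsub>?Q\<^esub> (I +>\<^bsub>A\<^esub> x) = I +>\<^bsub>A\<^esub> (k \<odot>\<^bsub>A\<^esub> x)"
    if k: "k \<in> carrier K" and x: "x \<in> carrier A" for k x
  proof -
    \<comment> \<open>All cosets in the union that defines the scalar multiple coincide, so the
      union is a single coset.\<close>
    have "I +>\<^bsub>A\<^esub> (k \<odot>\<^bsub>A\<^esub> y) = I +>\<^bsub>A\<^esub> (k \<odot>\<^bsub>A\<^esub> x)" if y: "y \<in> I +>\<^bsub>A\<^esub> x" for y
    proof -
      have yc: "y \<in> carrier A" using y x A.a_r_coset_subset_G[OF I.a_subset] by blast
      have "I +>\<^bsub>A\<^esub> y = I +>\<^bsub>A\<^esub> x" using A.a_repr_independence[OF y x I.a_subgroup] by simp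
      then have "h y = h x" using hc[OF yc] hc[OF x] by simp
      then show ?thesis by (intro eqI) (simp_all add: hD(4,5) k x yc)
    qed
    moreover have "x \<in> I +>\<^bsub>A\<^esub> x" by (rule I.a_rcos_self[OF x])
    ultimately show ?thesis unfolding sel by blast
  qed
  show "graded_epi K ?Q B ?h"
    unfolding graded_epi_def
  proof (intro conjI allI ballI)
    show "?h \<in> ring_hom ?Q B" using hom unfolding ring_hom_def sel .
    show "?h ` carrier ?Q = carrier B" using bij by (simp add: bij_betw_def sel)
  next
    fix k X assume k: "k \<in> carrier K" and "X \<in> carrier ?Q"
    then obtain x where x: "x \<in> carrier A" "X = I +>\<^bsub>A\<^esub> x" unfolding car by blast
    then show "k \<odot>\<^bsub>?Q\<^esub> X \<in> carrier ?Q" "?h (k \<odot>\<^bsub>?Q\<^esub> X) = k \<odot>\<^bsub>B\<^esub> ?h X"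
      using k by (simp_all add: sm cq hc hD(4,5))
  next
    fix n
    show "grade ?Q n \<subseteq> carrier ?Q" unfolding sel(7) car using hD(6) by blast
    have "?h ` grade ?Q n = h ` grade A n"
      unfolding sel(7) image_image by (rule image_cong) (simp_all add: hc hD(6))
    then show "?h ` grade ?Q n = grade B n" using hD(7) by simp
  qed
qed

section \<open>Path algebras\<close>

lemma vwalk_iff_nth:
  "vwalk p (with_proj Q) \<longleftrightarrow> p \<noteq> [] \<and> set p \<subseteq> pverts Q \<and>
     (\<forall>n. Suc n < length p \<longrightarrow> (p ! n, p ! Suc n) \<in> parcs Q)"
proof -
  have "set (vwalk_arcs p) \<subseteq> parcs Q \<longleftrightarrow> (\<forall>n. Suc n < length p \<longrightarrow> (p ! n, p ! Suc n) \<in> parcs Q)"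
    by (induction p rule: vwalk_arcs.induct) (auto simp: nth_Cons less_Suc_eq_0_disj split: nat.splits)
  then show ?thesis by (auto simp: vwalk_def)
qed

text \<open>For closure of the path algebra under products: a nonzero coefficient at
  \<open>p\<close> comes from a cut of \<open>p\<close> into two walks that share the vertex
  \<open>p ! n\<close>.\<close>

lemma vwalk_join_cut:
  assumes "n < length p" "vwalk (take (Suc n) p) (with_proj Q)" "vwalk (drop n p) (with_proj Q)"
  shows "vwalk p (with_proj Q)"
  unfolding vwalk_iff_nth
proof (intro conjI allI impI)
  show "p \<noteq> []" using assms(1) by auto
  have "set p = set (take (Suc n) p) \<union> set (drop n p)"
    by (metis append_take_drop_id set_append Un_assoc Un_absorb1 set_drop_subset_set_drop
        le_SucI order_refl)
  then show "set p \<subseteq> pverts Q" using assms(2,3) unfolding vwalk_iff_nth by blast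
next
  fix m assume m: "Suc m < length p"
  show "(p ! m, p ! Suc m) \<in> parcs Q"
  proof (cases "m < n")
    case True
    then show ?thesis using assms(1,2) m unfolding vwalk_iff_nth by auto
  next
    case False
    have "Suc (m - n) < length (drop n p)" using False m by auto
    then have "(drop n p ! (m - n), drop n p ! Suc (m - n)) \<in> parcs Q"
      using assms(3) unfolding vwalk_iff_nth by blast
    then show ?thesis using False m by simp
  qed
qed

context cring
begin

text \<open>Splits off one point of the support at a time. Both spanning arguments below, modulo the
  relations and for the loops at \<open>C\<close>, reduce to scaled basis vectors by this
  rule.\<close>

lemma finite_support_induct [consumes 3, case_names zero single add]:
  assumes f: "finite {b. f b \<noteq> \<zero>}" "{b. f b \<noteq> \<zero>} \<subseteq> S" "\<And>b. f b \<in> carrier R"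
    and zero: "P (\<lambda>b. \<zero>)"
    and single: "\<And>b k. b \<in> S \<Longrightarrow> k \<in> carrier R \<Longrightarrow> P (\<lambda>c. if c = b then k else \<zero>)"
    and add: "\<And>g h. P g \<Longrightarrow> P h \<Longrightarrow> (\<And>b. g b \<in> carrier R) \<Longrightarrow> (\<And>b. h b \<in> carrier R) \<Longrightarrow>
      P (\<lambda>b. g b \<oplus> h b)"
  shows "P f"
proof -
  have "P g" if "finite U" "{b. g b \<noteq> \<zero>} = U" "U \<subseteq> S" "\<And>b. g b \<in> carrier R" for U g
    using that
  proof (induction U arbitrary: g rule: finite_induct)
    case empty
    then have "g = (\<lambda>b. \<zero>)" by auto
    then show ?case using zero by simp
  next
    case (insert b U)
    have "P (g(b := \<zero>))" by (rule insert.IH) (use insert in auto)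
    moreover have "P (\<lambda>c. if c = b then g b else \<zero>)" using insert.prems by (intro single) auto
    ultimately have "P (\<lambda>c. (g(b := \<zero>)) c \<oplus> (if c = b then g b else \<zero>))"
      by (rule add) (use insert.prems in auto)
    also have "(\<lambda>c. (g(b := \<zero>)) c \<oplus> (if c = b then g b else \<zero>)) = g"
      using insert.prems(3) by (auto simp: fun_eq_iff)
    finally show ?case .
  qed
  then show ?thesis using f by blast
qed

text \<open>Sums over pairs of cuts \<open>m \<le> n\<close> of a path: on the left the second cut
  is chosen first, on the right the first cut, with \<open>l\<close> the distance to the second.
  This is associativity of the path product.\<close>

lemma finsum_triangle:
  fixes T :: "nat \<Rightarrow> nat \<Rightarrow> 'a"
  assumes "\<And>m n. T m n \<in> carrier R"
  shows "(\<Oplus>n \<in> {..<L}. \<Oplus>m \<in> {..<Suc n}. T m n) = (\<Oplus>m \<in> {..<L}. \<Oplus>l \<in> {..<L - m}. T m (m + l))"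
proof (induction L)
  case (Suc L)
  have "(\<Oplus>m \<in> {..<Suc L}. \<Oplus>l \<in> {..<Suc L - m}. T m (m + l)) =
      T L L \<oplus> (\<Oplus>m \<in> {..<L}. \<Oplus>l \<in> {..<Suc L - m}. T m (m + l))"
    using assms by (simp add: lessThan_Suc finsum_insert Pi_def)
  also have "(\<Oplus>m \<in> {..<L}. \<Oplus>l \<in> {..<Suc L - m}. T m (m + l)) =
      (\<Oplus>m \<in> {..<L}. T m L \<oplus> (\<Oplus>l \<in> {..<L - m}. T m (m + l)))"
    using assms by (intro finsum_cong') (auto simp: Suc_diff_le lessThan_Suc finsum_insert Pi_def)
  also have "\<dots> = (\<Oplus>m \<in> {..<L}. T m L) \<oplus> (\<Oplus>n \<in> {..<L}. \<Oplus>m \<in> {..<Suc n}. T m n)"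
    using assms by (subst finsum_addf) (auto simp: Suc.IH)
  finally show ?case using assms
    by (simp add: lessThan_Suc finsum_insert Pi_def a_ac)
qed simp

abbreviation PA :: "int \<Rightarrow> 'v pair_pre_digraph \<Rightarrow> ('a, 'v list \<Rightarrow> 'a) graded_module" where
  "PA w Q \<equiv> path_algebra R w Q"

lemma path_algebra_sel:
  "carrier (PA w Q) = {f. (\<forall>p. f p \<in> carrier R) \<and> finite {p. f p \<noteq> \<zero>} \<and>
     (\<forall>p. f p \<noteq> \<zero> \<longrightarrow> vwalk p (with_proj Q))}"
  "mult (PA w Q) f g = (\<lambda>p. \<Oplus>n \<in> {..<length p}. f (take (Suc n) p) \<otimes> g (drop n p))"
  "one (PA w Q) = (\<lambda>p. if \<exists>i \<in> pverts Q. p = [i] then \<one> else \<zero>)"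
  "zero (PA w Q) = (\<lambda>p. \<zero>)"
  "add (PA w Q) = (\<lambda>f g p. f p \<oplus> g p)"
  "smult (PA w Q) = (\<lambda>k f p. k \<otimes> f p)"
  "grade (PA w Q) n = {f \<in> carrier (PA w Q). \<forall>p. f p \<noteq> \<zero> \<longrightarrow> w * int (length p - 1) = n}"
  by (simp_all add: path_algebra_def Let_def)

lemma path_algebra_closed: "f \<in> carrier (PA w Q) \<Longrightarrow> f p \<in> carrier R"
  by (simp add: path_algebra_sel)

lemma path_algebra_outside: "f \<in> carrier (PA w Q) \<Longrightarrow> \<not> vwalk p (with_proj Q) \<Longrightarrow> f p = \<zero>"
  by (auto simp: path_algebra_sel)

lemma path_algebra_finite: "f \<in> carrier (PA w Q) \<Longrightarrow> finite {p. f p \<noteq> \<zero>}"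
  by (simp add: path_algebra_sel)

lemma path_algebra_abelian_group: "abelian_group (PA w Q)"
proof (rule abelian_groupI, goal_cases)
  case (1 x y)
  have "{p. x p \<oplus> y p \<noteq> \<zero>} \<subseteq> {p. x p \<noteq> \<zero>} \<union> {p. y p \<noteq> \<zero>}" by auto
  with 1 show ?case unfolding path_algebra_sel by (auto intro: finite_subset)
next
  case (6 x)
  have "{p. \<ominus> x p \<noteq> \<zero>} \<subseteq> {p. x p \<noteq> \<zero>}" by auto
  with 6 have "(\<lambda>p. \<ominus> x p) \<in> carrier (PA w Q)" "(\<lambda>p. \<ominus> x p) \<oplus>\<^bsub>PA w Q\<^esub> x = \<zero>\<^bsub>PA w Q\<^esub>"
    unfolding path_algebra_sel by (auto intro: finite_subset simp: l_neg)
  then show ?case by blast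
qed (auto simp: path_algebra_sel fun_eq_iff a_ac)

lemma path_algebra_mult_closed:
  assumes f: "f \<in> carrier (PA w Q)" and g: "g \<in> carrier (PA w Q)"
  shows "f \<otimes>\<^bsub>PA w Q\<^esub> g \<in> carrier (PA w Q)"
proof -
  have cut: "\<exists>n < length p. f (take (Suc n) p) \<noteq> \<zero> \<and> g (drop n p) \<noteq> \<zero>"
    if nz: "(f \<otimes>\<^bsub>PA w Q\<^esub> g) p \<noteq> \<zero>" for p
  proof (rule ccontr)
    assume "\<not> ?thesis"
    then have "f (take (Suc n) p) \<otimes> g (drop n p) = \<zero>" if "n < length p" for n
      using that path_algebra_closed[OF f] path_algebra_closed[OF g] by (metis l_null r_null)
    then have "(f \<otimes>\<^bsub>PA w Q\<^esub> g) p = \<zero>"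
      unfolding path_algebra_sel by (intro add.finprod_one_eqI) auto
    with nz show False by simp
  qed
  have "finite {p. (f \<otimes>\<^bsub>PA w Q\<^esub> g) p \<noteq> \<zero>}"
  proof (rule finite_subset)
    \<comment> \<open>Both pieces of a cut contain the cutting vertex, so they are glued after
      dropping it from the second piece.\<close>
    show "finite ((\<lambda>(a, b). a @ tl b) ` ({p. f p \<noteq> \<zero>} \<times> {p. g p \<noteq> \<zero>}))"
      using path_algebra_finite[OF f] path_algebra_finite[OF g] by simp
    show "{p. (f \<otimes>\<^bsub>PA w Q\<^esub> g) p \<noteq> \<zero>} \<subseteq> (\<lambda>(a, b). a @ tl b) ` ({p. f p \<noteq> \<zero>} \<times> {p. g p \<noteq> \<zero>})"
    proof
      fix p assume "p \<in> {p. (f \<otimes>\<^bsub>PA w Q\<^esub> g) p \<noteq> \<zero>}"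
      then obtain n where "f (take (Suc n) p) \<noteq> \<zero>" "g (drop n p) \<noteq> \<zero>" using cut by blast
      moreover have "p = take (Suc n) p @ tl (drop n p)" by (metis append_take_drop_id drop_Suc tl_drop)
      ultimately show "p \<in> (\<lambda>(a, b). a @ tl b) ` ({p. f p \<noteq> \<zero>} \<times> {p. g p \<noteq> \<zero>})"
        by (intro image_eqI[of _ _ "(take (Suc n) p, drop n p)"]) auto
    qed
  qed
  moreover have "vwalk p (with_proj Q)" if "(f \<otimes>\<^bsub>PA w Q\<^esub> g) p \<noteq> \<zero>" for p
    using cut[OF that] vwalk_join_cut path_algebra_outside[OF f] path_algebra_outside[OF g] by blast
  moreover have "(f \<otimes>\<^bsub>PA w Q\<^esub> g) p \<in> carrier R" for p
    unfolding path_algebra_sel using path_algebra_closed[OF f] path_algebra_closed[OF g]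
    by (intro finsum_closed) auto
  ultimately show ?thesis unfolding path_algebra_sel(1) by blast
qed

lemma path_algebra_assoc:
  assumes f: "f \<in> carrier (PA w Q)" and g: "g \<in> carrier (PA w Q)" and h: "h \<in> carrier (PA w Q)"
  shows "(f \<otimes>\<^bsub>PA w Q\<^esub> g) \<otimes>\<^bsub>PA w Q\<^esub> h = f \<otimes>\<^bsub>PA w Q\<^esub> (g \<otimes>\<^bsub>PA w Q\<^esub> h)"
proof
  fix p
  note [simp] = path_algebra_closed[OF f] path_algebra_closed[OF g] path_algebra_closed[OF h]
  \<comment> \<open>The term belonging to the cuts of \<open>p\<close> at \<open>m \<le> n\<close>.
    Both bracketings sum it over all such pairs, in different orders.\<close>
  define T where "T m n = f (take (Suc m) p) \<otimes> (g (drop m (take (Suc n) p)) \<otimes> h (drop n p))" for m n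
  have T: "T m n \<in> carrier R" for m n by (simp add: T_def)
  have "((f \<otimes>\<^bsub>PA w Q\<^esub> g) \<otimes>\<^bsub>PA w Q\<^esub> h) p = (\<Oplus>n \<in> {..<length p}. \<Oplus>m \<in> {..<Suc n}. T m n)"
    unfolding path_algebra_sel(2)
  proof (rule finsum_cong')
    fix n assume n: "n \<in> {..<length p}"
    then have len: "length (take (Suc n) p) = Suc n" by simp
    have "(\<Oplus>m \<in> {..<length (take (Suc n) p)}. f (take (Suc m) (take (Suc n) p)) \<otimes>
        g (drop m (take (Suc n) p))) \<otimes> h (drop n p) =
      (\<Oplus>m \<in> {..<Suc n}. f (take (Suc m) (take (Suc n) p)) \<otimes> g (drop m (take (Suc n) p)) \<otimes> h (drop n p))"
      unfolding len by (subst finsum_ldistr) auto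
    also have "\<dots> = (\<Oplus>m \<in> {..<Suc n}. T m n)"
      unfolding T_def by (rule finsum_cong') (auto simp: m_assoc min_def)
    finally show "(\<Oplus>m \<in> {..<length (take (Suc n) p)}. f (take (Suc m) (take (Suc n) p)) \<otimes>
        g (drop m (take (Suc n) p))) \<otimes> h (drop n p) = (\<Oplus>m \<in> {..<Suc n}. T m n)" .
  qed (auto intro!: finsum_closed T)
  also have "\<dots> = (\<Oplus>m \<in> {..<length p}. \<Oplus>l \<in> {..<length p - m}. T m (m + l))"
    by (rule finsum_triangle) (rule T)
  also have "\<dots> = (f \<otimes>\<^bsub>PA w Q\<^esub> (g \<otimes>\<^bsub>PA w Q\<^esub> h)) p"
    unfolding path_algebra_sel(2)
  proof (rule finsum_cong')
    fix m assume m: "m \<in> {..<length p}"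
    have "(\<Oplus>l \<in> {..<length p - m}. T m (m + l)) = (\<Oplus>l \<in> {..<length p - m}. f (take (Suc m) p) \<otimes>
        (g (take (Suc l) (drop m p)) \<otimes> h (drop l (drop m p))))"
      unfolding T_def by (rule finsum_cong') (auto simp: take_drop add.commute)
    then show "(\<Oplus>l \<in> {..<length p - m}. T m (m + l)) = f (take (Suc m) p) \<otimes>
        (\<Oplus>l \<in> {..<length (drop m p)}. g (take (Suc l) (drop m p)) \<otimes> h (drop l (drop m p)))"
      by (simp add: finsum_rdistr Pi_def)
  qed auto
  finally show "((f \<otimes>\<^bsub>PA w Q\<^esub> g) \<otimes>\<^bsub>PA w Q\<^esub> h) p = (f \<otimes>\<^bsub>PA w Q\<^esub> (g \<otimes>\<^bsub>PA w Q\<^esub> h)) p" .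
qed

lemma path_algebra_ring:
  assumes fin: "finite (pverts Q)"
  shows "ring (PA w Q)"
proof (rule ringI[OF path_algebra_abelian_group])
  show "Group.monoid (PA w Q)"
  proof (rule monoidI, goal_cases)
    case 1 then show ?case by (rule path_algebra_mult_closed)
  next
    case 2
    have "{p. (if \<exists>i \<in> pverts Q. p = [i] then \<one> else \<zero>) \<noteq> \<zero>} \<subseteq> (\<lambda>i. [i]) ` pverts Q" by auto
    then show ?case unfolding path_algebra_sel using fin by (auto intro: finite_subset split: if_splits)
  next
    case 3 then show ?case by (rule path_algebra_assoc)
  next
    case (4 f)
    note fc [simp] = path_algebra_closed[OF 4]
    show ?case
    proof
      fix p
      show "(\<one>\<^bsub>PA w Q\<^esub> \<otimes>\<^bsub>PA w Q\<^esub> f) p = f p"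
      \<comment> \<open>A nonzero coefficient makes \<open>p\<close> a walk, so its first vertex
        belongs to the quiver and the cut at 0 meets the unit with coefficient 1.\<close>
      proof (cases "f p = \<zero>")
        case True
        have "\<one>\<^bsub>PA w Q\<^esub> (take (Suc n) p) \<otimes> f (drop n p) = \<zero>" if "n < length p" for n
          using that True by (cases n; cases p) (auto simp: path_algebra_sel(3))
        then show ?thesis unfolding path_algebra_sel(2) True by (intro add.finprod_one_eqI) auto
      next
        case False
        then have w: "vwalk p (with_proj Q)" using path_algebra_outside[OF 4] by blast
        then obtain i q where p: "p = i # q" "i \<in> pverts Q" by (cases p) (auto simp: vwalk_def)
        have "(\<one>\<^bsub>PA w Q\<^esub> \<otimes>\<^bsub>PA w Q\<^esub> f) p = (\<Oplus>n \<in> {..<length p}. if n = 0 then f p else \<zero>)"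
          unfolding path_algebra_sel(2)
          by (rule finsum_cong') (auto simp: path_algebra_sel(3) p take_Suc_conv_app_nth split: nat.splits)
        also have "\<dots> = f p" using finsum_singleton[of 0 "{..<length p}" "\<lambda>_. f p"] p by simp
        finally show ?thesis .
      qed
    qed
  next
    case (5 f)
    note fc [simp] = path_algebra_closed[OF 5]
    have one: "\<one>\<^bsub>PA w Q\<^esub> (drop n p) = \<zero>" if "n < length p - 1" for n p
      using that by (auto simp: path_algebra_sel(3) dest!: arg_cong[where f = length])
    show ?case
    proof
      fix p
      show "(f \<otimes>\<^bsub>PA w Q\<^esub> \<one>\<^bsub>PA w Q\<^esub>) p = f p"
      proof (cases "f p = \<zero>")
        case True
        have "f (take (Suc n) p) \<otimes> \<one>\<^bsub>PA w Q\<^esub> (drop n p) = \<zero>" if "n < length p" for n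
        proof (cases "n < length p - 1")
          case False
          then have "take (Suc n) p = p" using that by simp
          then show ?thesis using True by (simp add: path_algebra_sel(3))
        qed (simp add: one)
        then show ?thesis unfolding path_algebra_sel(2) True by (intro add.finprod_one_eqI) auto
      next
        case False
        then have w: "vwalk p (with_proj Q)" using path_algebra_outside[OF 5] by blast
        then have p: "p \<noteq> []" "last p \<in> pverts Q" by (auto simp: vwalk_def)
        \<comment> \<open>The last cut is the only one whose final piece is a single vertex, so it
          alone meets the unit.\<close>
        have d: "drop (length p - 1) p = [last p]" using p(1)
          by (metis append_butlast_last_id append_eq_conv_conj length_butlast)
        have "(f \<otimes>\<^bsub>PA w Q\<^esub> \<one>\<^bsub>PA w Q\<^esub>) p = (\<Oplus>n \<in> {..<length p}. if n = length p - 1 then f p else \<zero>)"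
          unfolding path_algebra_sel(2)
        proof (rule finsum_cong')
          fix n assume n: "n \<in> {..<length p}"
          show "f (take (Suc n) p) \<otimes> \<one>\<^bsub>PA w Q\<^esub> (drop n p) = (if n = length p - 1 then f p else \<zero>)"
          proof (cases "n = length p - 1")
            case True
            then show ?thesis using d p by (simp add: path_algebra_sel(3))
          next
            case False
            then have "n < length p - 1" using n by auto
            then show ?thesis using one False by simp
          qed
        qed auto
        also have "\<dots> = f p"
          using add.finprod_singleton_swap[of "length p - 1" "{..<length p}" "\<lambda>_. f p"] p by simp
        finally show ?thesis .
      qed
    qed
  qed
next
  fix x y z assume x: "x \<in> carrier (PA w Q)" and y: "y \<in> carrier (PA w Q)" and z: "z \<in> carrier (PA w Q)"
  note [simp] = path_algebra_closed[OF x] path_algebra_closed[OF y] path_algebra_closed[OF z]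
  show "(x \<oplus>\<^bsub>PA w Q\<^esub> y) \<otimes>\<^bsub>PA w Q\<^esub> z = x \<otimes>\<^bsub>PA w Q\<^esub> z \<oplus>\<^bsub>PA w Q\<^esub> y \<otimes>\<^bsub>PA w Q\<^esub> z"
    by (auto simp: path_algebra_sel(2,5) l_distr finsum_addf Pi_def)
  show "z \<otimes>\<^bsub>PA w Q\<^esub> (x \<oplus>\<^bsub>PA w Q\<^esub> y) = z \<otimes>\<^bsub>PA w Q\<^esub> x \<oplus>\<^bsub>PA w Q\<^esub> z \<otimes>\<^bsub>PA w Q\<^esub> y"
    by (auto simp: path_algebra_sel(2,5) r_distr finsum_addf Pi_def)
qed

lemma path_element_closed:
  "vwalk p (with_proj Q) \<Longrightarrow> path_element R p \<in> carrier (PA w Q)"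
proof -
  have "{q. path_element R p q \<noteq> \<zero>} \<subseteq> {p}" by (auto simp: path_element_def)
  then show "vwalk p (with_proj Q) \<Longrightarrow> ?thesis"
    unfolding path_algebra_sel by (auto simp: path_element_def intro: finite_subset)
qed

lemma path_element_mult:
  assumes "n < length p"
  shows "path_element R (take (Suc n) p) \<otimes>\<^bsub>PA w Q\<^esub> path_element R (drop n p) = path_element R p"
proof
  fix q
  \<comment> \<open>A path and the place of its cut are recovered from the two pieces, so the
    product has a single nonzero term, and that term sits at \<open>p\<close>.\<close>
  have pq: "m = n \<and> q = p" if "take (Suc m) q = take (Suc n) p" "drop m q = drop n p" "m < length q" for m
  proof -
    have mn: "m = n" using arg_cong[OF that(1), of length] assms that(3) by simp
    then have "take n q = take n p" using that(1)
      by (metis assms butlast_take diff_Suc_1 Suc_leI that(3))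
    then show ?thesis using mn that(2) by (metis append_take_drop_id)
  qed
  show "(path_element R (take (Suc n) p) \<otimes>\<^bsub>PA w Q\<^esub> path_element R (drop n p)) q = path_element R p q"
  proof (cases "q = p")
    case True
    have "(path_element R (take (Suc n) p) \<otimes>\<^bsub>PA w Q\<^esub> path_element R (drop n p)) q =
        (\<Oplus>m \<in> {..<length q}. if m = n then \<one> else \<zero>)"
      unfolding path_algebra_sel(2) by (rule finsum_cong') (use pq True in \<open>auto simp: path_element_def\<close>)
    also have "\<dots> = \<one>" using add.finprod_singleton_swap[of n "{..<length q}" "\<lambda>_. \<one>"] assms True by simp
    finally show ?thesis using True by (simp add: path_element_def)
  next
    case False
    then have "path_element R (take (Suc n) p) (take (Suc m) q) \<otimes> path_element R (drop n p) (drop m q) = \<zero>"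
      if "m < length q" for m using pq[of m] that by (auto simp: path_element_def)
    then show ?thesis unfolding path_algebra_sel(2) using False
      by (subst add.finprod_one_eqI) (auto simp: path_element_def)
  qed
qed

end

section \<open>Zigzag algebras in coordinates\<close>

locale connected_zigzag_graph = zigzag_graph K G for K :: "('k, 'd) ring_scheme" (structure) and G :: "'v pair_pre_digraph" +
  assumes reach: "i \<in> pverts G \<Longrightarrow> j \<in> pverts G \<Longrightarrow> (i, j) \<in> (parcs G)\<^sup>*"
    and nonempty_verts: "pverts G \<noteq> {}"
begin

text \<open>A walk from inside \<open>S\<close> to a vertex outside has to leave \<open>S\<close>
  somewhere. Applied to one vertex this gives a neighbour; applied to the two ends of an edge it
  gives a third vertex next to that edge.\<close>

lemma cut_arc:
  assumes "S \<subseteq> pverts G" "S \<noteq> {}" "S \<noteq> pverts G"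
  obtains i j where "i \<in> S" "j \<in> pverts G" "j \<notin> S" "(i, j) \<in> parcs G"
proof -
  obtain u v where u: "u \<in> S" and v: "v \<in> pverts G" "v \<notin> S" using assms by blast
  have "(u, v) \<in> (parcs G)\<^sup>*" using u assms(1) by (intro reach[OF _ v(1)]) auto
  then have "v \<in> S \<or> (\<exists>i j. i \<in> S \<and> j \<in> pverts G \<and> j \<notin> S \<and> (i, j) \<in> parcs G)"
  proof (induction rule: rtrancl_induct)
    case (step j k)
    then show ?case using arcs_in_verts[of j k] by metis
  qed (use u in simp)
  then show ?thesis using v(2) that by metis
qed

section \<open>Coordinates of paths: a graded surjection from the path algebra onto the
  model\<close>

abbreviation ZP :: "('k, 'v list \<Rightarrow> 'k) graded_module" where
  "ZP \<equiv> zigzag_path_algebra K G"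

abbreviation L :: "'v \<Rightarrow> 'v list set" where
  "L \<equiv> zigzag_loop_paths G"

lemma quiver_verts [simp]: "pverts (zigzag_quiver G) = pverts G"
  by (simp add: zigzag_quiver_def)

lemma single_no_arcs: "card (pverts G) = 1 \<Longrightarrow> (i, j) \<notin> parcs G"
  using arcs_in_verts arc_irrefl by (metis card_1_singletonE singletonD)

lemma arc_in_quiver: "(i, j) \<in> parcs G \<Longrightarrow> (i, j) \<in> parcs (zigzag_quiver G)"
  using single_no_arcs by (auto simp: zigzag_quiver_def)

text \<open>The representatives of x_i are \<open>[i, i]\<close> in the one-vertex graph and
  \<open>[i, j, i]\<close> otherwise. These facts let later proofs treat both shapes at
  once.\<close>

lemma loop_path:
  assumes "i \<in> pverts G" "p \<in> L i"
  shows "hd p = i" "1 < length p" "length p \<le> 3" "vwalk p (with_proj (zigzag_quiver G))"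
    "length p = 2 \<Longrightarrow> L i = {p}" "(i, j) \<in> parcs G \<Longrightarrow> length p = 3"
  using assms single_no_arcs arcs_in_verts arc_sym
  by (auto simp: zigzag_loop_paths_def zigzag_quiver_def vwalk_def split: if_splits)

lemma loop_paths_nonempty: "i \<in> pverts G \<Longrightarrow> L i \<noteq> {}"
proof (cases "card (pverts G) = 1")
  case False
  assume i: "i \<in> pverts G"
  then have "{i} \<noteq> pverts G" using False by (metis is_singletonI is_singleton_altdef)
  then obtain j where "(i, j) \<in> parcs G" using cut_arc[of "{i}"] i by blast
  then show ?thesis using False by (auto simp: zigzag_loop_paths_def)
qed (simp add: zigzag_loop_paths_def)

lemma finite_loop_paths: "finite (L i)"
proof -
  have "{[i, j, i] | j. (i, j) \<in> parcs G} = (\<lambda>j. [i, j, i]) ` {j. (i, j) \<in> parcs G}" by auto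
  then show ?thesis using finite_nbrs by (simp add: zigzag_loop_paths_def)
qed

definition loop_path_at :: "'v \<Rightarrow> 'v list" where
  "loop_path_at i = (SOME p. p \<in> L i)"

lemma loop_path_at: "i \<in> pverts G \<Longrightarrow> loop_path_at i \<in> L i"
  unfolding loop_path_at_def using loop_paths_nonempty by (simp add: some_in_eq)

text \<open>The loop coordinate sums over all representatives of x_i, since the relations identify
  them. The guard for arrows excludes \<open>[i, i]\<close>, which is a path of the one-vertex
  quiver but stands for a loop. All other paths have no coordinate, as they are to vanish.\<close>

definition path_coords :: "('v list \<Rightarrow> 'k) \<Rightarrow> 'v zbasis \<Rightarrow> 'k" where
  "path_coords f b = (case b of
     Vertex i \<Rightarrow> f [i]
   | Arrow i j \<Rightarrow> (if (i, j) \<in> parcs G then f [i, j] else \<zero>)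
   | Loop i \<Rightarrow> (if i \<in> pverts G then (\<Oplus>p \<in> L i. f p) else \<zero>))"

definition chosen_loop :: "'v list \<Rightarrow> bool" where
  "chosen_loop p \<longleftrightarrow> hd p \<in> pverts G \<and> p = loop_path_at (hd p)"

text \<open>A linear right inverse of \<open>path_coords\<close> that puts the loop coordinate on
  one chosen representative. The test for the chosen loop comes first because in the one-vertex
  graph that path has length 2, like an arrow.\<close>

definition path_section :: "('v zbasis \<Rightarrow> 'k) \<Rightarrow> 'v list \<Rightarrow> 'k" where
  "path_section g p = (if chosen_loop p then g (Loop (hd p))
     else if length p = 1 then g (Vertex (hd p))
     else if length p = 2 then g (Arrow (hd p) (last p)) else \<zero>)"

lemma path_coords_simps [simp]:
  "path_coords f (Vertex i) = f [i]"
  "path_coords f (Arrow i j) = (if (i, j) \<in> parcs G then f [i, j] else \<zero>)"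
  "path_coords f (Loop i) = (if i \<in> pverts G then (\<Oplus>p \<in> L i. f p) else \<zero>)"
  by (simp_all add: path_coords_def)

lemma ZP_closed: "f \<in> carrier ZP \<Longrightarrow> f p \<in> carrier K"
  unfolding zigzag_path_algebra_def by (rule path_algebra_closed)

lemma ZP_outside: "f \<in> carrier ZP \<Longrightarrow> \<not> vwalk p (with_proj (zigzag_quiver G)) \<Longrightarrow> f p = \<zero>"
  unfolding zigzag_path_algebra_def by (rule path_algebra_outside)

lemma ZP_ring: "ring ZP"
  unfolding zigzag_path_algebra_def by (rule path_algebra_ring) (simp add: finite_verts)

lemma path_coords_closed:
  assumes "f \<in> carrier ZP"
  shows "path_coords f \<in> carrier (Z {})"
proof -
  note [simp] = ZP_closed[OF assms]
  have "path_coords f b \<in> carrier K" for b by (cases b) auto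
  moreover have "path_coords f b = \<zero>" if "b \<notin> zigzag_basis G {}" for b
    using that ZP_outside[OF assms, of "[i]" for i] by (cases b) (auto simp: vwalk_def)
  ultimately show ?thesis by (simp add: model_sel)
qed

lemma path_section_closed:
  assumes g: "g \<in> carrier (Z {})"
  shows "path_section g \<in> carrier ZP"
proof -
  note [simp] = model_closed[OF g]
  have cl: "path_section g p \<in> carrier K" for p by (simp add: path_section_def chosen_loop_def)
  have walk: "vwalk p (with_proj (zigzag_quiver G)) \<and> length p \<le> 3" if nz: "path_section g p \<noteq> \<zero>" for p
  proof -
    consider "hd p \<in> pverts G" "p = loop_path_at (hd p)" | "length p = 1" "g (Vertex (hd p)) \<noteq> \<zero>"
      | "length p = 2" "g (Arrow (hd p) (last p)) \<noteq> \<zero>"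
      using nz unfolding path_section_def chosen_loop_def by (auto split: if_splits)
    then show ?thesis
    proof cases
      case 1
      then show ?thesis using loop_path(3,4)[OF 1(1) loop_path_at[OF 1(1)]] by simp
    next
      case 2
      then have "hd p \<in> pverts G" using model_outside[OF g] basis_iff(1) by blast
      moreover obtain i where "p = [i]" using 2(1) by (auto simp: length_Suc_conv)
      ultimately show ?thesis by (simp add: vwalk_def)
    next
      case 3
      then have "(hd p, last p) \<in> parcs G" using model_outside[OF g] basis_iff(2) by blast
      moreover obtain i j where "p = [i, j]" using 3(1) by (auto simp: length_Suc_conv numeral_2_eq_2)
      ultimately show ?thesis using arc_in_quiver arcs_in_verts by (auto simp: vwalk_def)
    qed
  qed
  have "{p. path_section g p \<noteq> \<zero>} \<subseteq> {p. set p \<subseteq> pverts G \<and> length p \<le> 3}"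
    using walk by (auto simp: vwalk_def)
  then have "finite {p. path_section g p \<noteq> \<zero>}"
    by (rule finite_subset) (rule finite_lists_length_le[OF finite_verts])
  then show ?thesis unfolding zigzag_path_algebra_def path_algebra_sel(1) using cl walk by blast
qed

lemma path_coords_section:
  assumes g: "g \<in> carrier (Z {})"
  shows "path_coords (path_section g) = g"
proof
  fix b
  note [simp] = model_closed[OF g]
  note lp = loop_path[OF _ loop_path_at]
  show "path_coords (path_section g) b = g b"
  proof (cases b)
    case (Vertex i)
    have "[i] \<noteq> loop_path_at i" if "i \<in> pverts G"
      using lp(2)[OF that that] by (metis One_nat_def length_Cons less_irrefl list.size(3))
    then have n: "\<not> (hd [i] \<in> pverts G \<and> [i] = loop_path_at (hd [i]))" by (metis list.sel(1))
    have "path_section g [i] = g (Vertex i)" unfolding path_section_def chosen_loop_def if_not_P[OF n] by simp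
    then show ?thesis using Vertex by simp
  next
    case (Arrow i j)
    show ?thesis
    proof (cases "(i, j) \<in> parcs G")
      case True
      then have "i \<in> pverts G" using arcs_in_verts by blast
      from lp(6)[OF this this True] have "[i, j] \<noteq> loop_path_at i"
        by (metis length_Cons list.size(3) numeral_3_eq_3 n_not_Suc_n)
      then have n: "\<not> (hd [i, j] \<in> pverts G \<and> [i, j] = loop_path_at (hd [i, j]))" by (metis list.sel(1))
      have "path_section g [i, j] = g (Arrow i j)" unfolding path_section_def chosen_loop_def if_not_P[OF n] by simp
      then show ?thesis using Arrow True by simp
    next
      case False
      then show ?thesis using Arrow model_outside[OF g, of b] by simp
    qed
  next
    case (Loop i)
    show ?thesis
    proof (cases "i \<in> pverts G")
      case True
      have "(\<Oplus>p \<in> L i. path_section g p) = path_section g (loop_path_at i)"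
      proof (rule finsum_eq_single[OF finite_loop_paths loop_path_at[OF True]])
        show "path_section g (loop_path_at i) \<in> carrier K"
          by (rule ZP_closed[OF path_section_closed[OF g]])
        fix p assume p: "p \<in> L i" "p \<noteq> loop_path_at i"
        have "p \<noteq> loop_path_at (hd p)" using loop_path(1)[OF True p(1)] p(2) by simp
        moreover have "length p \<noteq> 1" using loop_path(2)[OF True p(1)] by simp
        \<comment> \<open>A loop path with two entries occurs only in the one-vertex graph, where it
          is the sole representative and hence the chosen one.\<close>
        moreover have "length p \<noteq> 2"
        proof
          assume "length p = 2"
          from loop_path(5)[OF True p(1) this] loop_path_at[OF True]
          have "loop_path_at i = p" by (metis singletonD)
          then show False using p(2) by simp
        qed
        ultimately show "path_section g p = \<zero>" unfolding path_section_def chosen_loop_def by (simp only: if_False simp_thms)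
      qed
      also have "\<dots> = g (Loop i)"
      proof -
        have hd: "hd (loop_path_at i) = i" by (rule lp(1)[OF True True])
        show ?thesis unfolding path_section_def chosen_loop_def hd using True by (simp only: simp_thms if_True)
      qed
      finally show ?thesis using Loop True by simp
    next
      case False
      then show ?thesis using Loop model_outside[OF g, of b] by simp
    qed
  qed
qed

text \<open>Only paths with at most two arrows have coordinates, and their cuts are the terms of
  \<open>zigzag_mult\<close>: for \<open>[i, j, i]\<close> the two outer cuts give vertex times loop
  and loop times vertex, the middle cut gives arrow times arrow.\<close>

lemma path_coords_mult:
  assumes f: "f \<in> carrier ZP" and g: "g \<in> carrier ZP"
  shows "path_coords (f \<otimes>\<^bsub>ZP\<^esub> g) = zigzag_mult K G {} (path_coords f) (path_coords g)"
proof
  fix b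
  note [simp] = ZP_closed[OF f] ZP_closed[OF g]
  have m: "(f \<otimes>\<^bsub>ZP\<^esub> g) p = (\<Oplus>n \<in> {..<length p}. f (take (Suc n) p) \<otimes> g (drop n p))" for p
    unfolding zigzag_path_algebra_def by (simp add: path_algebra_sel)
  have m1: "(f \<otimes>\<^bsub>ZP\<^esub> g) [i] = f [i] \<otimes> g [i]" for i
    unfolding m by (simp add: lessThan_Suc)
  have m2: "(f \<otimes>\<^bsub>ZP\<^esub> g) [i, j] = f [i] \<otimes> g [i, j] \<oplus> f [i, j] \<otimes> g [j]" for i j
    unfolding m by (simp add: lessThan_Suc a_ac)
  have m3: "(f \<otimes>\<^bsub>ZP\<^esub> g) [i, j, k] = f [i] \<otimes> g [i, j, k] \<oplus> f [i, j, k] \<otimes> g [k] \<oplus> f [i, j] \<otimes> g [j, k]" for i j k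
    unfolding m by (simp add: lessThan_Suc a_ac)
  show "path_coords (f \<otimes>\<^bsub>ZP\<^esub> g) b = zigzag_mult K G {} (path_coords f) (path_coords g) b"
  proof (cases b)
    case (Loop i)
    show ?thesis
    proof (cases "card (pverts G) = 1")
      case True
      then show ?thesis unfolding Loop
        by (simp add: zigzag_mult_simps m2 zigzag_loop_paths_def single_no_arcs)
    next
      case False
      have L: "L i = (\<lambda>j. [i, j, i]) ` {j. (i, j) \<in> parcs G}"
        using False by (auto simp: zigzag_loop_paths_def)
      have inj: "inj_on (\<lambda>j. [i, j, i]) {j. (i, j) \<in> parcs G}" by (auto simp: inj_on_def)
      have sum: "(\<Oplus>p \<in> L i. F p) = (\<Oplus>j \<in> {j. (i, j) \<in> parcs G}. F [i, j, i])"
        if "\<And>p. F p \<in> carrier K" for F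
        unfolding L by (subst finsum_reindex[OF _ inj]) (use that in auto)
      have mc: "(f \<otimes>\<^bsub>ZP\<^esub> g) p \<in> carrier K" for p unfolding m by (intro finsum_closed) auto
      have "(\<Oplus>j \<in> {j. (i, j) \<in> parcs G}. f [i] \<otimes> g [i, j, i] \<oplus> f [i, j, i] \<otimes> g [i] \<oplus> f [i, j] \<otimes> g [j, i]) =
        f [i] \<otimes> (\<Oplus>j \<in> {j. (i, j) \<in> parcs G}. g [i, j, i]) \<oplus>
        (\<Oplus>j \<in> {j. (i, j) \<in> parcs G}. f [i, j, i]) \<otimes> g [i] \<oplus>
        (\<Oplus>j \<in> {j. (i, j) \<in> parcs G}. f [i, j] \<otimes> g [j, i])"
        by (simp add: finsum_addf finsum_ldistr finsum_rdistr finite_nbrs Pi_def)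
      moreover have "(\<Oplus>j \<in> {j. (i, j) \<in> parcs G}. path_coords f (Arrow i j) \<otimes> path_coords g (Arrow j i)) =
        (\<Oplus>j \<in> {j. (i, j) \<in> parcs G}. f [i, j] \<otimes> g [j, i])"
        by (rule finsum_cong') (auto dest: arc_sym)
      ultimately show ?thesis unfolding Loop
        by (simp add: zigzag_mult_simps sum mc m3 del: path_coords_simps(2))
    qed
  qed (auto simp: zigzag_mult_simps m1 m2)
qed

lemma path_coords_add:
  assumes "f \<in> carrier ZP" "g \<in> carrier ZP"
  shows "path_coords (f \<oplus>\<^bsub>ZP\<^esub> g) = path_coords f \<oplus>\<^bsub>Z {}\<^esub> path_coords g"
proof
  fix b
  have s: "f \<oplus>\<^bsub>ZP\<^esub> g = (\<lambda>p. f p \<oplus> g p)"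
    unfolding zigzag_path_algebra_def by (simp add: path_algebra_sel)
  note [simp] = ZP_closed[OF assms(1)] ZP_closed[OF assms(2)]
  show "path_coords (f \<oplus>\<^bsub>ZP\<^esub> g) b = (path_coords f \<oplus>\<^bsub>Z {}\<^esub> path_coords g) b"
    unfolding s by (cases b) (auto simp: model_sel finsum_addf Pi_def)
qed

lemma path_coords_one: "path_coords \<one>\<^bsub>ZP\<^esub> = \<one>\<^bsub>Z {}\<^esub>"
proof
  fix b
  have s: "\<one>\<^bsub>ZP\<^esub> = (\<lambda>p. if \<exists>i \<in> pverts G. p = [i] then \<one> else \<zero>)"
    unfolding zigzag_path_algebra_def by (simp add: path_algebra_sel)
  have "(\<Oplus>p \<in> L i. if \<exists>i \<in> pverts G. p = [i] then \<one> else \<zero>) = \<zero>" if "i \<in> pverts G" for i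
  proof (rule add.finprod_one_eqI)
    fix p assume "p \<in> L i"
    then have "\<not> (\<exists>i \<in> pverts G. p = [i])" using loop_path(2)[OF that] by force
    then show "(if \<exists>i \<in> pverts G. p = [i] then \<one> else \<zero>) = \<zero>" by simp
  qed
  then show "path_coords \<one>\<^bsub>ZP\<^esub> b = \<one>\<^bsub>Z {}\<^esub> b"
    unfolding s by (cases b) (auto simp: model_sel image_iff)
qed

lemma path_coords_smult:
  assumes k: "k \<in> carrier K" and f: "f \<in> carrier ZP"
  shows "k \<odot>\<^bsub>ZP\<^esub> f \<in> carrier ZP" "path_coords (k \<odot>\<^bsub>ZP\<^esub> f) = k \<odot>\<^bsub>Z {}\<^esub> path_coords f"
proof -
  have s: "k \<odot>\<^bsub>ZP\<^esub> f = (\<lambda>p. k \<otimes> f p)"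
    unfolding zigzag_path_algebra_def by (simp add: path_algebra_sel)
  have "{p. k \<otimes> f p \<noteq> \<zero>} \<subseteq> {p. f p \<noteq> \<zero>}" using k by auto
  then have "finite {p. k \<otimes> f p \<noteq> \<zero>}"
    using f unfolding zigzag_path_algebra_def path_algebra_sel(1) by (auto intro: finite_subset)
  moreover have "vwalk p (with_proj (zigzag_quiver G))" if "k \<otimes> f p \<noteq> \<zero>" for p
    using that ZP_outside[OF f, of p] k r_null by metis
  ultimately show "k \<odot>\<^bsub>ZP\<^esub> f \<in> carrier ZP"
    unfolding s unfolding zigzag_path_algebra_def path_algebra_sel(1) using ZP_closed[OF f] k by simp
  show "path_coords (k \<odot>\<^bsub>ZP\<^esub> f) = k \<odot>\<^bsub>Z {}\<^esub> path_coords f"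
  proof
    fix b show "path_coords (k \<odot>\<^bsub>ZP\<^esub> f) b = (k \<odot>\<^bsub>Z {}\<^esub> path_coords f) b"
      unfolding s using ZP_closed[OF f] k
      by (cases b) (auto simp: model_sel finsum_rdistr finite_loop_paths Pi_def)
  qed
qed

lemma ZP_grade: "grade ZP n = {f \<in> carrier ZP. \<forall>p. f p \<noteq> \<zero> \<longrightarrow>
    (if card (pverts G) = 1 then 2 else 1) * int (length p - 1) = n}"
  unfolding zigzag_path_algebra_def by (simp add: path_algebra_sel(7))

text \<open>The one-vertex quiver has a loop of weight 2; otherwise a loop path consists of two
  arrows of weight 1.\<close>

lemma loop_path_degree:
  "p \<in> L i \<Longrightarrow> (if card (pverts G) = 1 then 2 else 1) * int (length p - 1) = 2"
  by (auto simp: zigzag_loop_paths_def split: if_splits)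

lemma path_coords_grade:
  assumes f: "f \<in> grade ZP n"
  shows "path_coords f \<in> grade (Z {}) n"
proof -
  let ?w = "if card (pverts G) = 1 then 2 else 1 :: int"
  have fc: "f \<in> carrier ZP" and fn: "\<And>p. f p \<noteq> \<zero> \<Longrightarrow> ?w * int (length p - 1) = n"
    using f unfolding ZP_grade by blast+
  have "zdegree b = n" if nz: "path_coords f b \<noteq> \<zero>" for b
  proof (cases b)
    case (Vertex i)
    then show ?thesis using nz fn[of "[i]"] by simp
  next
    case (Arrow i j)
    then show ?thesis using nz fn[of "[i, j]"] single_no_arcs by (auto split: if_splits)
  next
    case (Loop i)
    then have "\<exists>p \<in> L i. f p \<noteq> \<zero>"
      using nz add.finprod_one_eqI[of "L i" f] by (auto split: if_splits)
    then obtain p where p: "p \<in> L i" "f p \<noteq> \<zero>" by blast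
    from fn[OF p(2)] loop_path_degree[OF p(1)] have "n = 2" by (simp only:)
    then show ?thesis using Loop by simp
  qed
  then show ?thesis using path_coords_closed[OF fc] by (simp add: model_sel(7))
qed

lemma path_section_grade:
  assumes g: "g \<in> grade (Z {}) n"
  shows "path_section g \<in> grade ZP n"
proof -
  let ?w = "if card (pverts G) = 1 then 2 else 1 :: int"
  have gc: "g \<in> carrier (Z {})" and gn: "\<And>b. g b \<noteq> \<zero> \<Longrightarrow> zdegree b = n"
    using g unfolding model_sel(7) by blast+
  have "?w * int (length p - 1) = n" if nz: "path_section g p \<noteq> \<zero>" for p
  proof -
    consider "hd p \<in> pverts G" "p = loop_path_at (hd p)" "g (Loop (hd p)) \<noteq> \<zero>"
      | "length p = 1" "g (Vertex (hd p)) \<noteq> \<zero>"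
      | "length p = 2" "g (Arrow (hd p) (last p)) \<noteq> \<zero>"
      using nz unfolding path_section_def chosen_loop_def by (auto split: if_splits)
    then show ?thesis
    proof cases
      case 1
      have "p \<in> L (hd p)" using loop_path_at[OF 1(1)] by (simp only: 1(2)[symmetric])
      from loop_path_degree[OF this] gn[OF 1(3)] show ?thesis by (simp only: zdegree.simps)
    next
      case 2
      then show ?thesis using gn[OF 2(2)] by simp
    next
      case 3
      then have "(hd p, last p) \<in> parcs G" using model_outside[OF gc] basis_iff(2) by blast
      then show ?thesis using gn[OF 3(2)] 3(1) single_no_arcs by auto
    qed
  qed
  then show ?thesis using path_section_closed[OF gc] unfolding ZP_grade by blast
qed

lemma path_coords_epi: "graded_epi K ZP (Z {}) path_coords"
  unfolding graded_epi_def
proof (intro conjI allI ballI)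
  show "path_coords \<in> ring_hom ZP (Z {})"
    by (rule ring_hom_memI)
      (simp_all only: path_coords_closed path_coords_mult path_coords_add path_coords_one model_sel(2))
  show "path_coords ` carrier ZP = carrier (Z {})"
  proof
    show "carrier (Z {}) \<subseteq> path_coords ` carrier ZP"
      using path_coords_section path_section_closed by (intro subsetI) (rule image_eqI, auto)
  qed (use path_coords_closed in blast)
  show "grade ZP n \<subseteq> carrier ZP" for n unfolding ZP_grade by blast
  show "path_coords ` grade ZP n = grade (Z {}) n" for n
  proof
    show "grade (Z {}) n \<subseteq> path_coords ` grade ZP n"
    proof
      fix g assume g: "g \<in> grade (Z {}) n"
      then have gc: "g \<in> carrier (Z {})" unfolding model_sel(7) by blast
      have "path_coords (path_section g) \<in> path_coords ` grade ZP n"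
        by (rule imageI) (rule path_section_grade[OF g])
      then show "g \<in> path_coords ` grade ZP n" by (simp only: path_coords_section[OF gc])
    qed
  qed (use path_coords_grade in blast)
qed (fact path_coords_smult)+


section \<open>The ideal of relations is the kernel of the coordinate map\<close>

abbreviation I :: "('v list \<Rightarrow> 'k) set" where
  "I \<equiv> zigzag_ideal K G"

abbreviation path :: "'v list \<Rightarrow> 'v list \<Rightarrow> 'k" where
  "path \<equiv> path_element K"

abbreviation walk :: "'v list \<Rightarrow> bool" where
  "walk p \<equiv> vwalk p (with_proj (zigzag_quiver G))"

lemma path_closed: "walk p \<Longrightarrow> path p \<in> carrier ZP"
  unfolding zigzag_path_algebra_def by (rule path_element_closed)

lemma path_mult: "n < length p \<Longrightarrow> path (take (Suc n) p) \<otimes>\<^bsub>ZP\<^esub> path (drop n p) = path p"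
  unfolding zigzag_path_algebra_def by (rule path_element_mult)

lemma walk_take: "walk p \<Longrightarrow> walk (take (Suc n) p)"
  unfolding vwalk_iff_nth by (auto dest: in_set_takeD)

lemma walk_drop: "walk p \<Longrightarrow> n < length p \<Longrightarrow> walk (drop n p)"
  unfolding vwalk_iff_nth by (auto dest: in_set_dropD)

lemma quiver_eq: "card (pverts G) \<noteq> 1 \<Longrightarrow> zigzag_quiver G = G"
  by (simp add: zigzag_quiver_def)

lemma two_verts:
  assumes "card (pverts G) = 2" "i \<in> pverts G" "j \<in> pverts G" "k \<in> pverts G" "i \<noteq> j" "k \<noteq> j"
  shows "k = i"
proof -
  obtain x y where "pverts G = {x, y}" using assms(1) by (auto simp: card_2_iff)
  then show ?thesis using assms by auto
qed

lemma relations_closed: "zigzag_relations K G \<subseteq> carrier ZP"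
proof -
  interpret R: ring ZP by (rule ZP_ring)
  have walks: "walk [i, j, k]" if "(i, j) \<in> parcs G" "(j, k) \<in> parcs G" for i j k
    using that arc_in_quiver arcs_in_verts by (auto simp: vwalk_def)
  have "path [i, j, k] \<in> carrier ZP" if "(i, j) \<in> parcs G" "(j, k) \<in> parcs G" for i j k
    using walks[OF that] by (rule path_closed)
  then have "path [i, j, i] \<ominus>\<^bsub>ZP\<^esub> path [i, k, i] \<in> carrier ZP"
    if "(i, j) \<in> parcs G" "(i, k) \<in> parcs G" for i j k
    using that arc_sym by (intro R.minus_closed) auto
  moreover have "path [i, i, i] \<in> carrier ZP" if "i \<in> pverts G" "card (pverts G) = 1" for i
    by (rule path_closed) (use that in \<open>simp add: vwalk_def zigzag_quiver_def Id_on_iff\<close>)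
  moreover have "path p \<in> carrier ZP" if "vwalk p (with_proj G)" "card (pverts G) = 2" for p
    by (rule path_closed) (use that in \<open>simp add: quiver_eq\<close>)
  ultimately show ?thesis
    using \<open>\<And>i j k. (i, j) \<in> parcs G \<Longrightarrow> (j, k) \<in> parcs G \<Longrightarrow> path [i, j, k] \<in> carrier ZP\<close>
    unfolding zigzag_relations_def by auto
qed

lemma ideal_I: "ideal I ZP"
  unfolding zigzag_ideal_def by (rule ring.genideal_ideal[OF ZP_ring relations_closed])

lemma relations_in_I: "zigzag_relations K G \<subseteq> I"
  unfolding zigzag_ideal_def by (rule ring.genideal_self[OF ZP_ring relations_closed])

lemma I_prefix: "walk p \<Longrightarrow> n < length p \<Longrightarrow> path (take (Suc n) p) \<in> I \<Longrightarrow> path p \<in> I"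
  using ideal.I_r_closed[OF ideal_I _ path_closed[OF walk_drop]] path_mult by metis

lemma I_suffix: "walk p \<Longrightarrow> n < length p \<Longrightarrow> path (drop n p) \<in> I \<Longrightarrow> path p \<in> I"
  using ideal.I_l_closed[OF ideal_I _ path_closed[OF walk_take]] path_mult by metis

lemma I_cong:
  assumes "x \<ominus>\<^bsub>ZP\<^esub> y \<in> I" "y \<in> I" "x \<in> carrier ZP"
  shows "x \<in> I"
proof -
  interpret I: ideal I ZP by (rule ideal_I)
  have "(x \<ominus>\<^bsub>ZP\<^esub> y) \<oplus>\<^bsub>ZP\<^esub> y = x"
    using assms(3) I.a_Hcarr[OF assms(2)] by (simp add: I.minus_eq I.a_assoc I.l_neg)
  then show ?thesis
    using additive_subgroup.a_closed[OF ideal.axioms(1)[OF ideal_I] assms(1,2)] by simp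
qed

text \<open>The paths that survive the relations. With two vertices the vanishing of paths of length
  three is imposed; with three or more vertices it has to be derived from the quadratic
  relations.\<close>

lemma walk_normal_or_I:
  assumes p: "walk p"
  shows "(\<exists>i \<in> pverts G. p = [i]) \<or> (\<exists>i j. (i, j) \<in> parcs G \<and> p = [i, j]) \<or>
    (\<exists>i \<in> pverts G. p \<in> L i) \<or> path p \<in> I"
proof -
  interpret I: ideal I ZP by (rule ideal_I)
  consider "card (pverts G) = 1" | "card (pverts G) = 2" | "card (pverts G) \<noteq> 1" "card (pverts G) \<noteq> 2"
    by blast
  then show ?thesis
  proof cases
    case 1
    then obtain i where i: "pverts G = {i}" by (rule card_1_singletonE)
    have "\<forall>j \<in> set p. j = i" "p \<noteq> []" using p i by (auto simp: vwalk_def)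
    then have rep: "p = replicate (length p) i" "p \<noteq> []" using replicate_length_same by metis+
    have "length p \<noteq> 0" using rep(2) by simp
    then consider "length p = 1" | "length p = 2" | "2 < length p" by linarith
    then show ?thesis
    proof cases
      case a: 1
      then have "p = [i]" using rep(1) by simp
      then show ?thesis using i by blast
    next
      case a: 2
      then have "p = [i, i]" using rep(1) by (simp add: numeral_2_eq_2)
      then show ?thesis using i 1 by (auto simp: zigzag_loop_paths_def)
    next
      case a: 3
      then have "take (Suc 2) p = [i, i, i]"
        by (subst rep(1)) (simp add: numeral_2_eq_2)
      moreover have "path [i, i, i] \<in> I" using relations_in_I 1 i by (auto simp: zigzag_relations_def)
      ultimately have "path p \<in> I" using I_prefix[OF p a] by simp
      then show ?thesis by blast
    qed
  next
    case 2
    then have Q: "zigzag_quiver G = G" by (simp add: quiver_eq)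
    consider i where "p = [i]" | i j where "p = [i, j]" | i j k where "p = [i, j, k]" | "3 < length p"
    proof (cases p)
      case Nil then show ?thesis using p by (simp add: vwalk_def)
    next
      case (Cons i q)
      then show ?thesis using that by (cases q; cases "tl q"; cases "tl (tl q)") auto
    qed
    then show ?thesis
    proof cases
      case (1 i) then show ?thesis using p by (simp add: vwalk_def)
    next
      case (2 i j) then show ?thesis using p by (simp add: vwalk_def Q)
    next
      case (3 i j k)
      then have a: "(i, j) \<in> parcs G" "(j, k) \<in> parcs G" using p by (auto simp: vwalk_def Q)
      have "k = i"
        using two_verts[OF 2] arcs_in_verts[OF a(1)] arcs_in_verts[OF a(2)] a arc_irrefl by metis
      then show ?thesis using 3 a(1) arcs_in_verts 2 by (auto simp: zigzag_loop_paths_def)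
    next
      case 4
      have rel: "path q \<in> I" if "vwalk q (with_proj G)" "vwalk_length q = 3" for q
        using relations_in_I 2 that by (auto simp: zigzag_relations_def)
      have "path (take (Suc 3) p) \<in> I"
        by (rule rel) (use walk_take[OF p, of 3] 4 in \<open>auto simp: Q\<close>)
      then show ?thesis using I_prefix[OF p 4] by blast
    qed
  next
    case 3
    then have Q: "zigzag_quiver G = G" by (simp add: quiver_eq)
    have rel1: "path [i, j, k] \<in> I" if "(i, j) \<in> parcs G" "(j, k) \<in> parcs G" "i \<noteq> k" for i j k
      using relations_in_I 3 that unfolding zigzag_relations_def by auto
    have rel2: "path [i, j, i] \<ominus>\<^bsub>ZP\<^esub> path [i, k, i] \<in> I" if "(i, j) \<in> parcs G" "(i, k) \<in> parcs G" for i j k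
    proof (rule subsetD[OF relations_in_I])
      show "path [i, j, i] \<ominus>\<^bsub>ZP\<^esub> path [i, k, i] \<in> zigzag_relations K G"
        unfolding zigzag_relations_def using 3 that by simp blast
    qed
    have w: "walk [i, j]" "walk [i, j, i]" "walk [j, i, j]" "walk [i, j, i, j]" if "(i, j) \<in> parcs G" for i j
      using that arc_sym arcs_in_verts by (auto simp: vwalk_def Q)
    have four: "path [i, j, k, l] \<in> I"
      if a: "(i, j) \<in> parcs G" "(j, k) \<in> parcs G" "(k, l) \<in> parcs G" for i j k l
    proof -
      have wp: "walk [i, j, k, l]" using a arcs_in_verts by (auto simp: vwalk_def Q)
      consider "i \<noteq> k" | "j \<noteq> l" | "i = k" "j = l" by blast
      then show ?thesis
      proof cases
        case 1
        then show ?thesis using I_prefix[OF wp, of 2] rel1[OF a(1,2)] by (simp add: numeral_2_eq_2)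
      next
        case 2
        then show ?thesis using I_suffix[OF wp, of 1] rel1[OF a(2,3)] by simp
      next
        case eq: 3
        have ji: "(j, i) \<in> parcs G" using a(1) by (rule arc_sym)
        have "i \<noteq> j" using a(1) arc_irrefl by metis
        then have "card {i, j} = 2" by simp
        then have ne: "{i, j} \<noteq> pverts G" using 3(2) by metis
        have sub: "{i, j} \<subseteq> pverts G" using arcs_in_verts[OF a(1)] by simp
        \<comment> \<open>A third vertex \<open>m\<close> next to the edge. If it is next to
          \<open>i\<close>, then \<open>[i, j, i]\<close> may be replaced by
          \<open>[i, m, i]\<close>, and the path then ends in \<open>[m, i, j]\<close>, which is a
          relation since \<open>m \<noteq> j\<close>. If it is next to \<open>j\<close>, the other
          end of the path is changed in the same way.\<close>
        obtain u m where m: "u \<in> {i, j}" "m \<notin> {i, j}" "(u, m) \<in> parcs G"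
          by (rule cut_arc[OF sub insert_not_empty ne])
        have c: "path [i, j, i, j] \<in> carrier ZP" by (rule path_closed) (rule w[OF a(1)])
        have prod: "path [a, b, c] \<otimes>\<^bsub>ZP\<^esub> path [c, d] = path [a, b, c, d]"
          "path [a, b] \<otimes>\<^bsub>ZP\<^esub> path [b, c, d] = path [a, b, c, d]" for a b c d
          using path_mult[of 2 "[a, b, c, d]"] path_mult[of 1 "[a, b, c, d]"]
          by (simp_all add: numeral_2_eq_2)
        from m(1) consider "u = i" | "u = j" by blast
        then have "path [i, j, i, j] \<in> I"
        proof cases
          case 1
          then have im: "(i, m) \<in> parcs G" "(m, i) \<in> parcs G" using m arc_sym by auto
          have wm: "walk [i, m, i, j]" using im a arcs_in_verts by (auto simp: vwalk_def Q)
          have "path [m, i, j] \<in> I" using rel1[OF im(2) a(1)] m(2) by blast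
          then have y: "path [i, m, i, j] \<in> I" using I_suffix[OF wm, of 1] by simp
          have "(path [i, j, i] \<ominus>\<^bsub>ZP\<^esub> path [i, m, i]) \<otimes>\<^bsub>ZP\<^esub> path [i, j] \<in> I"
            by (rule I.I_r_closed[OF rel2[OF a(1) im(1)] path_closed[OF w(1)[OF a(1)]]])
          also have "(path [i, j, i] \<ominus>\<^bsub>ZP\<^esub> path [i, m, i]) \<otimes>\<^bsub>ZP\<^esub> path [i, j] =
              path [i, j, i, j] \<ominus>\<^bsub>ZP\<^esub> path [i, m, i, j]"
            using path_closed[OF w(2)[OF a(1)]] path_closed[OF w(2)[OF im(1)]] path_closed[OF w(1)[OF a(1)]]
            by (simp add: I.minus_eq I.l_distr I.l_minus prod)
          finally show ?thesis using y c by (rule I_cong)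
        next
          case 2
          then have jm: "(j, m) \<in> parcs G" "(m, j) \<in> parcs G" using m arc_sym by auto
          have wm: "walk [i, j, m, j]" using jm a arcs_in_verts by (auto simp: vwalk_def Q)
          have "path [i, j, m] \<in> I" using rel1[OF a(1) jm(1)] m(2) by blast
          then have y: "path [i, j, m, j] \<in> I" using I_prefix[OF wm, of 2] by (simp add: numeral_2_eq_2)
          have "path [i, j] \<otimes>\<^bsub>ZP\<^esub> (path [j, i, j] \<ominus>\<^bsub>ZP\<^esub> path [j, m, j]) \<in> I"
            by (rule I.I_l_closed[OF rel2[OF ji jm(1)] path_closed[OF w(1)[OF a(1)]]])
          also have "path [i, j] \<otimes>\<^bsub>ZP\<^esub> (path [j, i, j] \<ominus>\<^bsub>ZP\<^esub> path [j, m, j]) =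
              path [i, j, i, j] \<ominus>\<^bsub>ZP\<^esub> path [i, j, m, j]"
            using path_closed[OF w(2)[OF ji]] path_closed[OF w(2)[OF jm(1)]] path_closed[OF w(1)[OF a(1)]]
            by (simp add: I.minus_eq I.r_distr I.r_minus prod)
          finally show ?thesis using y c by (rule I_cong)
        qed
        then show ?thesis using eq by simp
      qed
    qed
    consider i where "p = [i]" | i j where "p = [i, j]" | i j k where "p = [i, j, k]"
      | i j k l q where "p = i # j # k # l # q"
      using p by (cases p rule: list.exhaust; cases "tl p"; cases "tl (tl p)"; cases "tl (tl (tl p))")
        (auto simp: vwalk_def)
    then show ?thesis
    proof cases
      case (1 i) then show ?thesis using p by (simp add: vwalk_def)
    next
      case (2 i j) then show ?thesis using p by (simp add: vwalk_def Q)
    next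
      case (3 i j k)
      then have a: "(i, j) \<in> parcs G" "(j, k) \<in> parcs G" using p by (auto simp: vwalk_def Q)
      show ?thesis
      proof (cases "i = k")
        case True
        then have "p \<in> L i" using 3 a(1) \<open>card (pverts G) \<noteq> 1\<close> by (auto simp: zigzag_loop_paths_def)
        then show ?thesis using a(1) arcs_in_verts by blast
      next
        case False
        then show ?thesis using rel1[OF a] 3 by blast
      qed
    next
      case (4 i j k l q)
      then have "path (take (Suc 3) p) \<in> I"
        using four[of i j k l] p by (auto simp: vwalk_def Q numeral_3_eq_3)
      then have "path p \<in> I" by (intro I_prefix[OF p, of 3]) (simp add: 4)
      then show ?thesis by blast
    qed
  qed
qed

definition zunit :: "'v zbasis \<Rightarrow> 'k \<Rightarrow> 'v zbasis \<Rightarrow> 'k" where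
  "zunit b k = (\<lambda>c. if c = b then k else \<zero>)"

lemma zunit_closed: "b \<in> zigzag_basis G C \<Longrightarrow> k \<in> carrier K \<Longrightarrow> zunit b k \<in> carrier (Z C)"
  by (auto simp: model_sel zunit_def)

lemma section_zunit:
  assumes k: "k \<in> carrier K"
  shows "i \<in> pverts G \<Longrightarrow> path_section (zunit (Vertex i) k) = (\<lambda>p. if p = [i] then k else \<zero>)"
    and "(i, j) \<in> parcs G \<Longrightarrow> path_section (zunit (Arrow i j) k) = (\<lambda>p. if p = [i, j] then k else \<zero>)"
    and "i \<in> pverts G \<Longrightarrow>
      path_section (zunit (Loop i) k) = (\<lambda>p. if p = loop_path_at i then k else \<zero>)"
proof -
  note lp = loop_path[OF _ loop_path_at]
  show "path_section (zunit (Vertex i) k) = (\<lambda>p. if p = [i] then k else \<zero>)" if i: "i \<in> pverts G"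
  proof
    fix p
    have "[i] \<noteq> loop_path_at i"
      using lp(2)[OF i i] by (metis One_nat_def length_Cons less_irrefl list.size(3))
    then have "\<not> chosen_loop [i]" by (simp add: chosen_loop_def)
    moreover have "length p = 1 \<and> hd p = i \<longleftrightarrow> p = [i]" by (auto simp: length_Suc_conv)
    ultimately show "path_section (zunit (Vertex i) k) p = (if p = [i] then k else \<zero>)"
      by (auto simp: path_section_def zunit_def)
  qed
  show "path_section (zunit (Arrow i j) k) = (\<lambda>p. if p = [i, j] then k else \<zero>)" if ij: "(i, j) \<in> parcs G"
  proof
    fix p
    have i: "i \<in> pverts G" using arcs_in_verts[OF ij] by blast
    have "length [i, j] \<noteq> length (loop_path_at i)" using lp(6)[OF i i ij] by simp
    then have "[i, j] \<noteq> loop_path_at i" by metis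
    then have "\<not> chosen_loop [i, j]" by (simp add: chosen_loop_def)
    moreover have "length p = 2 \<and> hd p = i \<and> last p = j \<longleftrightarrow> p = [i, j]"
      by (auto simp: length_Suc_conv numeral_2_eq_2)
    ultimately show "path_section (zunit (Arrow i j) k) p = (if p = [i, j] then k else \<zero>)"
      by (auto simp: path_section_def zunit_def)
  qed
  show "path_section (zunit (Loop i) k) = (\<lambda>p. if p = loop_path_at i then k else \<zero>)" if i: "i \<in> pverts G"
  proof
    fix p
    have hd: "hd (loop_path_at i) = i" by (rule lp(1)[OF i i])
    then have "chosen_loop p \<and> hd p = i \<longleftrightarrow> p = loop_path_at i"
      unfolding chosen_loop_def using i by metis
    then show "path_section (zunit (Loop i) k) p = (if p = loop_path_at i then k else \<zero>)"
      by (simp add: path_section_def zunit_def) metis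
  qed
qed

lemma ZP_sel:
  "zero ZP = (\<lambda>p. \<zero>)" "add ZP = (\<lambda>f g p. f p \<oplus> g p)" "smult ZP = (\<lambda>k f p. k \<otimes> f p)"
  unfolding zigzag_path_algebra_def by (simp_all add: path_algebra_sel)

lemma ZP_smult_mult:
  assumes k: "k \<in> carrier K" and f: "f \<in> carrier ZP" and g: "g \<in> carrier ZP"
  shows "(k \<odot>\<^bsub>ZP\<^esub> f) \<otimes>\<^bsub>ZP\<^esub> g = k \<odot>\<^bsub>ZP\<^esub> (f \<otimes>\<^bsub>ZP\<^esub> g)"
proof
  fix p
  have m: "(f \<otimes>\<^bsub>ZP\<^esub> g) p = (\<Oplus>n \<in> {..<length p}. f (take (Suc n) p) \<otimes> g (drop n p))" for f g p
    unfolding zigzag_path_algebra_def by (simp add: path_algebra_sel)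
  show "((k \<odot>\<^bsub>ZP\<^esub> f) \<otimes>\<^bsub>ZP\<^esub> g) p = (k \<odot>\<^bsub>ZP\<^esub> (f \<otimes>\<^bsub>ZP\<^esub> g)) p"
    using k ZP_closed[OF f] ZP_closed[OF g]
    by (simp add: m ZP_sel(3) m_assoc finsum_rdistr Pi_def)
qed

text \<open>\<open>genideal\<close> yields a ring ideal; it absorbs the scalar \<open>k\<close>
  because it absorbs the element \<open>k\<close> times the unit.\<close>

lemma I_smult:
  assumes k: "k \<in> carrier K" and u: "u \<in> I"
  shows "k \<odot>\<^bsub>ZP\<^esub> u \<in> I"
proof -
  interpret I: ideal I ZP by (rule ideal_I)
  have "(k \<odot>\<^bsub>ZP\<^esub> \<one>\<^bsub>ZP\<^esub>) \<otimes>\<^bsub>ZP\<^esub> u \<in> I"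
    by (rule I.I_l_closed[OF u path_coords_smult(1)[OF k I.one_closed]])
  then show ?thesis using ZP_smult_mult[OF k I.one_closed I.a_Hcarr[OF u]] I.a_Hcarr[OF u] by simp
qed

lemma path_coords_loop:
  assumes i: "i \<in> pverts G" "p \<in> L i"
  shows "path_coords (path p) = zunit (Loop i) \<one>"
proof
  fix b
  have "j \<in> pverts G \<Longrightarrow> p \<in> L j \<Longrightarrow> j = i" for j using loop_path(1)[OF i(1,2)] loop_path(1) by metis
  moreover have "(\<Oplus>q \<in> L i. path p q) = path p p"
    by (rule finsum_eq_single[OF finite_loop_paths i(2)]) (auto simp: path_element_def)
  moreover have "(\<Oplus>q \<in> L j. path p q) = \<zero>" if "p \<notin> L j" for j
    by (rule add.finprod_one_eqI) (use that in \<open>auto simp: path_element_def\<close>)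
  moreover have "p \<noteq> [j]" for j using loop_path(2)[OF i] by auto
  moreover have "p \<noteq> [j, k]" if "(j, k) \<in> parcs G" for j k
  proof
    assume "p = [j, k]"
    moreover from this have "j = i" using loop_path(1)[OF i] by simp
    ultimately show False using loop_path(6)[OF i, of k] that by simp
  qed
  ultimately show "path_coords (path p) b = zunit (Loop i) \<one> b"
    using i(1) by (cases b) (simp_all add: path_element_def zunit_def, (metis+)?)
qed

text \<open>The kernel is an ideal, so it suffices to look at the generators: a monomial relation is
  a path without coordinates, and a binomial relation is a difference of two representatives of the
  same loop.\<close>

lemma I_subset_kernel: "I \<subseteq> {f \<in> carrier ZP. path_coords f = \<zero>\<^bsub>Z {}\<^esub>}"
proof -
  let ?N = "{f \<in> carrier ZP. path_coords f = \<zero>\<^bsub>Z {}\<^esub>}"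
  have id: "ideal ?N ZP" by (rule quotient_algebra_iso(1)[OF model_ring ZP_ring path_coords_epi refl])
  interpret R: ring ZP by (rule ZP_ring)
  have walks: "walk [i, j, k]" if "(i, j) \<in> parcs G" "(j, k) \<in> parcs G" for i j k
    using that arc_in_quiver arcs_in_verts by (auto simp: vwalk_def)
  have zero: "path_coords (path p) = (\<lambda>b. \<zero>)" if "2 < length p" "\<And>i. i \<in> pverts G \<Longrightarrow> p \<notin> L i" for p
  proof
    fix b
    have "(\<Oplus>q \<in> L i. path p q) = \<zero>" if "i \<in> pverts G" for i
      by (rule add.finprod_one_eqI) (use \<open>i \<in> pverts G \<Longrightarrow> p \<notin> L i\<close> that in \<open>auto simp: path_element_def\<close>)
    then show "path_coords (path p) b = \<zero>"
      using \<open>2 < length p\<close> by (cases b) (auto simp: path_element_def)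
  qed
  have minus: "path_coords (x \<ominus>\<^bsub>ZP\<^esub> y) = \<zero>\<^bsub>Z {}\<^esub>"
    if "x \<in> carrier ZP" "y \<in> carrier ZP" "path_coords x = path_coords y" for x y
  proof -
    interpret B: ring "Z {}" by (rule model_ring)
    interpret ring_hom_ring ZP "Z {}" path_coords
      by (rule ring_hom_ringI2[OF ZP_ring model_ring graded_epiD(1)[OF path_coords_epi]])
    show ?thesis using that by (simp add: R.minus_eq B.r_neg)
  qed
  have "path_coords r = \<zero>\<^bsub>Z {}\<^esub>" if r: "r \<in> zigzag_relations K G" for r
  proof -
    consider "card (pverts G) = 1" | "card (pverts G) = 2" | "card (pverts G) \<noteq> 1" "card (pverts G) \<noteq> 2"
      by blast
    then show ?thesis
    proof cases
      case 1
      then obtain i where "r = path [i, i, i]" using r by (auto simp: zigzag_relations_def)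
      moreover have "[i, i, i] \<notin> L j" for j using 1 by (auto simp: zigzag_loop_paths_def)
      ultimately show ?thesis using zero[of "[i, i, i]"] by (simp add: model_sel)
    next
      case 2
      then obtain p where p: "r = path p" "length p = 4" using r by (auto simp: zigzag_relations_def)
      have "p \<notin> L j" for j using p 2 by (auto simp: zigzag_loop_paths_def)
      then show ?thesis using zero[of p] p by (simp add: model_sel)
    next
      case 3
      then consider i j k where "r = path [i, j, k]" "i \<noteq> k"
        | i j k where "r = path [i, j, i] \<ominus>\<^bsub>ZP\<^esub> path [i, k, i]" "(i, j) \<in> parcs G" "(i, k) \<in> parcs G"
        using r by (auto simp: zigzag_relations_def)
      then show ?thesis
      proof cases
        case (1 i j k)
        then have "[i, j, k] \<notin> L l" for l using 3 by (auto simp: zigzag_loop_paths_def)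
        then show ?thesis using zero[of "[i, j, k]"] 1 by (simp add: model_sel)
      next
        case (2 i j k)
        then have l: "[i, j, i] \<in> L i" "[i, k, i] \<in> L i" "i \<in> pverts G"
          using 3 arcs_in_verts by (auto simp: zigzag_loop_paths_def)
        show ?thesis unfolding 2(1)
          using path_coords_loop[OF l(3,1)] path_coords_loop[OF l(3,2)] 2 walks arc_sym
          by (intro minus path_closed) auto
      qed
    qed
  qed
  then have "zigzag_relations K G \<subseteq> ?N" using relations_closed by blast
  then show ?thesis unfolding zigzag_ideal_def by (rule R.genideal_minimal[OF id])
qed

text \<open>Modulo the relations, the image of the section spans the path algebra. Since
  \<open>path_coords\<close> is injective on that image, the kernel cannot be larger than
  \<open>I\<close>.\<close>

lemma ZP_decompose:
  assumes f: "f \<in> carrier ZP"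
  shows "\<exists>u \<in> I. \<exists>g \<in> carrier (Z {}). f = (\<lambda>p. u p \<oplus> path_section g p)"
proof (rule finite_support_induct[where S = "{p. walk p}"])
  show "finite {p. f p \<noteq> \<zero>}" "{p. f p \<noteq> \<zero>} \<subseteq> {p. walk p}" "f p \<in> carrier K" for p
    using f unfolding zigzag_path_algebra_def path_algebra_sel by auto
next
  interpret I: ideal I ZP by (rule ideal_I)
  have sec0: "path_section (\<lambda>b. \<zero>) = (\<lambda>p. \<zero>)" by (auto simp: path_section_def)
  have z0: "(\<lambda>b. \<zero>) \<in> carrier (Z {})" by (simp add: model_sel)
  have u0: "(\<lambda>p. \<zero>) \<in> I" using additive_subgroup.zero_closed[OF ideal.axioms(1)[OF ideal_I]] by (simp add: ZP_sel)
  show zero: "\<exists>u \<in> I. \<exists>g \<in> carrier (Z {}). (\<lambda>p. \<zero>) = (\<lambda>p. u p \<oplus> path_section g p)"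
    using z0 u0 sec0 by (intro bexI[of _ "\<lambda>p. \<zero>"] bexI[of _ "\<lambda>b. \<zero>"]) auto
  show "\<exists>u \<in> I. \<exists>g \<in> carrier (Z {}). (\<lambda>q. if q = p then k else \<zero>) = (\<lambda>p. u p \<oplus> path_section g p)"
    if p: "p \<in> {p. walk p}" and k: "k \<in> carrier K" for p k
  proof -
    have kp: "(\<lambda>q. if q = p then k else \<zero>) = k \<odot>\<^bsub>ZP\<^esub> path p" for p
      using k by (auto simp: ZP_sel path_element_def fun_eq_iff)
    consider i where "i \<in> pverts G" "p = [i]" | i j where "(i, j) \<in> parcs G" "p = [i, j]"
      | i where "i \<in> pverts G" "p \<in> L i" | "path p \<in> I"
      using walk_normal_or_I p by blast
    then show ?thesis
    proof cases
      case (1 i)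
      then show ?thesis using u0 zunit_closed[of "Vertex i" "{}" k] section_zunit(1)[OF k 1(1)] k
        by (intro bexI[of _ "\<lambda>p. \<zero>"] bexI[of _ "zunit (Vertex i) k"]) (auto simp: fun_eq_iff)
    next
      case (2 i j)
      then show ?thesis using u0 zunit_closed[of "Arrow i j" "{}" k] section_zunit(2)[OF k 2(1)] k
        by (intro bexI[of _ "\<lambda>p. \<zero>"] bexI[of _ "zunit (Arrow i j) k"]) (auto simp: fun_eq_iff)
    next
      case (3 i)
      let ?q = "loop_path_at i"
      have q: "?q \<in> L i" by (rule loop_path_at[OF 3(1)])
      have pc: "path p \<in> carrier ZP" "path ?q \<in> carrier ZP"
        using loop_path(4)[OF 3] loop_path(4)[OF 3(1) q] by (auto intro: path_closed)
      have "path p \<ominus>\<^bsub>ZP\<^esub> path ?q \<in> I"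
      proof (cases "p = ?q")
        case True
        then have "path p \<ominus>\<^bsub>ZP\<^esub> path ?q = \<zero>\<^bsub>ZP\<^esub>" using pc by (simp add: I.minus_eq I.r_neg)
        then show ?thesis using u0 by (simp add: ZP_sel)
      next
        case False
        then have c1: "card (pverts G) \<noteq> 1" using 3(2) q by (auto simp: zigzag_loop_paths_def)
        then obtain j k where jk: "p = [i, j, i]" "?q = [i, k, i]" "(i, j) \<in> parcs G" "(i, k) \<in> parcs G"
          using 3(2) q by (auto simp: zigzag_loop_paths_def)
        \<comment> \<open>With two vertices \<open>i\<close> has only one neighbour. Two different
          representatives of x_i thus force the case in which their difference is a
          relation.\<close>
        have "card (pverts G) \<noteq> 2"
          using two_verts[of j i k] arcs_in_verts[OF jk(3)] arcs_in_verts[OF jk(4)] jk False arc_irrefl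
          by metis
        then have "path [i, j, i] \<ominus>\<^bsub>ZP\<^esub> path [i, k, i] \<in> zigzag_relations K G"
          unfolding zigzag_relations_def using c1 jk(3,4) by simp blast
        then show ?thesis using relations_in_I by (auto simp: jk(1,2))
      qed
      then have "k \<odot>\<^bsub>ZP\<^esub> (path p \<ominus>\<^bsub>ZP\<^esub> path ?q) \<in> I" by (rule I_smult[OF k])
      moreover have "(\<lambda>q. if q = p then k else \<zero>) =
          (\<lambda>r. (k \<odot>\<^bsub>ZP\<^esub> (path p \<ominus>\<^bsub>ZP\<^esub> path ?q)) r \<oplus> path_section (zunit (Loop i) k) r)"
      proof -
        have "(path p \<ominus>\<^bsub>ZP\<^esub> path ?q) \<oplus>\<^bsub>ZP\<^esub> path ?q = path p"
          using pc by (simp add: I.minus_eq I.a_assoc I.l_neg)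
        then have e: "path p r = (path p \<ominus>\<^bsub>ZP\<^esub> path ?q) r \<oplus> path ?q r" for r
          by (simp add: ZP_sel fun_eq_iff)
        have "path_section (zunit (Loop i) k) = k \<odot>\<^bsub>ZP\<^esub> path ?q"
          unfolding section_zunit(3)[OF k 3(1)] by (rule kp)
        moreover have "(path p \<ominus>\<^bsub>ZP\<^esub> path ?q) r \<in> carrier K" "path ?q r \<in> carrier K" for r
          using pc by (auto intro!: ZP_closed)
        ultimately show ?thesis unfolding kp using k e by (auto simp: ZP_sel(3) r_distr fun_eq_iff)
      qed
      moreover have "zunit (Loop i) k \<in> carrier (Z {})" using 3(1) k by (intro zunit_closed) auto
      ultimately show ?thesis by blast
    next
      case 4
      have "k \<odot>\<^bsub>ZP\<^esub> path p \<in> I" by (rule I_smult[OF k 4])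
      moreover have "(k \<odot>\<^bsub>ZP\<^esub> path p) r \<in> carrier K" for r
        using k by (auto simp: ZP_sel path_element_def)
      ultimately show ?thesis unfolding kp using z0 sec0
        by (intro bexI[of _ "k \<odot>\<^bsub>ZP\<^esub> path p"] bexI[of _ "\<lambda>b. \<zero>"]) auto
    qed
  qed
  fix f f'
  assume "\<exists>u \<in> I. \<exists>g \<in> carrier (Z {}). f = (\<lambda>p. u p \<oplus> path_section g p)"
    and "\<exists>u \<in> I. \<exists>g \<in> carrier (Z {}). f' = (\<lambda>p. u p \<oplus> path_section g p)"
  then obtain u g u' g' where u: "u \<in> I" "u' \<in> I" and g: "g \<in> carrier (Z {})" "g' \<in> carrier (Z {})"
    and f: "f = (\<lambda>p. u p \<oplus> path_section g p)" "f' = (\<lambda>p. u' p \<oplus> path_section g' p)" by blast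
  note [simp] = ZP_closed[OF I.a_Hcarr[OF u(1)]] ZP_closed[OF I.a_Hcarr[OF u(2)]]
    ZP_closed[OF path_section_closed[OF g(1)]] ZP_closed[OF path_section_closed[OF g(2)]]
  have "path_section (g \<oplus>\<^bsub>Z {}\<^esub> g') p = path_section g p \<oplus> path_section g' p" for p
    by (simp add: path_section_def model_sel)
  then have "(\<lambda>p. f p \<oplus> f' p) = (\<lambda>p. (u \<oplus>\<^bsub>ZP\<^esub> u') p \<oplus> path_section (g \<oplus>\<^bsub>Z {}\<^esub> g') p)"
    unfolding f by (simp add: ZP_sel a_ac)
  moreover have "u \<oplus>\<^bsub>ZP\<^esub> u' \<in> I"
    by (rule additive_subgroup.a_closed[OF ideal.axioms(1)[OF ideal_I] u])
  moreover have "g \<oplus>\<^bsub>Z {}\<^esub> g' \<in> carrier (Z {})"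
    using abelian_monoid.a_closed[OF abelian_group.axioms(1)[OF model_abelian_group] g] .
  ultimately show "\<exists>u \<in> I. \<exists>g \<in> carrier (Z {}). (\<lambda>p. f p \<oplus> f' p) = (\<lambda>p. u p \<oplus> path_section g p)"
    by blast
qed

text \<open>An element of the kernel is an element of \<open>I\<close> plus
  \<open>path_section g\<close> by \<open>ZP_decompose\<close>; taking coordinates shows that
  \<open>g\<close> is 0.\<close>

lemma I_eq_kernel: "I = {f \<in> carrier ZP. path_coords f = \<zero>\<^bsub>Z {}\<^esub>}"
proof
  interpret B: ring "Z {}" by (rule model_ring)
  interpret I: ideal I ZP by (rule ideal_I)
  show "{f \<in> carrier ZP. path_coords f = \<zero>\<^bsub>Z {}\<^esub>} \<subseteq> I"
  proof
    fix f assume "f \<in> {f \<in> carrier ZP. path_coords f = \<zero>\<^bsub>Z {}\<^esub>}"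
    then have f: "f \<in> carrier ZP" "path_coords f = \<zero>\<^bsub>Z {}\<^esub>" by auto
    obtain u g where u: "u \<in> I" and g: "g \<in> carrier (Z {})" and fug: "f = u \<oplus>\<^bsub>ZP\<^esub> path_section g"
      using ZP_decompose[OF f(1)] by (auto simp: ZP_sel)
    have uc: "u \<in> carrier ZP" using u by (rule I.a_Hcarr)
    have "path_coords u = \<zero>\<^bsub>Z {}\<^esub>" using I_subset_kernel u by blast
    then have "g = \<zero>\<^bsub>Z {}\<^esub>"
      using f(2) path_coords_add[OF uc path_section_closed[OF g]] path_coords_section[OF g] g
      by (simp add: fug)
    then have "path_section g = \<zero>\<^bsub>ZP\<^esub>" by (auto simp: path_section_def model_sel ZP_sel)
    then show "f \<in> I" using u uc by (simp add: fug)
  qed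
qed (rule I_subset_kernel)


section \<open>The vertex condition: forgetting the loop coordinates at \<open>C\<close>\<close>

definition restrict_coords :: "'v set \<Rightarrow> ('v zbasis \<Rightarrow> 'k) \<Rightarrow> 'v zbasis \<Rightarrow> 'k" where
  "restrict_coords C f = (\<lambda>b. if b \<in> zigzag_basis G C then f b else \<zero>)"

lemma basis_mono: "b \<in> zigzag_basis G C \<Longrightarrow> b \<in> zigzag_basis G {}"
  by (auto simp: zigzag_basis_def)

lemma restrict_coords_closed: "f \<in> carrier (Z {}) \<Longrightarrow> restrict_coords C f \<in> carrier (Z C)"
  by (auto simp: model_sel restrict_coords_def)

lemma carrier_mono: "f \<in> carrier (Z C) \<Longrightarrow> f \<in> carrier (Z {})"
  unfolding model_sel(1) using basis_mono by blast

lemma restrict_coords_id: "f \<in> carrier (Z C) \<Longrightarrow> restrict_coords C f = f"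
  by (auto simp: model_sel restrict_coords_def)

text \<open>The coordinate of a factor at a loop enters no coordinate of the product except the one
  at the same loop, so dropping loops is multiplicative.\<close>

lemma restrict_coords_mult:
  assumes f: "f \<in> carrier (Z {})" and g: "g \<in> carrier (Z {})"
  shows "restrict_coords C (zigzag_mult K G {} f g) =
    zigzag_mult K G C (restrict_coords C f) (restrict_coords C g)"
proof
  fix b
  note [simp] = model_closed[OF f] model_closed[OF g]
  show "restrict_coords C (zigzag_mult K G {} f g) b =
    zigzag_mult K G C (restrict_coords C f) (restrict_coords C g) b"
  proof (cases b)
    case (Arrow i j)
    then show ?thesis using arcs_in_verts[of i j]
      by (auto simp: zigzag_mult_simps restrict_coords_def)
  next
    case (Loop i)
    have "(\<Oplus>j \<in> {j. (i, j) \<in> parcs G}. restrict_coords C f (Arrow i j) \<otimes> restrict_coords C g (Arrow j i)) =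
      (\<Oplus>j \<in> {j. (i, j) \<in> parcs G}. f (Arrow i j) \<otimes> g (Arrow j i))"
      by (rule finsum_cong') (auto simp: restrict_coords_def dest: arc_sym)
    note sum = this
    show ?thesis unfolding Loop zigzag_mult_simps sum
      by (auto simp: restrict_coords_def zigzag_mult_simps)
  qed (auto simp: zigzag_mult_simps restrict_coords_def)
qed

lemma restrict_coords_epi: "graded_epi K (Z {}) (Z C) (restrict_coords C)"
  unfolding graded_epi_def
proof (intro conjI allI ballI)
  show "restrict_coords C \<in> ring_hom (Z {}) (Z C)"
  proof (rule ring_hom_memI)
    show "restrict_coords C (x \<otimes>\<^bsub>Z {}\<^esub> y) = restrict_coords C x \<otimes>\<^bsub>Z C\<^esub> restrict_coords C y"
      if "x \<in> carrier (Z {})" "y \<in> carrier (Z {})" for x y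
      unfolding model_sel(2) using that by (rule restrict_coords_mult)
  qed (auto simp: restrict_coords_closed, auto simp: model_sel restrict_coords_def fun_eq_iff)
  show "restrict_coords C ` carrier (Z {}) = carrier (Z C)"
  proof
    show "carrier (Z C) \<subseteq> restrict_coords C ` carrier (Z {})"
      using carrier_mono restrict_coords_id by (metis image_eqI subsetI)
  qed (use restrict_coords_closed in blast)
  show "restrict_coords C ` grade (Z {}) n = grade (Z C) n" for n
  proof
    show "restrict_coords C ` grade (Z {}) n \<subseteq> grade (Z C) n"
      by (auto simp: model_sel restrict_coords_def split: if_splits)
    show "grade (Z C) n \<subseteq> restrict_coords C ` grade (Z {}) n"
    proof
      fix g assume g: "g \<in> grade (Z C) n"
      then have gc: "g \<in> carrier (Z C)" and "g \<in> grade (Z {}) n"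
        using carrier_mono unfolding model_sel(7) by blast+
      then have "restrict_coords C g \<in> restrict_coords C ` grade (Z {}) n" by blast
      then show "g \<in> restrict_coords C ` grade (Z {}) n" by (simp only: restrict_coords_id[OF gc])
    qed
  qed
qed (auto simp: model_sel restrict_coords_def)

abbreviation ZA :: "('k, ('v list \<Rightarrow> 'k) set) graded_module" where
  "ZA \<equiv> zigzag_algebra K G"

definition coset_coords :: "('v list \<Rightarrow> 'k) set \<Rightarrow> 'v zbasis \<Rightarrow> 'k" where
  "coset_coords X = the_elem (path_coords ` X)"

lemma coset_coords_iso:
  shows "ring ZA" and "graded_epi K ZA (Z {}) coset_coords" and "inj_on coset_coords (carrier ZA)"
    and "f \<in> carrier ZP \<Longrightarrow> coset_coords (I +>\<^bsub>ZP\<^esub> f) = path_coords f"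
    and "f \<in> carrier ZP \<Longrightarrow> I +>\<^bsub>ZP\<^esub> f \<in> carrier ZA"
proof -
  note iso = quotient_algebra_iso[OF model_ring ZP_ring path_coords_epi I_eq_kernel]
  have cc: "coset_coords = (\<lambda>X. the_elem (path_coords ` X))" by (auto simp: coset_coords_def)
  show "ring ZA" unfolding zigzag_algebra_def by (rule iso(2))
  show "graded_epi K ZA (Z {}) coset_coords" unfolding zigzag_algebra_def cc by (rule iso(3))
  show "inj_on coset_coords (carrier ZA)" unfolding zigzag_algebra_def cc by (rule iso(4))
  show "f \<in> carrier ZP \<Longrightarrow> coset_coords (I +>\<^bsub>ZP\<^esub> f) = path_coords f" unfolding cc by (rule iso(5))
  show "f \<in> carrier ZP \<Longrightarrow> I +>\<^bsub>ZP\<^esub> f \<in> carrier ZA" unfolding zigzag_algebra_def by (rule iso(6))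
qed

lemma ZA_graded_algebra: "graded_algebra K ZA"
  by (rule graded_algebra_transport[OF model_graded_algebra coset_coords_iso(1-3)])

text \<open>The generators have coordinate vectors supported at loops of \<open>C\<close>.
  Conversely, every vector so supported is a sum of scalar multiples of generators, one
  representative for each \<open>c\<close> being enough.\<close>

lemma vertex_ideal_eq_kernel:
  assumes C: "C \<subseteq> pverts G"
  shows "zigzag_vertex_ideal K G C = {X \<in> carrier ZA. restrict_coords C (coset_coords X) = \<zero>\<^bsub>Z C\<^esub>}"
proof -
  let ?N = "{X \<in> carrier ZA. restrict_coords C (coset_coords X) = \<zero>\<^bsub>Z C\<^esub>}"
  let ?S = "{I +>\<^bsub>ZP\<^esub> path p | p c. c \<in> C \<and> p \<in> L c}"
  have epi: "graded_epi K ZA (Z C) (\<lambda>X. restrict_coords C (coset_coords X))"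
    by (rule graded_epi_comp[OF coset_coords_iso(2) restrict_coords_epi])
  have N: "ideal ?N ZA" by (rule quotient_algebra_iso(1)[OF model_ring coset_coords_iso(1) epi refl])
  interpret A: graded_algebra K ZA by (rule ZA_graded_algebra)
  interpret B: ring "Z {}" by (rule model_ring)
  have pc: "path p \<in> carrier ZP" if "c \<in> C" "p \<in> L c" for p c
    using loop_path(4)[of c p] that C by (intro path_closed) auto
  have S: "?S \<subseteq> ?N"
  proof
    fix X assume "X \<in> ?S"
    then obtain p c where c: "c \<in> C" "p \<in> L c" and X: "X = I +>\<^bsub>ZP\<^esub> path p" by blast
    have "coset_coords X = zunit (Loop c) \<one>"
      unfolding X coset_coords_iso(4)[OF pc[OF c]] using C c by (intro path_coords_loop) auto
    moreover have "restrict_coords C (zunit (Loop c) \<one>) = \<zero>\<^bsub>Z C\<^esub>"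
      using c(1) by (auto simp: restrict_coords_def zunit_def model_sel)
    ultimately show "X \<in> ?N" using coset_coords_iso(5)[OF pc[OF c]] X by simp
  qed
  have Sc: "?S \<subseteq> carrier ZA" using S by blast
  have eq: "zigzag_vertex_ideal K G C = Idl\<^bsub>ZA\<^esub> ?S" unfolding zigzag_vertex_ideal_def ..
  interpret J: ideal "Idl\<^bsub>ZA\<^esub> ?S" ZA by (rule A.genideal_ideal[OF Sc])
  note epiD = graded_epiD[OF coset_coords_iso(2)]
  have hit: "\<exists>X \<in> Idl\<^bsub>ZA\<^esub> ?S. coset_coords X = f"
    if f: "f \<in> carrier (Z {})" "restrict_coords C f = \<zero>\<^bsub>Z C\<^esub>" for f
  proof (rule finite_support_induct[where S = "Loop ` C" and f = f])
    have supp: "{b. f b \<noteq> \<zero>} \<subseteq> Loop ` C"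
    proof
      fix b assume b: "b \<in> {b. f b \<noteq> \<zero>}"
      then have "b \<in> zigzag_basis G {}" using model_outside[OF f(1)] by blast
      moreover have "b \<notin> zigzag_basis G C"
        using fun_cong[OF f(2), of b] b by (auto simp: restrict_coords_def model_sel)
      ultimately show "b \<in> Loop ` C" by (cases b) auto
    qed
    then show "finite {b. f b \<noteq> \<zero>}" "{b. f b \<noteq> \<zero>} \<subseteq> Loop ` C"
      using finite_subset[OF C finite_verts] by (auto intro: finite_subset)
    show "f b \<in> carrier K" for b by (rule model_closed[OF f(1)])
    interpret ring_hom_ring ZA "Z {}" coset_coords
      by (rule ring_hom_ringI2[OF coset_coords_iso(1) model_ring epiD(1)])
    show "\<exists>X \<in> Idl\<^bsub>ZA\<^esub> ?S. coset_coords X = (\<lambda>b. \<zero>)"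
    proof
      show "coset_coords \<zero>\<^bsub>ZA\<^esub> = (\<lambda>b. \<zero>)" using hom_zero by (simp only: model_sel(4))
      show "\<zero>\<^bsub>ZA\<^esub> \<in> Idl\<^bsub>ZA\<^esub> ?S" by (rule additive_subgroup.zero_closed[OF J.additive_subgroup_axioms])
    qed
    show "\<exists>X \<in> Idl\<^bsub>ZA\<^esub> ?S. coset_coords X = (\<lambda>c. if c = b then k else \<zero>)"
      if b: "b \<in> Loop ` C" and k: "k \<in> carrier K" for b k
    proof -
      obtain c where c: "c \<in> C" "b = Loop c" using b by blast
      have q: "loop_path_at c \<in> L c" using c(1) C by (intro loop_path_at) auto
      let ?X = "I +>\<^bsub>ZP\<^esub> path (loop_path_at c)"
      have X: "?X \<in> ?S" using c(1) q by blast
      then have Xc: "?X \<in> carrier ZA" using Sc by blast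
      have "(k \<odot>\<^bsub>ZA\<^esub> \<one>\<^bsub>ZA\<^esub>) \<otimes>\<^bsub>ZA\<^esub> ?X \<in> Idl\<^bsub>ZA\<^esub> ?S"
        by (rule J.I_l_closed[OF subsetD[OF A.genideal_self[OF Sc] X] epiD(4)[OF k A.one_closed]])
      moreover have "(k \<odot>\<^bsub>ZA\<^esub> \<one>\<^bsub>ZA\<^esub>) \<otimes>\<^bsub>ZA\<^esub> ?X = k \<odot>\<^bsub>ZA\<^esub> ?X"
        using A.smult_mult_left[OF k A.one_closed Xc] Xc by simp
      moreover have "coset_coords (k \<odot>\<^bsub>ZA\<^esub> ?X) = (\<lambda>d. if d = b then k else \<zero>)"
      proof -
        have "coset_coords ?X = zunit (Loop c) \<one>"
          unfolding coset_coords_iso(4)[OF pc[OF c(1) q]] using C c(1) q by (intro path_coords_loop) auto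
        then show ?thesis unfolding epiD(5)[OF k Xc] using k c(2) by (auto simp: model_sel zunit_def)
      qed
      ultimately show ?thesis by auto
    qed
    show "\<exists>X \<in> Idl\<^bsub>ZA\<^esub> ?S. coset_coords X = (\<lambda>b. g b \<oplus> h b)"
      if g: "\<exists>X \<in> Idl\<^bsub>ZA\<^esub> ?S. coset_coords X = g" and h: "\<exists>X \<in> Idl\<^bsub>ZA\<^esub> ?S. coset_coords X = h" for g h
    proof -
      from g h obtain X Y where X: "X \<in> Idl\<^bsub>ZA\<^esub> ?S" "coset_coords X = g"
        and Y: "Y \<in> Idl\<^bsub>ZA\<^esub> ?S" "coset_coords Y = h" by blast
      have "coset_coords (X \<oplus>\<^bsub>ZA\<^esub> Y) = (\<lambda>b. g b \<oplus> h b)"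
        using epiD(8)[OF J.a_Hcarr[OF X(1)] J.a_Hcarr[OF Y(1)]] X Y by (simp add: model_sel(5))
      moreover have "X \<oplus>\<^bsub>ZA\<^esub> Y \<in> Idl\<^bsub>ZA\<^esub> ?S"
        by (rule additive_subgroup.a_closed[OF J.additive_subgroup_axioms X(1) Y(1)])
      ultimately show ?thesis by blast
    qed
  qed
  have "?N \<subseteq> Idl\<^bsub>ZA\<^esub> ?S"
  proof
    fix X assume "X \<in> ?N"
    then have X: "X \<in> carrier ZA" "restrict_coords C (coset_coords X) = \<zero>\<^bsub>Z C\<^esub>" by auto
    obtain Y where Y: "Y \<in> Idl\<^bsub>ZA\<^esub> ?S" "coset_coords Y = coset_coords X"
      using hit[OF epiD(3)[OF X(1)] X(2)] by blast
    have "Y = X" by (rule inj_onD[OF coset_coords_iso(3) Y(2) J.a_Hcarr[OF Y(1)] X(1)])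
    then show "X \<in> Idl\<^bsub>ZA\<^esub> ?S" using Y(1) by simp
  qed
  moreover have "Idl\<^bsub>ZA\<^esub> ?S \<subseteq> ?N" by (rule A.genideal_minimal[OF N S])
  ultimately show ?thesis unfolding eq by blast
qed

text \<open>The homological part starts from this isomorphism with the model and never returns to
  cosets.\<close>

theorem zigzag_algebra_vc_coords:
  assumes C: "C \<subseteq> pverts G"
  obtains h where "graded_algebra K (zigzag_algebra_vc K G C)"
    "graded_epi K (zigzag_algebra_vc K G C) (Z C) h" "inj_on h (carrier (zigzag_algebra_vc K G C))"
proof -
  have epi: "graded_epi K ZA (Z C) (\<lambda>X. restrict_coords C (coset_coords X))"
    by (rule graded_epi_comp[OF coset_coords_iso(2) restrict_coords_epi])
  note iso = quotient_algebra_iso(2-4)[OF model_ring coset_coords_iso(1) epi vertex_ideal_eq_kernel[OF C],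
    folded zigzag_algebra_vc_def]
  show ?thesis
    by (rule that[OF graded_algebra_transport[OF model_graded_algebra iso] iso(2,3)])
qed

end

text \<open>Connectedness is defined through the symmetric closure of the arcs; the arcs of a pair
  graph are symmetric, so the closure adds nothing.\<close>

lemma connected_zigzag_graphI:
  fixes K :: "('k, 'd) ring_scheme" and G :: "'v pair_pre_digraph"
  assumes "field K" "pair_graph G" "Digraph_Component.connected (with_proj G)"
  shows "connected_zigzag_graph K G"
proof -
  interpret K: field K by fact
  interpret G: pair_graph G by fact
  have sym: "(j, i) \<in> parcs G" if "(i, j) \<in> parcs G" for i j
    using that G.pair_sym_arcs by (auto simp: symmetric_def dest: symD)
  have sc: "strongly_connected (with_proj (mk_symmetric (with_proj G)))"
    using assms(3) by (simp add: Digraph_Component.connected_def)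
  have par: "parcs (mk_symmetric (with_proj G)) = parcs G"
    using sym by (auto simp: parcs_mk_symmetric)
  have on: "rtrancl_on F r \<subseteq> r\<^sup>*" for F and r :: "'v rel"
  proof (intro subrelI)
    fix a b assume "(a, b) \<in> rtrancl_on F r"
    then show "(a, b) \<in> r\<^sup>*" by induction auto
  qed
  show ?thesis
  proof unfold_locales
    show "finite (pverts G)" by (rule G.pair_finite_verts)
    show "i \<in> pverts G \<and> j \<in> pverts G" if "(i, j) \<in> parcs G" for i j
      using that G.in_arcsD1 G.in_arcsD2 by blast
    show "(i, i) \<notin> parcs G" for i using G.pair_no_loops[of "(i, i)"] by auto
    show "(i, j) \<in> (parcs G)\<^sup>*" if "i \<in> pverts G" "j \<in> pverts G" for i j
      using sc that on[of "pverts G" "parcs G"] unfolding strongly_connected_def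
      by (auto simp: reachable_def par)
    show "pverts G \<noteq> {}" using sc unfolding strongly_connected_def by simp
  qed (fact sym)
qed

section \<open>Summands of free graded modules\<close>

abbreviation sub_module :: "('a, 'b) graded_module \<Rightarrow> 'b set \<Rightarrow> ('a, 'b) graded_module" where
  "sub_module M H \<equiv> M\<lparr>carrier := H, grade := \<lambda>n. grade M n \<inter> H\<rparr>"

context graded_left_module
begin

lemma submoduleD:
  assumes "submodule H R M"
  shows "H \<subseteq> carrier M" "\<zero>\<^bsub>M\<^esub> \<in> H" "x \<in> H \<Longrightarrow> y \<in> H \<Longrightarrow> x \<oplus>\<^bsub>M\<^esub> y \<in> H"
    "x \<in> H \<Longrightarrow> \<ominus>\<^bsub>M\<^esub> x \<in> H" "a \<in> carrier R \<Longrightarrow> x \<in> H \<Longrightarrow> a \<odot>\<^bsub>M\<^esub> x \<in> H"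
proof -
  have s: "subgroup H (add_monoid M)" by (rule submodule.axioms(1)[OF assms])
  show "H \<subseteq> carrier M" "\<zero>\<^bsub>M\<^esub> \<in> H" "x \<in> H \<Longrightarrow> y \<in> H \<Longrightarrow> x \<oplus>\<^bsub>M\<^esub> y \<in> H"
    "x \<in> H \<Longrightarrow> \<ominus>\<^bsub>M\<^esub> x \<in> H"
    using subgroup.subset[OF s] subgroup.one_closed[OF s] subgroup.m_closed[OF s]
      subgroup.m_inv_closed[OF s] by (simp_all add: a_inv_def)
  show "a \<in> carrier R \<Longrightarrow> x \<in> H \<Longrightarrow> a \<odot>\<^bsub>M\<^esub> x \<in> H" by (rule submodule.smult_closed[OF assms])
qed

end

text \<open>Sums in \<open>H\<close> agree with sums in \<open>M\<close>, so decompositions and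
  their uniqueness are inherited. The lemma serves for the fixed points of an idempotent and for the
  cyclic submodules of a simple module.\<close>

lemma graded_sub_module:
  fixes M :: "('a, 'b) graded_module"
  assumes M: "graded_left_module R M" and H: "submodule H R M"
    and comp: "\<And>x n. x \<in> H \<Longrightarrow> component M x n \<in> H"
  shows "graded_left_module R (sub_module M H)"
proof -
  interpret M: graded_left_module R M by (rule M)
  let ?N = "sub_module M H"
  note HD = M.submoduleD[OF H]
  have Hc: "x \<in> H \<Longrightarrow> x \<in> carrier M" for x using HD(1) by blast
  interpret N: abelian_group ?N
  proof (rule abelian_groupI)
    show "\<exists>y \<in> carrier ?N. y \<oplus>\<^bsub>?N\<^esub> x = \<zero>\<^bsub>?N\<^esub>" if "x \<in> carrier ?N" for x
      using that HD(4)[of x] M.M.l_neg[OF Hc] by (intro bexI[of _ "\<ominus>\<^bsub>M\<^esub> x"]) auto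
  qed (use HD(2,3) Hc in \<open>auto simp: M.M.a_ac\<close>)
  have fs: "(\<Oplus>\<^bsub>?N\<^esub>s \<in> S. c s) = (\<Oplus>\<^bsub>M\<^esub>s \<in> S. c s)"
    if "finite S" "\<And>s. s \<in> S \<Longrightarrow> c s \<in> H" for S :: "int set" and c
    using that
  proof (induction S rule: finite_induct)
    case (insert s S)
    then have "c \<in> S \<rightarrow> carrier M" "c s \<in> carrier M" "c \<in> S \<rightarrow> carrier ?N" "c s \<in> carrier ?N"
      using Hc by auto
    then show ?case using insert by simp
  qed simp
  have inv: "inv\<^bsub>add_monoid ?N\<^esub> x = \<ominus>\<^bsub>M\<^esub> x" if "x \<in> H" for x
    using N.minus_equality[of "\<ominus>\<^bsub>M\<^esub> x" x] that HD(4)[OF that] M.M.l_neg[OF Hc[OF that]]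
    by (simp add: a_inv_def)
  have gsub: "subgroup (grade M n) (add_monoid M)" for n by (rule M.M.grade_subgroup)
  have neg: "\<ominus>\<^bsub>M\<^esub> x \<in> grade M n" if "x \<in> grade M n" for x n
    using subgroup.m_inv_closed[OF gsub that] by (simp add: a_inv_def)
  interpret N: graded_abelian_group ?N
  proof (intro graded_abelian_group.intro graded_abelian_group_axioms.intro N.abelian_group_axioms)
    fix n show "subgroup (grade ?N n) (add_monoid ?N)"
    proof (rule group.subgroupI[OF N.a_group])
      show "grade ?N n \<noteq> {}" using M.M.zero_grade[of n] HD(2) by auto
      show "inv\<^bsub>add_monoid ?N\<^esub> x \<in> grade ?N n" if "x \<in> grade ?N n" for x
        using that HD(4) neg by (subst inv) auto
    qed (use HD(3) M.M.add_grade in auto)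
  next
    fix x assume x: "x \<in> carrier ?N"
    then have xH: "x \<in> H" and xc: "x \<in> carrier M" using Hc by auto
    show "\<exists>!c. (\<forall>n. c n \<in> grade ?N n) \<and> finite {n. c n \<noteq> \<zero>\<^bsub>?N\<^esub>} \<and>
        x = (\<Oplus>\<^bsub>?N\<^esub>n \<in> {n. c n \<noteq> \<zero>\<^bsub>?N\<^esub>}. c n)"
    proof (rule ex1I[of _ "component M x"], intro conjI allI)
      show "component M x n \<in> grade ?N n" for n
        using M.M.component_grade[OF xc] comp[OF xH] by simp
      show "finite {n. component M x n \<noteq> \<zero>\<^bsub>?N\<^esub>}" using M.M.finite_component[OF xc] by simp
      then show "x = (\<Oplus>\<^bsub>?N\<^esub>n \<in> {n. component M x n \<noteq> \<zero>\<^bsub>?N\<^esub>}. component M x n)"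
        using M.M.sum_component[OF xc] comp[OF xH] by (subst fs) simp_all
    next
      fix c assume c: "(\<forall>n. c n \<in> grade ?N n) \<and> finite {n. c n \<noteq> \<zero>\<^bsub>?N\<^esub>} \<and>
        x = (\<Oplus>\<^bsub>?N\<^esub>n \<in> {n. c n \<noteq> \<zero>\<^bsub>?N\<^esub>}. c n)"
      then have "(\<Oplus>\<^bsub>?N\<^esub>n \<in> {n. c n \<noteq> \<zero>\<^bsub>M\<^esub>}. c n) = (\<Oplus>\<^bsub>M\<^esub>n \<in> {n. c n \<noteq> \<zero>\<^bsub>M\<^esub>}. c n)"
        by (intro fs) auto
      then have "x = (\<Oplus>\<^bsub>M\<^esub>n \<in> {n. c n \<noteq> \<zero>\<^bsub>M\<^esub>}. c n)" using c by simp
      then show "c = component M x"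
        using c by (intro M.M.component_unique[symmetric, where S = "{n. c n \<noteq> \<zero>\<^bsub>M\<^esub>}"]) auto
    qed
  qed
  show ?thesis
  proof
    show "a \<odot>\<^bsub>?N\<^esub> x \<in> grade ?N (m + n)" if "a \<in> grade R m" "x \<in> grade ?N n" for a x m n
      using that M.smult_grade HD(5) M.R.grade_closed by auto
  qed (use Hc HD(5) in \<open>auto simp: M.smult_l_distr M.smult_r_distr M.smult_assoc M.smult_one\<close>)
qed

lemma graded_hom_restrict:
  "f \<in> graded_hom R M N \<Longrightarrow> H \<subseteq> carrier M \<Longrightarrow> f \<in> graded_hom R (sub_module M H) N"
  unfolding graded_hom_def hom_def by (auto simp: Pi_def image_subset_iff subset_iff)

definition free_unit :: "('a, 'd) ring_scheme \<Rightarrow> 'i \<Rightarrow> 'i \<Rightarrow> 'a" where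
  "free_unit R b = (\<lambda>c. if c = b then \<one>\<^bsub>R\<^esub> else \<zero>\<^bsub>R\<^esub>)"

context graded_ring
begin

lemma free_unit_grade: "b \<in> B \<Longrightarrow> free_unit A b \<in> grade (free_graded_module A B \<delta>) (\<delta> b)"
proof -
  have "{c. free_unit A b c \<noteq> \<zero>} \<subseteq> {b}" by (auto simp: free_unit_def)
  then show "b \<in> B \<Longrightarrow> ?thesis"
    unfolding free_graded_module_sel
    by (auto simp: free_unit_def one_grade zero_grade intro: finite_subset)
qed

lemma free_extension_unit:
  assumes \<phi>: "\<phi> \<in> carrier (free_graded_module A B \<delta>)"
  shows "free_extension A (free_graded_module A B \<delta>) (free_unit A) \<phi> = \<phi>"
proof
  fix c
  let ?F = "free_graded_module A B \<delta>"
  interpret F: graded_left_module A ?F by (rule free_graded_left_module)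
  have fin: "finite {b. \<phi> b \<noteq> \<zero>}" and sub: "{b. \<phi> b \<noteq> \<zero>} \<subseteq> B" and cl [simp]: "\<phi> b \<in> carrier A" for b
    using \<phi> by (auto simp: free_graded_module_sel)
  have uc: "free_unit A b \<in> carrier ?F" if "b \<in> B" for b
    using free_unit_grade[OF that] by (rule F.M.grade_closed)
  have "free_extension A ?F (free_unit A) \<phi> c = (\<Oplus>b \<in> {b. \<phi> b \<noteq> \<zero>}. (\<phi> b \<odot>\<^bsub>?F\<^esub> free_unit A b) c)"
    unfolding free_extension_def
  proof (rule free_finsum[OF fin])
    fix b assume "b \<in> {b. \<phi> b \<noteq> \<zero>}"
    then have "b \<in> B" using sub by blast
    from uc[OF this] show "\<phi> b \<odot>\<^bsub>?F\<^esub> free_unit A b \<in> carrier ?F" by (rule F.smult_closed[OF cl])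
  qed
  also have "\<dots> = (\<Oplus>b \<in> {b. \<phi> b \<noteq> \<zero>}. if c = b then \<phi> b else \<zero>)"
    by (rule finsum_cong') (auto simp: free_graded_module_sel free_unit_def)
  also have "\<dots> = \<phi> c"
  proof (cases "\<phi> c = \<zero>")
    case True
    then have "(\<Oplus>b \<in> {b. \<phi> b \<noteq> \<zero>}. if c = b then \<phi> b else \<zero>) = \<zero>"
      by (intro add.finprod_one_eqI) auto
    then show ?thesis using True by simp
  next
    case False
    then show ?thesis using fin add.finprod_singleton[of c "{b. \<phi> b \<noteq> \<zero>}" \<phi>] by (simp add: Pi_def)
  qed
  finally show "free_extension A ?F (free_unit A) \<phi> c = \<phi> c" .
qed

end

text \<open>The modules A e_i of the resolution are direct summands of free modules. They are
  treated as fixed points of an idempotent endomorphism, which avoids naming a complement.\<close>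

locale free_summand = R: graded_ring R
  for R :: "('k, 'a, 'd) graded_module_scheme" (structure) +
  fixes B :: "'i set" and \<delta> :: "'i \<Rightarrow> int" and \<rho> :: "('i \<Rightarrow> 'a) \<Rightarrow> 'i \<Rightarrow> 'a"
  assumes hom: "\<rho> \<in> graded_hom R (free_graded_module R B \<delta>) (free_graded_module R B \<delta>)"
    and idem: "\<phi> \<in> carrier (free_graded_module R B \<delta>) \<Longrightarrow> \<rho> (\<rho> \<phi>) = \<rho> \<phi>"
begin

definition summand :: "('a, 'i \<Rightarrow> 'a) graded_module" where
  "summand = sub_module (free_graded_module R B \<delta>) {\<phi> \<in> carrier (free_graded_module R B \<delta>). \<rho> \<phi> = \<phi>}"

abbreviation F :: "('a, 'i \<Rightarrow> 'a) graded_module" where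
  "F \<equiv> free_graded_module R B \<delta>"

lemma summand_sel:
  "carrier summand = {\<phi> \<in> carrier F. \<rho> \<phi> = \<phi>}" "zero summand = zero F" "add summand = add F"
  "smult summand = smult F" "grade summand n = {\<phi> \<in> grade F n. \<rho> \<phi> = \<phi>}"
proof -
  interpret F: graded_left_module R F by (rule R.free_graded_left_module)
  show "grade summand n = {\<phi> \<in> grade F n. \<rho> \<phi> = \<phi>}"
    unfolding summand_def using F.M.grade_closed by auto
qed (simp_all add: summand_def)

lemma submodule_fixed: "submodule {\<phi> \<in> carrier F. \<rho> \<phi> = \<phi>} R F"
proof -
  interpret F: graded_left_module R F by (rule R.free_graded_left_module)
  note homD = graded_homD[OF hom]
  interpret group_hom "add_monoid F" "add_monoid F" \<rho>
    by (intro group_hom.intro group_hom_axioms.intro homD(1) F.M.a_group)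
  show ?thesis
  proof (intro submodule.intro submodule_axioms.intro)
    show "subgroup {\<phi> \<in> carrier F. \<rho> \<phi> = \<phi>} (add_monoid F)"
    proof (rule group.subgroupI[OF F.M.a_group])
      show "{\<phi> \<in> carrier F. \<rho> \<phi> = \<phi>} \<noteq> {}" using hom_one F.M.zero_closed by auto
    qed (use homD in auto)
  qed (use homD F.smult_closed in auto)
qed

lemma graded_summand: "graded_left_module R summand"
  unfolding summand_def
proof (rule graded_sub_module[OF R.free_graded_left_module submodule_fixed])
  fix \<phi> n assume "\<phi> \<in> {\<phi> \<in> carrier F. \<rho> \<phi> = \<phi>}"
  then have \<phi>: "\<phi> \<in> carrier F" "\<rho> \<phi> = \<phi>" by auto
  interpret F: graded_left_module R F by (rule R.free_graded_left_module)
  have "component F \<phi> n \<in> carrier F" using F.M.component_grade[OF \<phi>(1)] by (rule F.M.grade_closed)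
  then show "component F \<phi> n \<in> {\<phi> \<in> carrier F. \<rho> \<phi> = \<phi>}"
    using graded_hom_component[OF R.free_graded_left_module R.free_graded_left_module hom \<phi>(1), of n] \<phi>(2)
    by simp
qed

text \<open>Apply \<open>\<rho>\<close> to the expansion of \<open>\<phi>\<close> in the basis: the
  coefficients stay the same, and the basis elements become generators of the summand.\<close>

lemma projection_unit:
  assumes "\<phi> \<in> carrier summand"
  shows "free_extension R F (\<lambda>b. \<rho> (free_unit R b)) \<phi> = \<phi>"
proof -
  interpret F: graded_left_module R F by (rule R.free_graded_left_module)
  have \<phi>: "\<phi> \<in> carrier F" "\<rho> \<phi> = \<phi>" using assms by (auto simp: summand_sel)
  have "\<rho> (free_extension R F (free_unit R) \<phi>) = free_extension R F (\<lambda>b. \<rho> (free_unit R b)) \<phi>"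
    by (rule graded_hom_free_extension[OF R.free_graded_left_module R.free_graded_left_module hom \<phi>(1)])
      (rule F.M.grade_closed[OF R.free_unit_grade])
  then show ?thesis using \<phi> by (simp add: R.free_extension_unit)
qed

lemma unit_grade: "b \<in> B \<Longrightarrow> \<rho> (free_unit R b) \<in> grade summand (\<delta> b)"
proof -
  assume b: "b \<in> B"
  interpret F: graded_left_module R F by (rule R.free_graded_left_module)
  have "\<rho> (free_unit R b) \<in> grade F (\<delta> b)" by (rule graded_homD(5)[OF hom R.free_unit_grade[OF b]])
  moreover have "\<rho> (\<rho> (free_unit R b)) = \<rho> (free_unit R b)"
    by (rule idem) (rule F.M.grade_closed[OF R.free_unit_grade[OF b]])
  ultimately show ?thesis by (simp add: summand_sel)
qed

lemma summand_lift:
  assumes M: "graded_left_module R M" and N: "graded_left_module R N"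
    and g: "g \<in> graded_hom R M N" "g ` carrier M = carrier N" and f: "f \<in> graded_hom R summand N"
  shows "\<exists>h \<in> graded_hom R summand M. \<forall>x \<in> carrier summand. g (h x) = f x"
proof -
  interpret F: graded_left_module R F by (rule R.free_graded_left_module)
  interpret S: graded_left_module R summand by (rule graded_summand)
  interpret M: graded_left_module R M by (rule M)
  interpret N: graded_left_module R N by (rule N)
  let ?u = "\<lambda>b. \<rho> (free_unit R b)"
  have "\<exists>y. y \<in> grade M (\<delta> b) \<and> g y = f (?u b)" if b: "b \<in> B" for b
  proof -
    have fu: "f (?u b) \<in> grade N (\<delta> b)" by (rule graded_homD(5)[OF f unit_grade[OF b]])
    then have "f (?u b) \<in> g ` carrier M" using g(2) N.M.grade_closed by simp
    then obtain y where y: "y \<in> carrier M" "g y = f (?u b)" by auto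
    \<comment> \<open>A preimage need not be homogeneous; its component in the right degree is again
      a preimage.\<close>
    have "g (component M y (\<delta> b)) = component N (f (?u b)) (\<delta> b)"
      using graded_hom_component[OF M N g(1) y(1)] y(2) by simp
    also have "\<dots> = f (?u b)" using N.M.component_homogeneous[OF fu] by simp
    finally show ?thesis using M.M.component_grade[OF y(1)] by blast
  qed
  then have "\<forall>b \<in> B. \<exists>y. y \<in> grade M (\<delta> b) \<and> g y = f (?u b)" by blast
  from bchoice[OF this] obtain m
    where m: "\<And>b. b \<in> B \<Longrightarrow> m b \<in> grade M (\<delta> b)" "\<And>b. b \<in> B \<Longrightarrow> g (m b) = f (?u b)"
    by blast
  let ?h = "free_extension R M m"
  \<comment> \<open>The map is defined on the whole free module by its values on the basis; the
    claim is that its restriction to the summand lifts \<open>f\<close>.\<close>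
  have h: "?h \<in> graded_hom R F M" by (rule M.free_extension_hom) (rule m(1))
  have hS: "?h \<in> graded_hom R summand M"
    unfolding summand_def by (rule graded_hom_restrict[OF h]) blast
  have "g (?h \<phi>) = f \<phi>" if \<phi>: "\<phi> \<in> carrier summand" for \<phi>
  proof -
    have \<phi>F: "\<phi> \<in> carrier F" using \<phi> by (simp add: summand_sel)
    have sub: "{b. \<phi> b \<noteq> \<zero>} \<subseteq> B" and cl: "\<phi> b \<in> carrier R" and fin: "finite {b. \<phi> b \<noteq> \<zero>}" for b
      using \<phi>F by (auto simp: R.free_graded_module_sel)
    have uS: "?u b \<in> carrier summand" if "b \<in> B" for b by (rule S.M.grade_closed[OF unit_grade[OF that]])
    have "g (?h \<phi>) = free_extension R N (\<lambda>b. g (m b)) \<phi>"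
      by (rule graded_hom_free_extension[OF M N g(1) \<phi>F]) (rule M.M.grade_closed[OF m(1)])
    also have "\<dots> = free_extension R N (\<lambda>b. f (?u b)) \<phi>"
      unfolding free_extension_def
    proof (rule N.M.finsum_cong'[OF refl])
      fix b assume "b \<in> {b. \<phi> b \<noteq> \<zero>}"
      then have b: "b \<in> B" using sub by blast
      show "\<phi> b \<odot>\<^bsub>N\<^esub> g (m b) = \<phi> b \<odot>\<^bsub>N\<^esub> f (?u b)" using m(2)[OF b] by simp
    next
      show "(\<lambda>b. \<phi> b \<odot>\<^bsub>N\<^esub> f (?u b)) \<in> {b. \<phi> b \<noteq> \<zero>} \<rightarrow> carrier N"
      proof
        fix b assume "b \<in> {b. \<phi> b \<noteq> \<zero>}"
        then have b: "b \<in> B" using sub by blast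
        show "\<phi> b \<odot>\<^bsub>N\<^esub> f (?u b) \<in> carrier N"
          by (rule N.smult_closed[OF cl graded_homD(2)[OF f uS[OF b]]])
      qed
    qed
    also have "\<dots> = (\<Oplus>\<^bsub>N\<^esub>b \<in> {b. \<phi> b \<noteq> \<zero>}. f (\<phi> b \<odot>\<^bsub>F\<^esub> ?u b))"
      unfolding free_extension_def
    proof (rule N.M.finsum_cong'[OF refl])
      fix b assume "b \<in> {b. \<phi> b \<noteq> \<zero>}"
      then have b: "b \<in> B" using sub by blast
      show "\<phi> b \<odot>\<^bsub>N\<^esub> f (?u b) = f (\<phi> b \<odot>\<^bsub>F\<^esub> ?u b)"
        using graded_homD(4)[OF f cl uS[OF b]] by (simp add: summand_sel)
    next
      show "(\<lambda>b. f (\<phi> b \<odot>\<^bsub>F\<^esub> ?u b)) \<in> {b. \<phi> b \<noteq> \<zero>} \<rightarrow> carrier N"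
      proof
        fix b assume "b \<in> {b. \<phi> b \<noteq> \<zero>}"
        then have b: "b \<in> B" using sub by blast
        show "f (\<phi> b \<odot>\<^bsub>F\<^esub> ?u b) \<in> carrier N"
          using graded_homD(2)[OF f S.smult_closed[OF cl uS[OF b]]] by (simp add: summand_sel)
      qed
    qed
    \<comment> \<open>\<open>f\<close> is additive on the summand only, so the sum is formed there
      and afterwards compared with the sum in the free module.\<close>
    also have "\<dots> = f (\<Oplus>\<^bsub>summand\<^esub>b \<in> {b. \<phi> b \<noteq> \<zero>}. \<phi> b \<odot>\<^bsub>F\<^esub> ?u b)"
    proof (rule hom_add_finsum[OF S.M.abelian_group_axioms N.M.abelian_group_axioms graded_homD(1)[OF f] fin,
          symmetric])
      fix b assume "b \<in> {b. \<phi> b \<noteq> \<zero>}"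
      then have b: "b \<in> B" using sub by blast
      show "\<phi> b \<odot>\<^bsub>F\<^esub> ?u b \<in> carrier summand"
        using S.smult_closed[OF cl uS[OF b]] by (simp add: summand_sel)
    qed
    also have "(\<Oplus>\<^bsub>summand\<^esub>b \<in> {b. \<phi> b \<noteq> \<zero>}. \<phi> b \<odot>\<^bsub>F\<^esub> ?u b) = \<phi>"
    proof -
      have id: "(\<lambda>x. x) \<in> graded_hom R summand F"
        unfolding graded_hom_def hom_def by (auto simp: summand_sel)
      have "(\<Oplus>\<^bsub>summand\<^esub>b \<in> {b. \<phi> b \<noteq> \<zero>}. \<phi> b \<odot>\<^bsub>F\<^esub> ?u b) = (\<Oplus>\<^bsub>F\<^esub>b \<in> {b. \<phi> b \<noteq> \<zero>}. \<phi> b \<odot>\<^bsub>F\<^esub> ?u b)"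
      proof (rule hom_add_finsum[OF S.M.abelian_group_axioms F.M.abelian_group_axioms graded_homD(1)[OF id] fin])
        fix b assume "b \<in> {b. \<phi> b \<noteq> \<zero>}"
        then have b: "b \<in> B" using sub by blast
        show "\<phi> b \<odot>\<^bsub>F\<^esub> ?u b \<in> carrier summand"
          using S.smult_closed[OF cl uS[OF b]] by (simp add: summand_sel)
      qed
      also have "\<dots> = \<phi>" using projection_unit[OF \<phi>] by (simp add: free_extension_def)
      finally show ?thesis .
    qed
    finally show ?thesis .
  qed
  then show ?thesis using hS by blast
qed

theorem projective_summand: "graded_projective R summand"
  unfolding graded_projective_def using graded_summand summand_lift by blast

text \<open>By \<open>projection_unit\<close> the projected basis elements generate, and all of them
  have degree \<open>n\<close>.\<close>

theorem generated_summand: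
  assumes \<delta>: "\<And>b. b \<in> B \<Longrightarrow> \<delta> b = n"
  shows "generated_in_degree n R summand"
  unfolding generated_in_degree_def
proof (intro allI impI)
  fix H assume H: "submodule H R summand \<and> grade summand n \<subseteq> H"
  interpret S: graded_left_module R summand by (rule graded_summand)
  interpret F: graded_left_module R F by (rule R.free_graded_left_module)
  let ?u = "\<lambda>b. \<rho> (free_unit R b)"
  have HD: "H \<subseteq> carrier summand" "\<zero>\<^bsub>F\<^esub> \<in> H" "x \<in> H \<Longrightarrow> y \<in> H \<Longrightarrow> x \<oplus>\<^bsub>F\<^esub> y \<in> H"
    "a \<in> carrier R \<Longrightarrow> x \<in> H \<Longrightarrow> a \<odot>\<^bsub>F\<^esub> x \<in> H" for x y a
    using S.submoduleD[of H] H by (auto simp: summand_sel)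
  have "\<phi> \<in> H" if \<phi>: "\<phi> \<in> carrier summand" for \<phi>
  proof -
    have \<phi>F: "\<phi> \<in> carrier F" using \<phi> by (simp add: summand_sel)
    have sub: "{b. \<phi> b \<noteq> \<zero>} \<subseteq> B" and cl: "\<phi> b \<in> carrier R" and fin: "finite {b. \<phi> b \<noteq> \<zero>}" for b
      using \<phi>F by (auto simp: R.free_graded_module_sel)
    have "(\<Oplus>\<^bsub>F\<^esub>b \<in> S. \<phi> b \<odot>\<^bsub>F\<^esub> ?u b) \<in> H" if "finite S" "S \<subseteq> B" for S
      using that
    proof (induction S rule: finite_induct)
      case empty then show ?case using HD(2) by simp
    next
      case (insert b S)
      have mem: "\<phi> b \<odot>\<^bsub>F\<^esub> ?u b \<in> H" if "b \<in> B" for b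
        by (rule HD(4)[OF cl]) (use unit_grade[OF that] \<delta>[OF that] H in auto)
      have "H \<subseteq> carrier F" using HD(1) by (auto simp: summand_sel)
      then have "(\<lambda>b. \<phi> b \<odot>\<^bsub>F\<^esub> ?u b) \<in> S \<rightarrow> carrier F" "\<phi> b \<odot>\<^bsub>F\<^esub> ?u b \<in> carrier F"
        using mem insert.prems by blast+
      then have "(\<Oplus>\<^bsub>F\<^esub>b \<in> insert b S. \<phi> b \<odot>\<^bsub>F\<^esub> ?u b) =
          \<phi> b \<odot>\<^bsub>F\<^esub> ?u b \<oplus>\<^bsub>F\<^esub> (\<Oplus>\<^bsub>F\<^esub>b \<in> S. \<phi> b \<odot>\<^bsub>F\<^esub> ?u b)"
        using insert.hyps by (intro F.M.finsum_insert) auto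
      then show ?case using HD(3)[OF mem insert.IH] insert.prems by simp
    qed
    from this[OF fin sub] show ?thesis using projection_unit[OF \<phi>] by (simp add: free_extension_def)
  qed
  then show "H = carrier summand" using HD(1) by blast
qed

end

section \<open>The words indexing the resolution of a simple module\<close>

locale zigzag_words = connected_zigzag_graph K G
  for K :: "('k, 'd) ring_scheme" (structure) and G :: "'v pair_pre_digraph" +
  fixes C :: "'v set" and r :: 'v
  assumes C_sub: "C \<subseteq> pverts G" and C_nonempty: "C \<noteq> {}" and r_vert: "r \<in> pverts G"
begin

section \<open>Parents, words and the coefficients of the differential\<close>

definition dist_C :: "'v \<Rightarrow> nat" where
  "dist_C i = (LEAST n. \<exists>c \<in> C. (i, c) \<in> parcs G ^^ n)"

definition parent :: "'v \<Rightarrow> 'v" where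
  "parent i = (SOME j. (i, j) \<in> parcs G \<and> dist_C j < dist_C i)"

text \<open>A shortest walk from \<open>i\<close> to \<open>C\<close> has at least one arc, and its
  second vertex is closer to \<open>C\<close>.\<close>

lemma parent:
  assumes i: "i \<in> pverts G" "i \<notin> C"
  shows parent_arc: "(i, parent i) \<in> parcs G" and dist_parent: "dist_C (parent i) < dist_C i"
proof -
  obtain c where c: "c \<in> C" using C_nonempty by blast
  then have "(i, c) \<in> (parcs G)\<^sup>*" using i C_sub by (intro reach) auto
  then have "\<exists>n. \<exists>c \<in> C. (i, c) \<in> parcs G ^^ n" using c rtrancl_imp_relpow by blast
  then have "\<exists>c \<in> C. (i, c) \<in> parcs G ^^ dist_C i" unfolding dist_C_def by (rule LeastI_ex)
  then obtain c where c: "c \<in> C" "(i, c) \<in> parcs G ^^ dist_C i" by blast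
  then obtain n where n: "dist_C i = Suc n" using i(2) by (cases "dist_C i") auto
  then obtain j where j: "(i, j) \<in> parcs G" "(j, c) \<in> parcs G ^^ n" using c(2) by (metis relpow_Suc_E2)
  have "dist_C j \<le> n" unfolding dist_C_def by (rule Least_le) (use c j in blast)
  then have "(i, j) \<in> parcs G \<and> dist_C j < dist_C i" using j n by simp
  then have "(i, parent i) \<in> parcs G \<and> dist_C (parent i) < dist_C i"
    unfolding parent_def by (rule someI)
  then show "(i, parent i) \<in> parcs G" "dist_C (parent i) < dist_C i" by auto
qed

text \<open>The distance to \<open>C\<close> drops strictly at each of the two steps.\<close>

lemma parent_parent:
  assumes "i \<in> pverts G" "i \<notin> C" "parent i \<notin> C"
  shows "parent (parent i) \<noteq> i"
proof -
  have "parent i \<in> pverts G" using arcs_in_verts[OF parent_arc[OF assms(1,2)]] by simp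
  from dist_parent[OF this assms(3)] dist_parent[OF assms(1,2)] show ?thesis by auto
qed

definition bad :: "'v \<Rightarrow> 'v list \<Rightarrow> bool" where
  "bad k w \<longleftrightarrow> k \<notin> C \<and> (\<exists>a. w = parent k # k # a)"

text \<open>
  Words are paths read backwards: they end in \<open>r\<close>.  The word \<open>w\<close> of length \<open>t + 1\<close> stands for a
  generator \<open>[w]\<close> of the \<open>t\<close>-th module at the vertex \<open>hd w\<close>; excluding the subwords
  \<open>[k, parent k, k]\<close> selects a basis of the Koszul dual, in which the sum over all neighbours \<open>j\<close>
  of the paths \<open>[k, j, k]\<close> vanishes.
\<close>

primrec words :: "nat \<Rightarrow> 'v list set" where
  "words 0 = {[r]}"
| "words (Suc t) = {k # w | k w. w \<in> words t \<and> (k, hd w) \<in> parcs G \<and> \<not> bad k w}"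

text \<open>
  The differential sends \<open>[w]\<close> to \<open>(hd w \<rightarrow> hd (tl w)) [tl w]\<close> plus, if \<open>correction w = Some (s, z)\<close>,
  the term \<open>s (hd w \<rightarrow> parent (hd w)) [z]\<close>.
\<close>

fun correction :: "'v list \<Rightarrow> ('k \<times> 'v list) option" where
  "correction [] = None"
| "correction (q # w) =
    (if q \<in> C then None
     else if \<exists>j a. w = j # q # a then Some (\<ominus> \<one>, parent q # tl w)
     else if w \<noteq> [] \<and> q = parent (hd w)
       then map_option (\<lambda>(s, z). (\<ominus> s, parent q # z)) (correction w)
     else None)"

text \<open>The matrix entries of the differential, up to the arrow. The main term and the
  correction do not collide on a word: the correction starts at \<open>parent (hd w)\<close>, and by
  \<open>correction_Some\<close> the main term \<open>tl w\<close> does not.\<close>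

definition coeff :: "'v list \<Rightarrow> 'v list \<Rightarrow> 'k" where
  "coeff w u = (if u = tl w then \<one> else case correction w of None \<Rightarrow> \<zero>
     | Some (s, z) \<Rightarrow> if u = z then s else \<zero>)"

lemma words_nonempty: "w \<in> words t \<Longrightarrow> w \<noteq> []"
  by (cases t) auto

lemma words_length: "w \<in> words t \<Longrightarrow> length w = Suc t"
  by (induction t arbitrary: w) auto

lemma words_verts: "w \<in> words t \<Longrightarrow> set w \<subseteq> pverts G"
proof (induction t arbitrary: w)
  case (Suc t)
  then show ?case using arcs_in_verts by fastforce
qed (simp add: r_vert)

lemma words_hd: "w \<in> words t \<Longrightarrow> hd w \<in> pverts G"
  using words_verts words_nonempty by (metis hd_in_set subsetD)

lemma finite_words: "finite (words t)"
proof (rule finite_subset)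
  show "words t \<subseteq> {w. set w \<subseteq> pverts G \<and> length w \<le> Suc t}" using words_verts words_length by fastforce
qed (rule finite_lists_length_le[OF finite_verts])

lemma words_SucE:
  assumes "w \<in> words (Suc t)"
  obtains k v where "w = k # v" "v \<in> words t" "(k, hd v) \<in> parcs G" "\<not> bad k v"
  using assms by auto

lemma words_tl: "w \<in> words (Suc t) \<Longrightarrow> tl w \<in> words t"
  by auto

lemma words_arc: "w \<in> words (Suc t) \<Longrightarrow> (hd w, hd (tl w)) \<in> parcs G"
  by auto

text \<open>With p = \<open>parent (hd w)\<close>, an excluded beginning would be p,
  \<open>parent\<close> p, p; it would make \<open>hd w\<close> the parent of its own parent. Hence
  a parent can always be put in front, which makes the correction terms words.\<close>

lemma words_parent_Cons:
  assumes w: "w \<in> words t" and hd: "hd w \<notin> C"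
  shows "parent (hd w) # w \<in> words (Suc t)"
proof -
  have v: "hd w \<in> pverts G" by (rule words_hd[OF w])
  have "\<not> bad (parent (hd w)) w"
  proof
    assume "bad (parent (hd w)) w"
    then have "parent (hd w) \<notin> C" and "\<exists>a. w = parent (parent (hd w)) # parent (hd w) # a"
      unfolding bad_def by blast+
    then have "parent (hd w) \<notin> C" "parent (parent (hd w)) = hd w" by (metis list.sel(1))+
    then show False using parent_parent[OF v hd] by blast
  qed
  then show ?thesis using w arc_sym[OF parent_arc[OF v hd]] by auto
qed

text \<open>The triangularity of the corrections. The conclusion \<open>bad (hd w) z\<close> keeps
  correction terms apart from main terms of words with the same head. The condition on
  \<open>hd (tl w)\<close> says that a corrected word never starts with a vertex followed by its
  parent.\<close>

lemma correction_Some: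
  assumes "w \<in> words (Suc t)" "correction w = Some (s, z)"
  shows "z \<in> words t \<and> hd w \<notin> C \<and> hd z = parent (hd w) \<and> hd (tl w) \<noteq> parent (hd w) \<and>
    s \<in> carrier K \<and> bad (hd w) z"
  using assms
proof (induction t arbitrary: w s z)
  case 0
  then show ?case by (auto split: if_splits)
next
  case (Suc t)
  from Suc.prems(1) obtain q v where w: "w = q # v" and v: "v \<in> words (Suc t)"
    and qv: "(q, hd v) \<in> parcs G" "\<not> bad q v"
    by (rule words_SucE)
  have q: "q \<in> pverts G" using arcs_in_verts[OF qv(1)] by simp
  have qC: "q \<notin> C" using Suc.prems(2) by (auto simp: w split: if_splits)
  show ?case
  proof (cases "\<exists>j a. v = j # q # a")
    case True
    then obtain j a where v': "v = j # q # a" by blast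
    have sz: "s = \<ominus> \<one>" "z = parent q # q # a"
      using Suc.prems(2) qC v' by (auto simp: w)
    have "q # a \<in> words t" using words_tl[OF v] v' by simp
    then have "z \<in> words (Suc t)" unfolding sz using words_parent_Cons[of "q # a" t] qC by simp
    \<comment> \<open>Equality would make \<open>w\<close> start with the excluded subword
      \<open>[q, parent q, q]\<close>.\<close>
    moreover have "j \<noteq> parent q" using qv(2) qC v' by (auto simp: bad_def)
    moreover have "bad q z" using qC by (auto simp: bad_def sz)
    ultimately show ?thesis using qC sz(1) by (simp add: w v' sz(2))
  next
    case False
    then have qp: "q = parent (hd v)" and "\<exists>s' z'. correction v = Some (s', z') \<and> s = \<ominus> s' \<and> z = parent q # z'"
      using Suc.prems(2) qC by (auto simp: w split: if_splits)
    then obtain s' z' where c: "correction v = Some (s', z')" and sz: "s = \<ominus> s'" "z = parent q # z'" by blast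
    from Suc.IH[OF v c] have IH: "z' \<in> words t" "hd v \<notin> C" "hd z' = q" "s' \<in> carrier K"
      using qp by auto
    have "hd v \<in> pverts G" by (rule words_hd[OF v])
    \<comment> \<open>Since \<open>q = parent (hd v)\<close>, equality would be a two-cycle.\<close>
    then have "hd v \<noteq> parent q" using parent_parent[of "hd v"] IH(2) qp qC by metis
    moreover have "z \<in> words (Suc t)" unfolding sz using words_parent_Cons[OF IH(1)] IH(3) qC by simp
    moreover have "z' = q # tl z'" using IH(3) words_nonempty[OF IH(1)] by (metis list.collapse)
    then have "bad q z" using qC unfolding bad_def sz by blast
    ultimately show ?thesis using qC IH(4) by (simp add: w sz)
  qed
qed

lemma coeff_closed: "w \<in> words (Suc t) \<Longrightarrow> coeff w u \<in> carrier K"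
proof (cases "correction w")
  case (Some sz)
  obtain s z where sz: "sz = (s, z)" by (cases sz)
  show ?thesis if w: "w \<in> words (Suc t)"
    using correction_Some[OF w Some[unfolded sz]] unfolding coeff_def Some sz by simp
qed (simp add: coeff_def)

lemma coeff_tl: "coeff w (tl w) = \<one>"
  by (simp add: coeff_def)

lemma coeff_nonzero:
  assumes "coeff w u \<noteq> \<zero>" "u \<noteq> tl w"
  obtains s where "correction w = Some (s, u)"
  using assms by (auto simp: coeff_def split: option.splits if_splits)

lemma coeff_arc:
  assumes w: "w \<in> words (Suc t)" and "coeff w u \<noteq> \<zero>"
  shows "(hd w, hd u) \<in> parcs G"
proof (cases "u = tl w")
  case True
  then show ?thesis using words_arc[OF w] by simp
next
  case False
  then obtain s where "correction w = Some (s, u)" using assms(2) coeff_nonzero by blast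
  from correction_Some[OF w this] have "hd w \<notin> C" "hd u = parent (hd w)" by auto
  then show ?thesis using parent_arc[OF words_hd[OF w]] by simp
qed

text \<open>The sum is the coefficient of x_q times \<open>[u]\<close>, for q = \<open>hd u\<close>,
  in the square of the differential on \<open>[w]\<close>. Composites of arrows with different ends
  are 0, and so are loops at \<open>C\<close>, whence the conditions on the heads.\<close>

lemma coeff_square:
  assumes w: "w \<in> words (Suc (Suc t))" and u: "u \<in> words t" and hd: "hd w = hd u" "hd u \<notin> C"
  shows "(\<Oplus>v \<in> words (Suc t). coeff w v \<otimes> coeff v u) = \<zero>"
proof -
  from w obtain q v where wq: "w = q # v" and v: "v \<in> words (Suc t)"
    and qv: "(q, hd v) \<in> parcs G" "\<not> bad q v"
    by (rule words_SucE)
  have q: "q \<in> pverts G" "q \<notin> C" "hd u = q" using arcs_in_verts[OF qv(1)] hd wq by auto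
  \<comment> \<open>A word starting at \<open>parent q\<close> reaches a word starting at
    \<open>q\<close> only through its main term: a correction would start at
    \<open>parent (parent q)\<close>.\<close>
  have zero_z: "coeff z u = (if u = tl z then \<one> else \<zero>)" if z: "z \<in> words (Suc t)" "hd z = parent q" for z
  proof (cases "u = tl z \<or> coeff z u = \<zero>")
    case False
    then obtain s where "correction z = Some (s, u)" using coeff_nonzero by blast
    from correction_Some[OF z(1) this] z(2) q(3) have "parent q \<notin> C" "parent (parent q) = q" by auto
    then show ?thesis using parent_parent[OF q(1,2)] by blast
  qed (auto simp: coeff_def)
  show ?thesis
  proof (cases "correction w")
    case None
    have "coeff w x \<otimes> coeff x u = \<zero>" if x: "x \<in> words (Suc t)" for x
    proof (cases "x = v")
      case True
      \<comment> \<open>If \<open>u\<close> occurred in the image of \<open>v\<close>, as main term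
        or as correction, then \<open>w\<close> would fall under one of the two clauses that give it
        a correction.\<close>
      have "coeff v u = \<zero>"
      proof (rule ccontr)
        assume nz: "coeff v u \<noteq> \<zero>"
        show False
        proof (cases "u = tl v")
          case True
          have "v = hd v # q # tl (tl v)"
            using words_nonempty[OF v] words_nonempty[OF u] q(3) True by (metis list.collapse)
          then have "\<exists>j a. v = j # q # a" by blast
          then show False using None q(2) by (simp add: wq)
        next
          case False
          then obtain s where c: "correction v = Some (s, u)" using nz coeff_nonzero by blast
          from correction_Some[OF v this] q(3) have "q = parent (hd v)" by simp
          then show False using None q(2) c words_nonempty[OF v] by (auto simp: wq split: if_splits)
        qed
      qed
      then show ?thesis using True coeff_closed[OF w] by simp
    next
      case False
      then have "coeff w x = \<zero>" using None by (simp add: coeff_def wq)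
      then show ?thesis using coeff_closed[OF x] by simp
    qed
    then show ?thesis by (rule add.finprod_one_eqI)
  next
    case (Some sz)
    obtain s z where sz: "sz = (s, z)" by (cases sz)
    note c = Some[unfolded sz]
    from correction_Some[OF w c] have z: "z \<in> words (Suc t)" "hd z = parent q" "hd v \<noteq> parent q"
      and s: "s \<in> carrier K" by (auto simp: wq)
    have vz: "v \<noteq> z" using z(2,3) by auto
    have cw: "coeff w v = \<one>" "coeff w z = s" using vz c by (auto simp: coeff_def wq)
    have zero: "coeff w x \<otimes> coeff x u = \<zero>" if "x \<in> words (Suc t) - {v, z}" for x
    proof -
      have "coeff w x = \<zero>" using that c by (auto simp: coeff_def wq)
      then show ?thesis using coeff_closed[of x t u] that by simp
    qed
    have "(\<Oplus>x \<in> words (Suc t). coeff w x \<otimes> coeff x u) = (\<Oplus>x \<in> {v, z}. coeff w x \<otimes> coeff x u)"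
      by (rule add.finprod_mono_neutral_cong_right)
        (use zero v z(1) finite_words[of "Suc t"] coeff_closed[OF w] coeff_closed in
          \<open>auto simp del: words.simps\<close>)
    also have "\<dots> = coeff v u \<oplus> s \<otimes> coeff z u"
      using vz cw s coeff_closed[OF v] coeff_closed[OF z(1)] by simp
    also have "\<dots> = \<zero>"
    proof (cases "\<exists>j a. v = j # q # a")
      case True
      then obtain j a where v': "v = j # q # a" by blast
      have sz': "s = \<ominus> \<one>" "z = parent q # q # a" using c q(2) v' by (auto simp: wq)
      have tl: "tl v = q # a" "hd (tl v) = q" using v' by simp_all
      \<comment> \<open>The main term \<open>tl v\<close> starts at \<open>q\<close>, so a
        correction of \<open>v\<close> starting at \<open>q\<close> would violate
        \<open>correction_Some\<close>. The only term to cancel is \<open>q # a\<close>, and the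
        main term of \<open>z\<close> with sign -1 does so.\<close>
      have "coeff v u = (if u = tl v then \<one> else \<zero>)"
      proof (cases "u = tl v \<or> coeff v u = \<zero>")
        case True
        then show ?thesis using coeff_tl[of v] by auto
      next
        case False
        then obtain s' where "correction v = Some (s', u)" using coeff_nonzero[of v u] by blast
        from correction_Some[OF v this] have "hd u = parent (hd v)" "hd (tl v) \<noteq> parent (hd v)" by blast+
        then show ?thesis using q(3) tl(2) by simp
      qed
      then have "coeff v u = (if u = q # a then \<one> else \<zero>)" unfolding tl(1) .
      then show ?thesis using zero_z[OF z(1,2)] by (auto simp: sz' r_neg)
    next
      case False
      then have qp: "q = parent (hd v)" and "\<exists>s' z'. correction v = Some (s', z') \<and> s = \<ominus> s' \<and> z = parent q # z'"
        using c q(2) by (auto simp: wq split: if_splits)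
      \<comment> \<open>Now the term to cancel is the correction \<open>z'\<close> of
        \<open>v\<close>. Putting \<open>parent q\<close> in front gives a word with main term
        \<open>z'\<close>, entered with the opposite sign.\<close>
      then obtain s' z' where c': "correction v = Some (s', z')" and sz': "s = \<ominus> s'" "z = parent q # z'" by blast
      have s': "s' \<in> carrier K" using correction_Some[OF v c'] by blast
      have "u \<noteq> tl v"
      proof
        assume "u = tl v"
        then have "v = hd v # q # tl (tl v)"
          using words_nonempty[OF v] words_nonempty[OF u] q(3) by (metis list.collapse)
        then show False using False by blast
      qed
      then have "coeff v u = (if u = z' then s' else \<zero>)" using c' by (simp add: coeff_def)
      then show ?thesis using zero_z[OF z(1,2)] s' by (auto simp: sz' r_neg)
    qed
    finally show ?thesis .
  qed
qed

end

section \<open>The resolution\<close>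

text \<open>Right multiplications are left linear, and an idempotent of degree 0 preserves the
  grading; the fixed points in coordinate \<open>b\<close> form the left ideal A
  \<open>\<epsilon> b\<close>.\<close>

lemma (in graded_ring) free_summand_idempotents:
  assumes \<epsilon>: "\<And>b. \<epsilon> b \<in> grade A 0" "\<And>b. \<epsilon> b \<otimes> \<epsilon> b = \<epsilon> b"
  shows "free_summand A B \<delta> (\<lambda>\<phi> b. \<phi> b \<otimes> \<epsilon> b)"
proof -
  let ?F = "free_graded_module A B \<delta>"
  have c [simp]: "\<epsilon> b \<in> carrier A" for b by (rule grade_closed[OF \<epsilon>(1)])
  have cl: "(\<lambda>b. \<phi> b \<otimes> \<epsilon> b) \<in> carrier ?F" if "\<phi> \<in> carrier ?F" for \<phi>
  proof -
    have "{b. \<phi> b \<otimes> \<epsilon> b \<noteq> \<zero>} \<subseteq> {b. \<phi> b \<noteq> \<zero>}" by auto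
    then show ?thesis using that unfolding free_graded_module_sel by (auto intro: finite_subset)
  qed
  have gr: "(\<lambda>b. \<phi> b \<otimes> \<epsilon> b) \<in> grade ?F n" if "\<phi> \<in> grade ?F n" for \<phi> n
  proof -
    have "\<phi> \<in> carrier ?F" and "\<phi> b \<in> grade A (n - \<delta> b)" for b
      using that by (auto simp: free_graded_module_sel(5))
    moreover from mult_grade[OF this(2) \<epsilon>(1)] have "\<phi> b \<otimes> \<epsilon> b \<in> grade A (n - \<delta> b)" for b by simp
    ultimately show ?thesis using cl by (simp add: free_graded_module_sel(5))
  qed
  show ?thesis
  proof (intro free_summand.intro free_summand_axioms.intro graded_ring_axioms)
    show "(\<lambda>\<phi> b. \<phi> b \<otimes> \<epsilon> b) \<in> graded_hom A ?F ?F"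
      unfolding graded_hom_def hom_def
      using cl gr by (auto simp: free_graded_module_sel(1,3,4) l_distr m_assoc fun_eq_iff)
    show "(\<lambda>b. (\<phi> b \<otimes> \<epsilon> b) \<otimes> \<epsilon> b) = (\<lambda>b. \<phi> b \<otimes> \<epsilon> b)" if "\<phi> \<in> carrier ?F" for \<phi>
      using that \<epsilon>(2) by (auto simp: free_graded_module_sel(1) m_assoc)
  qed
qed

text \<open>Right multiplication by e_i keeps exactly the basis elements with target
  \<open>i\<close>, so these span A e_i.\<close>

primrec target :: "'v zbasis \<Rightarrow> 'v" where
  "target (Vertex i) = i"
| "target (Arrow i j) = j"
| "target (Loop i) = i"

locale zigzag_coords = zigzag_words K G C r + A: graded_algebra K A
  for K :: "('k, 'd) ring_scheme" (structure) and G :: "'v pair_pre_digraph"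
    and C :: "'v set" and r :: 'v and A :: "('k, 'a) graded_module" +
  fixes cf :: "'a \<Rightarrow> 'v zbasis \<Rightarrow> 'k"
  assumes cf_epi: "graded_epi K A (Z C) cf" and cf_inj: "inj_on cf (carrier A)"
begin

section \<open>Computing in the algebra through its coordinates\<close>

lemmas cf_mem = graded_epiD(3)[OF cf_epi]

lemma cf_closed [simp]: "a \<in> carrier A \<Longrightarrow> cf a b \<in> carrier K"
  by (rule model_closed[OF cf_mem])

lemma cf_outside: "a \<in> carrier A \<Longrightarrow> b \<notin> zigzag_basis G C \<Longrightarrow> cf a b = \<zero>"
  by (rule model_outside[OF cf_mem])

lemma cf_eqI: "a \<in> carrier A \<Longrightarrow> a' \<in> carrier A \<Longrightarrow> (\<And>b. cf a b = cf a' b) \<Longrightarrow> a = a'"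
  using cf_inj by (meson ext inj_onD)

lemma cf_mult: "a \<in> carrier A \<Longrightarrow> b \<in> carrier A \<Longrightarrow> cf (a \<otimes>\<^bsub>A\<^esub> b) = zigzag_mult K G C (cf a) (cf b)"
  using graded_epiD(9)[OF cf_epi] by (simp add: model_sel(2))

lemma cf_add: "a \<in> carrier A \<Longrightarrow> b \<in> carrier A \<Longrightarrow> cf (a \<oplus>\<^bsub>A\<^esub> b) c = cf a c \<oplus> cf b c"
  using graded_epiD(8)[OF cf_epi] by (simp add: model_sel(5))

lemma cf_smult: "k \<in> carrier K \<Longrightarrow> a \<in> carrier A \<Longrightarrow> cf (k \<odot>\<^bsub>A\<^esub> a) c = k \<otimes> cf a c"
  using graded_epiD(5)[OF cf_epi] by (simp add: model_sel(6))

lemma cf_one: "cf \<one>\<^bsub>A\<^esub> c = (if c \<in> Vertex ` pverts G then \<one> else \<zero>)"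
  using graded_epiD(10)[OF cf_epi] by (simp add: model_sel(3))

lemma cf_hom: "cf \<in> hom (add_monoid A) (add_monoid (Z C))"
  using graded_epiD(3,8)[OF cf_epi] by (simp add: hom_def)

lemma cf_finsum:
  assumes "finite S" "\<And>s. s \<in> S \<Longrightarrow> a s \<in> carrier A"
  shows "cf (\<Oplus>\<^bsub>A\<^esub>s \<in> S. a s) b = (\<Oplus>s \<in> S. cf (a s) b)"
proof -
  have "cf (\<Oplus>\<^bsub>A\<^esub>s \<in> S. a s) = (\<Oplus>\<^bsub>Z C\<^esub>s \<in> S. cf (a s))"
    by (rule hom_add_finsum[OF A.abelian_group_axioms model_abelian_group cf_hom assms])
  then show ?thesis using model_finsum[OF assms(1), of "\<lambda>s. cf (a s)"] cf_mem[OF assms(2)] by simp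
qed

lemma cf_zero [simp]: "cf \<zero>\<^bsub>A\<^esub> b = \<zero>"
  using cf_finsum[of "{}"] by simp

lemma cf_eq_zeroI: "a \<in> carrier A \<Longrightarrow> (\<And>b. cf a b = \<zero>) \<Longrightarrow> a = \<zero>\<^bsub>A\<^esub>"
  by (rule cf_eqI) simp_all

definition el :: "('v zbasis \<Rightarrow> 'k) \<Rightarrow> 'a" where
  "el = inv_into (carrier A) cf"

lemma el: "g \<in> carrier (Z C) \<Longrightarrow> el g \<in> carrier A" "g \<in> carrier (Z C) \<Longrightarrow> cf (el g) = g"
  unfolding el_def using graded_epiD(2)[OF cf_epi] by (metis inv_into_into, metis f_inv_into_f)

lemma grade_iff: "a \<in> grade A n \<longleftrightarrow> a \<in> carrier A \<and> (\<forall>b. cf a b \<noteq> \<zero> \<longrightarrow> zdegree b = n)"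
proof
  assume a: "a \<in> grade A n"
  then have "cf a \<in> grade (Z C) n" using graded_epiD(7)[OF cf_epi] by blast
  then show "a \<in> carrier A \<and> (\<forall>b. cf a b \<noteq> \<zero> \<longrightarrow> zdegree b = n)"
    using A.grade_closed[OF a] by (simp add: model_sel(7))
next
  assume a: "a \<in> carrier A \<and> (\<forall>b. cf a b \<noteq> \<zero> \<longrightarrow> zdegree b = n)"
  then have "cf a \<in> grade (Z C) n" using cf_mem by (simp add: model_sel(7))
  then have "cf a \<in> cf ` grade A n" by (simp only: graded_epiD(7)[OF cf_epi])
  then obtain a' where a': "cf a = cf a'" "a' \<in> grade A n" by (rule imageE)
  have "a = a'" using a a'(1) A.grade_closed[OF a'(2)] by (intro inj_onD[OF cf_inj]) auto
  then show "a \<in> grade A n" using a'(2) by simp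
qed

definition idem :: "'v \<Rightarrow> 'a" where
  "idem i = el (zunit (Vertex i) \<one>)"

lemma idem_closed: "i \<in> pverts G \<Longrightarrow> idem i \<in> carrier A"
  and cf_idem: "i \<in> pverts G \<Longrightarrow> cf (idem i) = zunit (Vertex i) \<one>"
  unfolding idem_def by (auto intro!: el zunit_closed)

lemma idem_grade: "i \<in> pverts G \<Longrightarrow> idem i \<in> grade A 0"
  by (auto simp: grade_iff idem_closed cf_idem zunit_def)

lemma cf_mult_idem:
  assumes a: "a \<in> carrier A" and i: "i \<in> pverts G"
  shows "cf (a \<otimes>\<^bsub>A\<^esub> idem i) b = (if target b = i then cf a b else \<zero>)"
  using cf_outside[OF a, of b] a i
  by (cases b) (auto simp: cf_mult idem_closed cf_idem zigzag_mult_simps zunit_def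
      intro!: add.finprod_one_eqI)

lemma mult_idem_eq_iff:
  assumes "a \<in> carrier A" "i \<in> pverts G"
  shows "a \<otimes>\<^bsub>A\<^esub> idem i = a \<longleftrightarrow> (\<forall>b. target b \<noteq> i \<longrightarrow> cf a b = \<zero>)"
proof
  assume "a \<otimes>\<^bsub>A\<^esub> idem i = a"
  then show "\<forall>b. target b \<noteq> i \<longrightarrow> cf a b = \<zero>" using cf_mult_idem[OF assms] by metis
next
  assume "\<forall>b. target b \<noteq> i \<longrightarrow> cf a b = \<zero>"
  then show "a \<otimes>\<^bsub>A\<^esub> idem i = a"
    using assms by (intro cf_eqI) (auto simp: cf_mult_idem idem_closed)
qed

text \<open>\<open>koszul\<close> asks for modules of sequences, so words are numbered. Lists over
  the finite vertex set are countable, which provides an injective numbering of all words at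
  once.\<close>

definition enc :: "'v list \<Rightarrow> nat" where
  "enc = to_nat_on (lists (pverts G))"

definition dec :: "nat \<Rightarrow> 'v list" where
  "dec = from_nat_into (lists (pverts G))"

lemma dec_enc [simp]: "w \<in> words t \<Longrightarrow> dec (enc w) = w"
proof -
  have "countable (lists (pverts G))" using finite_verts by (intro countable_lists countable_finite)
  then show "w \<in> words t \<Longrightarrow> dec (enc w) = w"
    unfolding enc_def dec_def using words_verts by (intro from_nat_into_to_nat_on) (auto simp: in_lists_conv_set)
qed

lemma enc_inj: "inj_on enc (words t)"
  by (rule inj_on_inverseI[where g = dec]) simp

text \<open>The value 0 off the index set keeps this an idempotent of degree 0 at every
  \<open>n\<close>, as \<open>free_summand_idempotents\<close> demands.\<close>

definition vertex_idem :: "nat \<Rightarrow> nat \<Rightarrow> 'a" where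
  "vertex_idem t n = (if n \<in> enc ` words t then idem (hd (dec n)) else \<zero>\<^bsub>A\<^esub>)"

section \<open>The terms of the resolution and the differential\<close>

abbreviation FM :: "nat \<Rightarrow> ('a, nat \<Rightarrow> 'a) graded_module" where
  "FM t \<equiv> free_graded_module A (enc ` words t) (\<lambda>_. int t)"

text \<open>The direct sum of the modules A e_(hd w) over the words \<open>w\<close> in
  \<open>words t\<close>, with generators in degree \<open>t\<close>.\<close>

definition PM :: "nat \<Rightarrow> ('a, nat \<Rightarrow> 'a) graded_module" where
  "PM t = free_summand.summand A (enc ` words t) (\<lambda>_. int t) (\<lambda>\<phi> n. \<phi> n \<otimes>\<^bsub>A\<^esub> vertex_idem t n)"

lemma PM_summand: "free_summand A (enc ` words t) (\<lambda>_. int t) (\<lambda>\<phi> n. \<phi> n \<otimes>\<^bsub>A\<^esub> vertex_idem t n)"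
proof (rule A.free_summand_idempotents)
  fix n
  show "vertex_idem t n \<in> grade A 0"
    by (auto simp: vertex_idem_def A.zero_grade idem_grade words_hd)
  show "vertex_idem t n \<otimes>\<^bsub>A\<^esub> vertex_idem t n = vertex_idem t n"
    by (auto simp: vertex_idem_def mult_idem_eq_iff idem_closed words_hd cf_idem zunit_def)
qed

lemma PM_sel:
  "zero (PM t) = zero (FM t)" "add (PM t) = add (FM t)" "smult (PM t) = smult (FM t)"
  "grade (PM t) n = grade (FM t) n \<inter> carrier (PM t)" "carrier (PM t) \<subseteq> carrier (FM t)"
proof -
  interpret F: graded_left_module A "FM t" by (rule A.free_graded_left_module)
  note sel = free_summand.summand_sel[OF PM_summand[of t], folded PM_def]
  show "zero (PM t) = zero (FM t)" "add (PM t) = add (FM t)" "smult (PM t) = smult (FM t)"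
    by (rule sel)+
  show "grade (PM t) n = grade (FM t) n \<inter> carrier (PM t)" unfolding sel using F.M.grade_closed by blast
  show "carrier (PM t) \<subseteq> carrier (FM t)" unfolding sel by blast
qed

lemma PM_carrier:
  "\<phi> \<in> carrier (PM t) \<longleftrightarrow> (\<forall>n. \<phi> n \<in> carrier A) \<and> (\<forall>n. n \<notin> enc ` words t \<longrightarrow> \<phi> n = \<zero>\<^bsub>A\<^esub>) \<and>
     (\<forall>w \<in> words t. \<forall>b. target b \<noteq> hd w \<longrightarrow> cf (\<phi> (enc w)) b = \<zero>)"
proof -
  have F: "\<phi> \<in> carrier (FM t) \<longleftrightarrow> (\<forall>n. \<phi> n \<in> carrier A) \<and> (\<forall>n. n \<notin> enc ` words t \<longrightarrow> \<phi> n = \<zero>\<^bsub>A\<^esub>)"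
    using finite_words[of t] by (auto simp: A.free_graded_module_sel(1) intro: finite_subset[of _ "enc ` words t"])
  have eq: "\<phi> n \<otimes>\<^bsub>A\<^esub> vertex_idem t n = \<phi> n \<longleftrightarrow>
      (\<forall>w \<in> words t. n = enc w \<longrightarrow> (\<forall>b. target b \<noteq> hd w \<longrightarrow> cf (\<phi> (enc w)) b = \<zero>))"
    if \<phi>: "\<forall>n. \<phi> n \<in> carrier A" "\<forall>n. n \<notin> enc ` words t \<longrightarrow> \<phi> n = \<zero>\<^bsub>A\<^esub>" for n
  proof (cases "n \<in> enc ` words t")
    case True
    then obtain w where w: "w \<in> words t" "n = enc w" by blast
    have "w' = w" if "w' \<in> words t" "enc w = enc w'" for w'
      using inj_onD[OF enc_inj that(2) w(1) that(1)] by simp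
    then have "(\<forall>w' \<in> words t. n = enc w' \<longrightarrow> (\<forall>b. target b \<noteq> hd w' \<longrightarrow> cf (\<phi> (enc w')) b = \<zero>)) \<longleftrightarrow>
        (\<forall>b. target b \<noteq> hd w \<longrightarrow> cf (\<phi> (enc w)) b = \<zero>)"
      using w by metis
    moreover have "vertex_idem t n = idem (hd w)" using True w by (simp add: vertex_idem_def)
    ultimately show ?thesis using \<phi>(1) w(2) mult_idem_eq_iff[OF _ words_hd[OF w(1)]] by simp
  next
    case False
    then show ?thesis using \<phi> by (auto simp: vertex_idem_def)
  qed
  have "\<phi> \<in> carrier (PM t) \<longleftrightarrow> \<phi> \<in> carrier (FM t) \<and> (\<forall>n. \<phi> n \<otimes>\<^bsub>A\<^esub> vertex_idem t n = \<phi> n)"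
    unfolding PM_def free_summand.summand_sel(1)[OF PM_summand] by (auto simp: fun_eq_iff)
  then show ?thesis unfolding F using eq by blast
qed

lemma PM_closed: "\<phi> \<in> carrier (PM t) \<Longrightarrow> \<phi> n \<in> carrier A"
  by (simp add: PM_carrier)

lemma PM_eqI:
  assumes "\<phi> \<in> carrier (PM t)" "\<psi> \<in> carrier (PM t)"
    and "\<And>w b. w \<in> words t \<Longrightarrow> b \<in> zigzag_basis G C \<Longrightarrow> target b = hd w \<Longrightarrow>
      cf (\<phi> (enc w)) b = cf (\<psi> (enc w)) b"
  shows "\<phi> = \<psi>"
proof
  fix n
  show "\<phi> n = \<psi> n"
  proof (cases "n \<in> enc ` words t")
    case True
    then obtain w where w: "w \<in> words t" "n = enc w" by blast
    have "cf (\<phi> n) b = cf (\<psi> n) b" for b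
    proof (cases "b \<in> zigzag_basis G C \<and> target b = hd w")
      case False
      then show ?thesis using assms(1,2) w cf_outside[OF PM_closed[OF assms(1)]] cf_outside[OF PM_closed[OF assms(2)]]
        by (auto simp: PM_carrier)
    qed (use assms(3) w in auto)
    then show ?thesis by (rule cf_eqI[OF PM_closed[OF assms(1)] PM_closed[OF assms(2)]])
  qed (use assms(1,2) in \<open>auto simp: PM_carrier\<close>)
qed

definition PM_of :: "nat \<Rightarrow> ('v list \<Rightarrow> 'v zbasis \<Rightarrow> 'k) \<Rightarrow> nat \<Rightarrow> 'a" where
  "PM_of t Y n = (if n \<in> enc ` words t then el (Y (dec n)) else \<zero>\<^bsub>A\<^esub>)"

lemma PM_of:
  assumes "\<And>w. w \<in> words t \<Longrightarrow> Y w \<in> carrier (Z C)"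
    and "\<And>w b. w \<in> words t \<Longrightarrow> target b \<noteq> hd w \<Longrightarrow> Y w b = \<zero>"
  shows "PM_of t Y \<in> carrier (PM t)" and "w \<in> words t \<Longrightarrow> cf (PM_of t Y (enc w)) = Y w"
proof -
  show *: "w \<in> words t \<Longrightarrow> cf (PM_of t Y (enc w)) = Y w" for w
    using assms(1) by (simp add: PM_of_def el)
  show "PM_of t Y \<in> carrier (PM t)"
    unfolding PM_carrier using assms by (auto simp: * ) (auto simp: PM_of_def el)
qed

text \<open>If \<open>hd w\<close> and \<open>hd u\<close> are not adjacent, then
  \<open>Arrow (hd w) (hd u)\<close> is no basis element, but by \<open>coeff_arc\<close> the
  coefficient is 0 as well.\<close>

definition dcoeff :: "'v list \<Rightarrow> 'v list \<Rightarrow> 'v zbasis \<Rightarrow> 'k" where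
  "dcoeff w u = zunit (Arrow (hd w) (hd u)) (coeff w u)"

lemma dcoeff_closed:
  assumes "w \<in> words (Suc t)"
  shows "dcoeff w u \<in> carrier (Z C)"
proof (cases "coeff w u = \<zero>")
  case True
  then show ?thesis by (simp add: dcoeff_def zunit_def model_sel)
next
  case False
  from coeff_arc[OF assms this] coeff_closed[OF assms] show ?thesis
    unfolding dcoeff_def by (intro zunit_closed) auto
qed

definition dmat :: "nat \<Rightarrow> nat \<Rightarrow> nat \<Rightarrow> 'a" where
  "dmat t m = (if m \<in> enc ` words (Suc t) then PM_of t (dcoeff (dec m)) else (\<lambda>n. \<zero>\<^bsub>A\<^esub>))"

lemma dmat_PM:
  assumes "w \<in> words (Suc t)"
  shows "dmat t (enc w) \<in> carrier (PM t)"
    and "u \<in> words t \<Longrightarrow> cf (dmat t (enc w) (enc u)) = dcoeff w u"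
proof -
  have "dmat t (enc w) = PM_of t (dcoeff w)" using assms by (simp add: dmat_def del: words.simps)
  moreover have "dcoeff w u b = \<zero>" if "target b \<noteq> hd u" for u b
    using that by (auto simp: dcoeff_def zunit_def)
  ultimately show "dmat t (enc w) \<in> carrier (PM t)"
    "u \<in> words t \<Longrightarrow> cf (dmat t (enc w) (enc u)) = dcoeff w u"
    using PM_of[of t "dcoeff w"] dcoeff_closed[OF assms] by simp_all
qed

text \<open>An arrow has degree 1 and the generators of \<open>PM t\<close> have degree
  \<open>t\<close>, so a generator of degree \<open>t + 1\<close> is sent to the same
  degree.\<close>

lemma dmat_grade:
  assumes "w \<in> words (Suc t)"
  shows "dmat t (enc w) \<in> grade (PM t) (int (Suc t))"
proof -
  have "dmat t (enc w) n \<in> grade A 1" for n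
  proof (cases "n \<in> enc ` words t")
    case True
    then obtain u where u: "u \<in> words t" "n = enc u" by blast
    show ?thesis using PM_closed[OF dmat_PM(1)[OF assms]]
      by (auto simp: grade_iff u(2) dmat_PM(2)[OF assms u(1)] dcoeff_def zunit_def split: if_splits)
  next
    case False
    then have "dmat t (enc w) n = \<zero>\<^bsub>A\<^esub>" using dmat_PM(1)[OF assms] by (simp add: PM_carrier)
    then show ?thesis by (simp add: A.zero_grade)
  qed
  then show ?thesis using dmat_PM(1)[OF assms] PM_sel(5)[of t]
    by (auto simp: PM_sel(4) A.free_graded_module_sel(5))
qed

definition diff :: "nat \<Rightarrow> (nat \<Rightarrow> 'a) \<Rightarrow> nat \<Rightarrow> 'a" where
  "diff t = free_extension A (PM t) (dmat t)"

lemma PM_module: "graded_left_module A (PM t)"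
  unfolding PM_def by (rule free_summand.graded_summand[OF PM_summand])

lemma diff_FM_hom: "diff t \<in> graded_hom A (FM (Suc t)) (PM t)"
  unfolding diff_def
  by (rule graded_left_module.free_extension_hom[OF PM_module])
    (use dmat_grade in \<open>auto simp del: words.simps\<close>)

lemma diff_hom: "diff t \<in> graded_hom A (PM (Suc t)) (PM t)"
proof -
  have "PM (Suc t) = sub_module (FM (Suc t)) (carrier (PM (Suc t)))"
    unfolding PM_def free_summand.summand_def[OF PM_summand] by simp
  then show ?thesis using graded_hom_restrict[OF diff_FM_hom PM_sel(5)] by metis
qed

lemma cf_diff:
  assumes \<phi>: "\<phi> \<in> carrier (PM (Suc t))" and u: "u \<in> words t"
  shows "cf (diff t \<phi> (enc u)) b =
    (\<Oplus>w \<in> words (Suc t). zigzag_mult K G C (cf (\<phi> (enc w))) (dcoeff w u) b)"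
proof -
  interpret P: graded_left_module A "PM t" by (rule PM_module)
  interpret F: graded_left_module A "FM t" by (rule A.free_graded_left_module)
  have fin: "finite (enc ` words (Suc t))" using finite_words[of "Suc t"] by blast
  have sub: "{n. \<phi> n \<noteq> \<zero>\<^bsub>A\<^esub>} \<subseteq> enc ` words (Suc t)" using \<phi> unfolding PM_carrier by blast
  have \<phi>c: "\<phi> n \<in> carrier A" for n by (rule PM_closed[OF \<phi>])
  have mc: "dmat t n \<in> carrier (PM t)" if "n \<in> enc ` words (Suc t)" for n
    using that dmat_PM(1) by blast
  have id: "(\<lambda>x. x) \<in> hom (add_monoid (PM t)) (add_monoid (FM t))"
    using PM_sel(5)[of t] by (auto simp: hom_def PM_sel(2))
  have sc: "\<phi> n \<odot>\<^bsub>PM t\<^esub> dmat t n \<in> carrier (PM t)" if "n \<in> enc ` words (Suc t)" for n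
    by (rule P.smult_closed[OF \<phi>c mc[OF that]])
  have "diff t \<phi> = (\<Oplus>\<^bsub>PM t\<^esub>n \<in> enc ` words (Suc t). \<phi> n \<odot>\<^bsub>PM t\<^esub> dmat t n)"
    unfolding diff_def
    by (rule P.free_extension_superset[OF subsetD[OF PM_sel(5) \<phi>] mc fin subset_refl sub])
  \<comment> \<open>The inclusion into the free module is additive, and in the free module sums are
    evaluated pointwise.\<close>
  also have "\<dots> = (\<Oplus>\<^bsub>FM t\<^esub>n \<in> enc ` words (Suc t). \<phi> n \<odot>\<^bsub>PM t\<^esub> dmat t n)"
    by (rule hom_add_finsum[OF P.M.abelian_group_axioms F.M.abelian_group_axioms id fin sc])
  finally have "diff t \<phi> (enc u) = (\<Oplus>\<^bsub>A\<^esub>n \<in> enc ` words (Suc t). (\<phi> n \<odot>\<^bsub>PM t\<^esub> dmat t n) (enc u))"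
    using A.free_finsum[OF fin subsetD[OF PM_sel(5) sc]] by simp
  also have "\<dots> = (\<Oplus>\<^bsub>A\<^esub>n \<in> enc ` words (Suc t). \<phi> n \<otimes>\<^bsub>A\<^esub> dmat t n (enc u))"
    by (simp add: PM_sel(3) A.free_graded_module_sel(4))
  finally have "cf (diff t \<phi> (enc u)) b =
      (\<Oplus>n \<in> enc ` words (Suc t). cf (\<phi> n \<otimes>\<^bsub>A\<^esub> dmat t n (enc u)) b)"
    using cf_finsum[OF fin, of "\<lambda>n. \<phi> n \<otimes>\<^bsub>A\<^esub> dmat t n (enc u)" b] \<phi>c PM_closed[OF mc] by simp
  also have "\<dots> = (\<Oplus>w \<in> words (Suc t). cf (\<phi> (enc w) \<otimes>\<^bsub>A\<^esub> dmat t (enc w) (enc u)) b)"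
    by (rule finsum_reindex[OF _ enc_inj]) (use \<phi>c PM_closed[OF mc] in auto)
  also have "\<dots> = (\<Oplus>w \<in> words (Suc t). zigzag_mult K G C (cf (\<phi> (enc w))) (dcoeff w u) b)"
  proof (rule finsum_cong'[OF refl])
    fix w assume w: "w \<in> words (Suc t)"
    then have "dmat t (enc w) (enc u) \<in> carrier A" using PM_closed[OF dmat_PM(1)] by blast
    then show "cf (\<phi> (enc w) \<otimes>\<^bsub>A\<^esub> dmat t (enc w) (enc u)) b =
        zigzag_mult K G C (cf (\<phi> (enc w))) (dcoeff w u) b"
      using cf_mult[OF \<phi>c] dmat_PM(2)[OF w u] by simp
  qed (use model_closed[OF model_mult_closed[OF cf_mem[OF \<phi>c] dcoeff_closed]] in blast)
  finally show ?thesis .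
qed

text \<open>Multiplication by arrows raises the degree by one: vertex coordinates become arrow
  coordinates, arrow coordinates become loop coordinates, and loop coordinates are lost. At a loop,
  the arrow back from \<open>hd w\<close> leaves one term of the neighbour sum.\<close>

lemma cf_diff_simps:
  assumes \<phi>: "\<phi> \<in> carrier (PM (Suc t))" and u: "u \<in> words t"
  shows "cf (diff t \<phi> (enc u)) (Vertex i) = \<zero>"
    and "cf (diff t \<phi> (enc u)) (Arrow k (hd u)) =
      (\<Oplus>w \<in> words (Suc t). if hd w = k then cf (\<phi> (enc w)) (Vertex k) \<otimes> coeff w u else \<zero>)"
    and "hd u \<notin> C \<Longrightarrow> cf (diff t \<phi> (enc u)) (Loop (hd u)) =
      (\<Oplus>w \<in> words (Suc t). cf (\<phi> (enc w)) (Arrow (hd u) (hd w)) \<otimes> coeff w u)"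
proof -
  note [simp] = PM_closed[OF \<phi>]
  show "cf (diff t \<phi> (enc u)) (Vertex i) = \<zero>"
    unfolding cf_diff[OF assms] zigzag_mult_simps
    by (rule add.finprod_one_eqI) (simp add: dcoeff_def zunit_def)
  show "cf (diff t \<phi> (enc u)) (Arrow k (hd u)) =
      (\<Oplus>w \<in> words (Suc t). if hd w = k then cf (\<phi> (enc w)) (Vertex k) \<otimes> coeff w u else \<zero>)"
    unfolding cf_diff[OF assms] zigzag_mult_simps
    by (rule finsum_cong') (auto simp: dcoeff_def zunit_def coeff_closed simp del: words.simps)
  show "cf (diff t \<phi> (enc u)) (Loop (hd u)) =
      (\<Oplus>w \<in> words (Suc t). cf (\<phi> (enc w)) (Arrow (hd u) (hd w)) \<otimes> coeff w u)" if C: "hd u \<notin> C"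
    unfolding cf_diff[OF assms]
  proof (rule finsum_cong'[OF refl])
    fix w assume w: "w \<in> words (Suc t)"
    let ?i = "hd u"
    have i: "?i \<in> pverts G \<and> ?i \<notin> C" using words_hd[OF u] C by simp
    have "(\<Oplus>j \<in> {j. (?i, j) \<in> parcs G}. cf (\<phi> (enc w)) (Arrow ?i j) \<otimes> dcoeff w u (Arrow j ?i)) =
        cf (\<phi> (enc w)) (Arrow ?i (hd w)) \<otimes> coeff w u"
    proof (cases "(?i, hd w) \<in> parcs G")
      case True
      have "(\<Oplus>j \<in> {j. (?i, j) \<in> parcs G}. cf (\<phi> (enc w)) (Arrow ?i j) \<otimes> dcoeff w u (Arrow j ?i)) =
          cf (\<phi> (enc w)) (Arrow ?i (hd w)) \<otimes> dcoeff w u (Arrow (hd w) ?i)"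
        by (rule finsum_eq_single[OF finite_nbrs]) (use True coeff_closed[OF w] in \<open>auto simp: dcoeff_def zunit_def\<close>)
      then show ?thesis by (simp add: dcoeff_def zunit_def)
    next
      case False
      then have "coeff w u = \<zero>" using coeff_arc[OF w] arc_sym by blast
      then show ?thesis by (auto simp: dcoeff_def zunit_def intro!: add.finprod_one_eqI)
    qed
    then show "zigzag_mult K G C (cf (\<phi> (enc w))) (dcoeff w u) (Loop ?i) =
        cf (\<phi> (enc w)) (Arrow ?i (hd w)) \<otimes> coeff w u"
      using i coeff_closed[OF w] by (simp add: zigzag_mult_simps dcoeff_def zunit_def)
  qed (use coeff_closed in \<open>auto simp del: words.simps\<close>)
qed


section \<open>The complex and its exactness\<close>

lemma PM_add: "\<phi> \<oplus>\<^bsub>PM t\<^esub> \<psi> = (\<lambda>n. \<phi> n \<oplus>\<^bsub>A\<^esub> \<psi> n)"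
  by (simp add: PM_sel(2) A.free_graded_module_sel)

lemma PM_zero: "\<zero>\<^bsub>PM t\<^esub> = (\<lambda>n. \<zero>\<^bsub>A\<^esub>)"
  by (simp add: PM_sel(1) A.free_graded_module_sel)

lemma diff_mem: "\<phi> \<in> carrier (PM (Suc t)) \<Longrightarrow> diff t \<phi> \<in> carrier (PM t)"
  by (rule graded_homD(2)[OF diff_hom])

lemma zero_PM_eqI:
  assumes "\<phi> \<in> carrier (PM t)"
    and "\<And>w i. w \<in> words t \<Longrightarrow> cf (\<phi> (enc w)) (Vertex i) = \<zero>"
    and "\<And>w k. w \<in> words t \<Longrightarrow> (k, hd w) \<in> parcs G \<Longrightarrow> cf (\<phi> (enc w)) (Arrow k (hd w)) = \<zero>"
    and "\<And>w. w \<in> words t \<Longrightarrow> hd w \<notin> C \<Longrightarrow> cf (\<phi> (enc w)) (Loop (hd w)) = \<zero>"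
  shows "\<phi> = \<zero>\<^bsub>PM t\<^esub>"
proof (rule PM_eqI[OF assms(1)])
  interpret P: graded_left_module A "PM t" by (rule PM_module)
  show "\<zero>\<^bsub>PM t\<^esub> \<in> carrier (PM t)" by (rule P.M.zero_closed)
  show "cf (\<phi> (enc w)) b = cf (\<zero>\<^bsub>PM t\<^esub> (enc w)) b"
    if "w \<in> words t" "b \<in> zigzag_basis G C" "target b = hd w" for w b
    using that assms(2-4) by (cases b) (auto simp: PM_zero)
qed

text \<open>A composite of two arrows only has loop coordinates, and only if it returns to its
  start, that is for \<open>hd w = hd u\<close>. The coordinate is then the sum in
  \<open>coeff_square\<close>.\<close>

lemma diff_diff_unit:
  assumes w: "w \<in> words (Suc (Suc t))"
  shows "diff t (dmat (Suc t) (enc w)) = \<zero>\<^bsub>PM t\<^esub>"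
proof (rule zero_PM_eqI)
  note m = dmat_PM(1)[OF w]
  show "diff t (dmat (Suc t) (enc w)) \<in> carrier (PM t)" by (rule diff_mem[OF m])
  fix u assume u: "u \<in> words t"
  show "cf (diff t (dmat (Suc t) (enc w)) (enc u)) (Vertex i) = \<zero>" for i
    by (rule cf_diff_simps(1)[OF m u])
  show "cf (diff t (dmat (Suc t) (enc w)) (enc u)) (Arrow k (hd u)) = \<zero>" for k
    unfolding cf_diff_simps(2)[OF m u]
  proof (rule add.finprod_one_eqI)
    fix v assume v: "v \<in> words (Suc t)"
    show "(if hd v = k then cf (dmat (Suc t) (enc w) (enc v)) (Vertex k) \<otimes> coeff v u else \<zero>) = \<zero>"
      using coeff_closed[OF v] by (simp add: dmat_PM(2)[OF w v] dcoeff_def zunit_def)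
  qed
  show "cf (diff t (dmat (Suc t) (enc w)) (enc u)) (Loop (hd u)) = \<zero>" if C: "hd u \<notin> C"
  proof -
    have "(\<Oplus>v \<in> words (Suc t). cf (dmat (Suc t) (enc w) (enc v)) (Arrow (hd u) (hd v)) \<otimes> coeff v u) =
        (\<Oplus>v \<in> words (Suc t). if hd w = hd u then coeff w v \<otimes> coeff v u else \<zero>)"
    proof (rule finsum_cong'[OF refl])
      fix v assume v: "v \<in> words (Suc t)"
      show "cf (dmat (Suc t) (enc w) (enc v)) (Arrow (hd u) (hd v)) \<otimes> coeff v u =
          (if hd w = hd u then coeff w v \<otimes> coeff v u else \<zero>)"
        using coeff_closed[OF v] by (simp add: dmat_PM(2)[OF w v] dcoeff_def zunit_def)
    qed (use coeff_closed[OF w] coeff_closed in \<open>auto simp del: words.simps\<close>)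
    also have "\<dots> = \<zero>"
      using coeff_square[OF w u _ C] by (cases "hd w = hd u") simp_all
    finally show ?thesis unfolding cf_diff_simps(3)[OF m u C] .
  qed
qed

lemma diff_diff:
  assumes \<phi>: "\<phi> \<in> carrier (PM (Suc (Suc t)))"
  shows "diff t (diff (Suc t) \<phi>) = \<zero>\<^bsub>PM t\<^esub>"
proof -
  interpret P: graded_left_module A "PM t" by (rule PM_module)
  have sub: "n \<in> enc ` words (Suc (Suc t))" if "\<phi> n \<noteq> \<zero>\<^bsub>A\<^esub>" for n
    using \<phi> that unfolding PM_carrier by blast
  have "diff t (diff (Suc t) \<phi>) = free_extension A (PM t) (\<lambda>n. diff t (dmat (Suc t) n)) \<phi>"
    unfolding diff_def[of "Suc t"]
    by (rule graded_hom_free_extension[OF PM_module PM_module diff_hom subsetD[OF PM_sel(5) \<phi>]])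
      (use dmat_PM(1) in blast)
  also have "\<dots> = \<zero>\<^bsub>PM t\<^esub>"
    unfolding free_extension_def
  proof (rule P.M.add.finprod_one_eqI)
    fix n assume "n \<in> {n. \<phi> n \<noteq> \<zero>\<^bsub>A\<^esub>}"
    then obtain w where "w \<in> words (Suc (Suc t))" "n = enc w" using sub by blast
    then show "\<phi> n \<odot>\<^bsub>PM t\<^esub> diff t (dmat (Suc t) n) = \<zero>\<^bsub>PM t\<^esub>"
      using diff_diff_unit P.smult_zero_right[OF PM_closed[OF \<phi>]] by simp
  qed
  finally show ?thesis .
qed

text \<open>
  In the coordinate of \<open>diff t \<phi>\<close> that contains the vertex coordinate of \<open>\<phi>\<close> at \<open>w\<close>, further
  contributions come from words with a correction, and such words \<open>v\<close> satisfy
  \<open>hd (tl v) \<noteq> parent (hd v)\<close>.  So the words with this property are treated first.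
\<close>

lemma cycle_vertex_zero:
  assumes \<phi>: "\<phi> \<in> carrier (PM (Suc t))" and cyc: "diff t \<phi> = \<zero>\<^bsub>PM t\<^esub>" and w: "w \<in> words (Suc t)"
  shows "cf (\<phi> (enc w)) (Vertex i) = \<zero>"
proof -
  note [simp] = PM_closed[OF \<phi>]
  let ?x = "\<lambda>w. cf (\<phi> (enc w)) (Vertex (hd w))"
  have step: "?x w = \<zero>"
    if w: "w \<in> words (Suc t)"
      and other: "\<And>v. v \<in> words (Suc t) \<Longrightarrow> hd v = hd w \<Longrightarrow> v \<noteq> w \<Longrightarrow> ?x v \<otimes> coeff v (tl w) = \<zero>" for w
  proof -
    have u: "tl w \<in> words t" by (rule words_tl[OF w])
    have "(\<Oplus>v \<in> words (Suc t). if hd v = hd w then cf (\<phi> (enc v)) (Vertex (hd w)) \<otimes> coeff v (tl w) else \<zero>) =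
        (if hd w = hd w then cf (\<phi> (enc w)) (Vertex (hd w)) \<otimes> coeff w (tl w) else \<zero>)"
      by (rule finsum_eq_single[OF finite_words w])
        (use coeff_closed[OF w] other in \<open>auto simp del: words.simps\<close>)
    moreover have "cf (diff t \<phi> (enc (tl w))) (Arrow (hd w) (hd (tl w))) = \<zero>"
      by (simp add: cyc PM_zero)
    ultimately show ?thesis unfolding cf_diff_simps(2)[OF \<phi> u] by (simp add: coeff_tl)
  qed
  have other: "?x v \<otimes> coeff v (tl w) = \<zero>"
    if w: "w \<in> words (Suc t)" and v: "v \<in> words (Suc t)" "hd v = hd w" "v \<noteq> w"
      and nc: "\<And>s. correction v = Some (s, tl w) \<Longrightarrow> ?x v = \<zero>" for v w
  proof (cases "coeff v (tl w) = \<zero>")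
    case False
    \<comment> \<open>Different words with the same head have different tails, so only the
      correction of \<open>v\<close> can reach \<open>tl w\<close>.\<close>
    have "tl w \<noteq> tl v"
      using v(2,3) words_nonempty[OF v(1)] words_nonempty[OF w] by (metis list.expand)
    then obtain s where "correction v = Some (s, tl w)" using False coeff_nonzero by blast
    then show ?thesis using nc coeff_closed[OF v(1)] by simp
  qed simp
  have first: "?x w = \<zero>" if w: "w \<in> words (Suc t)" "hd (tl w) \<noteq> parent (hd w)" for w
  proof (rule step[OF w(1)], rule other[OF w(1)])
    fix v s assume v: "v \<in> words (Suc t)" "hd v = hd w" "correction v = Some (s, tl w)"
    from correction_Some[OF v(1,3)] v(2) w(2) show "?x v = \<zero>" by simp
  qed
  have "?x w = \<zero>" if w: "w \<in> words (Suc t)" for w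
  proof (rule step[OF w], rule other[OF w])
    fix v s assume v: "v \<in> words (Suc t)" "hd v = hd w" "correction v = Some (s, tl w)"
    from correction_Some[OF v(1,3)] show "?x v = \<zero>" by (intro first[OF v(1)]) blast
  qed
  then show ?thesis using w \<phi> by (cases "i = hd w") (auto simp: PM_carrier simp del: words.simps)
qed

text \<open>The candidate preimage of an element without vertex coordinates. A coordinate at the
  arrow from k to \<open>hd v\<close> is produced by e_k on the word \<open>k # v\<close>. A loop at
  \<open>hd v\<close> is produced by the arrow to its parent p on the word p followed by
  \<open>v\<close>, because x_i is the path from i to its parent and back.\<close>

definition lift_coords :: "(nat \<Rightarrow> 'a) \<Rightarrow> 'v list \<Rightarrow> 'v zbasis \<Rightarrow> 'k" where
  "lift_coords \<phi> w b = (
     if b = Vertex (hd w) then cf (\<phi> (enc (tl w))) (Arrow (hd w) (hd (tl w)))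
     else if hd (tl w) \<notin> C \<and> hd w = parent (hd (tl w)) \<and> b = Arrow (hd (tl w)) (hd w)
       then cf (\<phi> (enc (tl w))) (Loop (hd (tl w)))
     else \<zero>)"

lemma lift_coords:
  assumes \<phi>: "\<phi> \<in> carrier (PM t)"
  shows "PM_of (Suc t) (lift_coords \<phi>) \<in> carrier (PM (Suc t))"
    and "w \<in> words (Suc t) \<Longrightarrow> cf (PM_of (Suc t) (lift_coords \<phi>) (enc w)) = lift_coords \<phi> w"
proof -
  have mem: "lift_coords \<phi> w \<in> carrier (Z C)" if w: "w \<in> words (Suc t)" for w
  proof -
    have "lift_coords \<phi> w b \<in> carrier K" for b using PM_closed[OF \<phi>] by (simp add: lift_coords_def)
    moreover have "lift_coords \<phi> w b = \<zero>" if "b \<notin> zigzag_basis G C" for b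
      using that words_hd[OF w] arc_sym[OF words_arc[OF w]] by (auto simp: lift_coords_def)
    ultimately show ?thesis by (simp add: model_sel)
  qed
  have tgt: "lift_coords \<phi> w b = \<zero>" if "target b \<noteq> hd w" for w b
    using that by (auto simp: lift_coords_def)
  show "PM_of (Suc t) (lift_coords \<phi>) \<in> carrier (PM (Suc t))"
    by (rule PM_of(1)[OF mem tgt])
  show "w \<in> words (Suc t) \<Longrightarrow> cf (PM_of (Suc t) (lift_coords \<phi>) (enc w)) = lift_coords \<phi> w"
    by (rule PM_of(2)[OF mem tgt])
qed

text \<open>
  Modulo boundaries, a vertex-free element has only coordinates at arrows \<open>k \<rightarrow> hd w\<close> for which
  \<open>k # w\<close> is not a word.  Such a coordinate reappears as the loop coordinate of the differential
  at \<open>tl w\<close>, hence it vanishes for cycles.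
\<close>

lemma vertex_free_lift:
  assumes \<phi>: "\<phi> \<in> carrier (PM t)"
    and v0: "\<And>w i. w \<in> words t \<Longrightarrow> cf (\<phi> (enc w)) (Vertex i) = \<zero>"
  obtains \<psi> \<chi> where "\<psi> \<in> carrier (PM (Suc t))" "\<chi> \<in> carrier (PM t)" "\<phi> = \<chi> \<oplus>\<^bsub>PM t\<^esub> diff t \<psi>"
    "\<And>w b. w \<in> words t \<Longrightarrow> cf (\<chi> (enc w)) b \<noteq> \<zero> \<Longrightarrow> \<exists>k. b = Arrow k (hd w) \<and> bad k w"
proof -
  interpret P: graded_left_module A "PM t" by (rule PM_module)
  define \<psi> where "\<psi> = PM_of (Suc t) (lift_coords \<phi>)"
  have \<psi>: "\<psi> \<in> carrier (PM (Suc t))" and cf\<psi>: "\<And>w. w \<in> words (Suc t) \<Longrightarrow> cf (\<psi> (enc w)) = lift_coords \<phi> w"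
    unfolding \<psi>_def using lift_coords[OF \<phi>] by blast+
  note d\<psi> = diff_mem[OF \<psi>]
  define \<chi> where "\<chi> = \<phi> \<ominus>\<^bsub>PM t\<^esub> diff t \<psi>"
  have \<chi>: "\<chi> \<in> carrier (PM t)" unfolding \<chi>_def using \<phi> d\<psi> by simp
  have eq: "\<phi> = \<chi> \<oplus>\<^bsub>PM t\<^esub> diff t \<psi>"
    unfolding \<chi>_def using \<phi> d\<psi> by (simp add: P.M.minus_eq P.M.a_assoc P.M.l_neg)
  note [simp] = PM_closed[OF \<phi>] PM_closed[OF \<chi>] PM_closed[OF d\<psi>] PM_closed[OF \<psi>]
  have sum: "cf (\<phi> n) b = cf (\<chi> n) b \<oplus> cf (diff t \<psi> n) b" for n b
    using PM_add eq cf_add[of "\<chi> n" "diff t \<psi> n" b] by simp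
  have \<chi>0: "cf (\<chi> n) b = \<zero>" if "cf (diff t \<psi> n) b = cf (\<phi> n) b" for n b
    using sum[of n b] that add.r_cancel_one[of "cf (\<phi> n) b" "cf (\<chi> n) b"] by simp
  have "\<exists>k. b = Arrow k (hd w) \<and> bad k w" if w: "w \<in> words t" and nz: "cf (\<chi> (enc w)) b \<noteq> \<zero>" for w b
  proof -
    have basis: "b \<in> zigzag_basis G C" using nz cf_outside[of "\<chi> (enc w)" b] by auto
    have tgt: "target b = hd w" using nz \<chi> w by (auto simp: PM_carrier)
    show ?thesis
    proof (cases b)
      case (Vertex i)
      then show ?thesis using nz \<chi>0[of "enc w" b] v0[OF w] cf_diff_simps(1)[OF \<psi> w] by simp
    next
      case (Arrow k l)
      then have b: "b = Arrow k (hd w)" "(k, hd w) \<in> parcs G" using tgt basis by auto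
      have "bad k w"
      proof (rule ccontr)
        assume nb: "\<not> bad k w"
        then have kw: "k # w \<in> words (Suc t)" using w b(2) by auto
        have "cf (diff t \<psi> (enc w)) b =
            (\<Oplus>v \<in> words (Suc t). if hd v = k then cf (\<psi> (enc v)) (Vertex k) \<otimes> coeff v w else \<zero>)"
          unfolding b(1) by (rule cf_diff_simps(2)[OF \<psi> w])
        also have "\<dots> = (if hd (k # w) = k then cf (\<psi> (enc (k # w))) (Vertex k) \<otimes> coeff (k # w) w else \<zero>)"
        proof (rule finsum_eq_single[OF finite_words kw])
          show "(if hd (k # w) = k then cf (\<psi> (enc (k # w))) (Vertex k) \<otimes> coeff (k # w) w else \<zero>) \<in> carrier K"
            using coeff_closed[OF kw] by simp
          fix v assume v: "v \<in> words (Suc t)" "v \<noteq> k # w"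
          \<comment> \<open>A correction of a word with head \<open>k\<close> only reaches words
            that are bad for \<open>k\<close>, so nothing but \<open>k # w\<close>
            contributes.\<close>
          have "coeff v w = \<zero>" if hv: "hd v = k"
          proof (rule ccontr)
            assume "coeff v w \<noteq> \<zero>"
            moreover have "w \<noteq> tl v" using v hv words_nonempty[OF v(1)] by (metis list.collapse)
            ultimately obtain s where "correction v = Some (s, w)" using coeff_nonzero by blast
            from correction_Some[OF v(1) this] have "bad (hd v) w" by blast
            then show False using nb hv by simp
          qed
          then show "(if hd v = k then cf (\<psi> (enc v)) (Vertex k) \<otimes> coeff v w else \<zero>) = \<zero>" by simp
        qed
        also have "\<dots> = cf (\<phi> (enc w)) b"
          using coeff_tl[of "k # w"] by (simp add: cf\<psi>[OF kw] lift_coords_def b(1))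
        finally show False using \<chi>0 nz by blast
      qed
      then show ?thesis using b(1) by blast
    next
      case (Loop i)
      then have b: "b = Loop (hd w)" "hd w \<notin> C" using tgt basis by auto
      let ?p = "parent (hd w)"
      have pw: "?p # w \<in> words (Suc t)" by (rule words_parent_Cons[OF w b(2)])
      have "cf (diff t \<psi> (enc w)) b =
          (\<Oplus>v \<in> words (Suc t). cf (\<psi> (enc v)) (Arrow (hd w) (hd v)) \<otimes> coeff v w)"
        unfolding b(1) by (rule cf_diff_simps(3)[OF \<psi> w b(2)])
      also have "\<dots> = cf (\<psi> (enc (?p # w))) (Arrow (hd w) (hd (?p # w))) \<otimes> coeff (?p # w) w"
      proof (rule finsum_eq_single[OF finite_words pw])
        show "cf (\<psi> (enc (?p # w))) (Arrow (hd w) (hd (?p # w))) \<otimes> coeff (?p # w) w \<in> carrier K"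
          using coeff_closed[OF pw] by simp
        fix v assume v: "v \<in> words (Suc t)" "v \<noteq> ?p # w"
        show "cf (\<psi> (enc v)) (Arrow (hd w) (hd v)) \<otimes> coeff v w = \<zero>"
        proof (cases "lift_coords \<phi> v (Arrow (hd w) (hd v)) = \<zero>")
          case True
          then show ?thesis using coeff_closed[OF v(1)] by (simp add: cf\<psi>[OF v(1)])
        next
          case False
          then have hv: "hd (tl v) = hd w" "hd v = ?p" by (auto simp: lift_coords_def split: if_splits)
          \<comment> \<open>Such a \<open>v\<close> starts at \<open>?p\<close>, so a correction of
            \<open>v\<close> equal to \<open>w\<close> would start at \<open>parent ?p\<close>; that
            would make \<open>hd w\<close> and \<open>?p\<close> a two-cycle.\<close>
          have "coeff v w = \<zero>"
          proof (rule ccontr)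
            assume "coeff v w \<noteq> \<zero>"
            moreover have "w \<noteq> tl v" using v hv words_nonempty[OF v(1)] by (metis list.collapse)
            ultimately obtain s where "correction v = Some (s, w)" using coeff_nonzero by blast
            from correction_Some[OF v(1) this] hv have "?p \<notin> C" "parent ?p = hd w" by auto
            then show False using parent_parent[OF words_hd[OF w] b(2)] by blast
          qed
          then show ?thesis by simp
        qed
      qed
      also have "\<dots> = cf (\<phi> (enc w)) b"
        using coeff_tl[of "?p # w"] b by (simp add: cf\<psi>[OF pw] lift_coords_def)
      finally show ?thesis using \<chi>0 nz by blast
    qed
  qed
  then show ?thesis using that[OF \<psi> \<chi> eq] by blast
qed

text \<open>A bad word has at least two letters, so for the single word \<open>[r]\<close> the
  remainder in \<open>vertex_free_lift\<close> is 0.\<close>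

lemma exact_zero:
  assumes \<phi>: "\<phi> \<in> carrier (PM 0)" and v0: "cf (\<phi> (enc [r])) (Vertex r) = \<zero>"
  shows "\<phi> \<in> diff 0 ` carrier (PM (Suc 0))"
proof -
  interpret P: graded_left_module A "PM 0" by (rule PM_module)
  have v0': "cf (\<phi> (enc w)) (Vertex i) = \<zero>" if "w \<in> words 0" for w i
    using \<phi> v0 that by (cases "i = r") (auto simp: PM_carrier)
  obtain \<psi> \<chi> where \<psi>: "\<psi> \<in> carrier (PM (Suc 0))" and \<chi>: "\<chi> \<in> carrier (PM 0)"
    and eq: "\<phi> = \<chi> \<oplus>\<^bsub>PM 0\<^esub> diff 0 \<psi>"
    and bad: "\<And>w b. w \<in> words 0 \<Longrightarrow> cf (\<chi> (enc w)) b \<noteq> \<zero> \<Longrightarrow> \<exists>k. b = Arrow k (hd w) \<and> bad k w"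
    using vertex_free_lift[OF \<phi> v0'] by metis
  have "cf (\<chi> (enc w)) b = \<zero>" if "w \<in> words 0" for w b
    using bad[OF that, of b] that by (auto simp: bad_def)
  then have "\<chi> = \<zero>\<^bsub>PM 0\<^esub>" by (intro zero_PM_eqI \<chi>) auto
  then have "\<phi> = diff 0 \<psi>" using eq diff_mem[OF \<psi>] by simp
  then show ?thesis using \<psi> by blast
qed

lemma exact_Suc:
  assumes \<phi>: "\<phi> \<in> carrier (PM (Suc t))" and cyc: "diff t \<phi> = \<zero>\<^bsub>PM t\<^esub>"
  shows "\<phi> \<in> diff (Suc t) ` carrier (PM (Suc (Suc t)))"
proof -
  interpret P: graded_left_module A "PM (Suc t)" by (rule PM_module)
  interpret Q: graded_left_module A "PM t" by (rule PM_module)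
  obtain \<psi> \<chi> where \<psi>: "\<psi> \<in> carrier (PM (Suc (Suc t)))" and \<chi>: "\<chi> \<in> carrier (PM (Suc t))"
    and eq: "\<phi> = \<chi> \<oplus>\<^bsub>PM (Suc t)\<^esub> diff (Suc t) \<psi>"
    and bad: "\<And>w b. w \<in> words (Suc t) \<Longrightarrow> cf (\<chi> (enc w)) b \<noteq> \<zero> \<Longrightarrow> \<exists>k. b = Arrow k (hd w) \<and> bad k w"
    using vertex_free_lift[OF \<phi> cycle_vertex_zero[OF \<phi> cyc]] by metis
  note [simp] = PM_closed[OF \<chi>]
  have "diff t \<phi> = diff t \<chi> \<oplus>\<^bsub>PM t\<^esub> diff t (diff (Suc t) \<psi>)"
    unfolding eq by (rule graded_homD(3)[OF diff_hom \<chi> diff_mem[OF \<psi>]])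
  \<comment> \<open>The remainder differs from the cycle \<open>\<phi>\<close> by a boundary, hence
    is itself a cycle.\<close>
  then have d\<chi>: "diff t \<chi> = \<zero>\<^bsub>PM t\<^esub>" using cyc diff_diff[OF \<psi>] diff_mem[OF \<chi>] by simp
  have "cf (\<chi> (enc u)) (Arrow k (hd u)) = \<zero>" if u: "u \<in> words (Suc t)" "bad k u" for u k
  proof -
    obtain a where k: "k \<notin> C" and ua: "u = parent k # k # a" using u(2) by (auto simp: bad_def)
    have tlu: "tl u \<in> words t" by (rule words_tl[OF u(1)])
    have hk: "hd (tl u) = k" by (simp add: ua)
    have kv: "k \<in> pverts G" using words_hd[OF tlu] hk by simp
    have "\<zero> = cf (diff t \<chi> (enc (tl u))) (Loop (hd (tl u)))" by (simp add: d\<chi> PM_zero)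
    also have "\<dots> = (\<Oplus>w \<in> words (Suc t). cf (\<chi> (enc w)) (Arrow (hd (tl u)) (hd w)) \<otimes> coeff w (tl u))"
      by (rule cf_diff_simps(3)[OF \<chi> tlu]) (use k hk in simp)
    also have "\<dots> = cf (\<chi> (enc u)) (Arrow (hd (tl u)) (hd u)) \<otimes> coeff u (tl u)"
    proof (rule finsum_eq_single[OF finite_words u(1)])
      show "cf (\<chi> (enc u)) (Arrow (hd (tl u)) (hd u)) \<otimes> coeff u (tl u) \<in> carrier K"
        using coeff_closed[OF u(1)] by simp
      fix w assume w: "w \<in> words (Suc t)" "w \<noteq> u"
      show "cf (\<chi> (enc w)) (Arrow (hd (tl u)) (hd w)) \<otimes> coeff w (tl u) = \<zero>"
      proof (cases "cf (\<chi> (enc w)) (Arrow k (hd w)) = \<zero>")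
        case True
        then show ?thesis using coeff_closed[OF w(1)] by (simp add: hk)
      next
        case False
        from bad[OF w(1) this] have "bad k w" by blast
        then obtain a' where wa: "w = parent k # k # a'" by (auto simp: bad_def)
        \<comment> \<open>Both \<open>w\<close> and \<open>u\<close> start with
          \<open>parent k\<close> and \<open>k\<close>. A correction of \<open>w\<close> equal to
          \<open>tl u\<close> starts at \<open>k\<close>, so \<open>k\<close> would be the parent of
          \<open>parent k\<close>.\<close>
        have "coeff w (tl u) = \<zero>"
        proof (rule ccontr)
          assume "coeff w (tl u) \<noteq> \<zero>"
          moreover have "tl u \<noteq> tl w" using w(2) by (simp add: ua wa)
          ultimately obtain s where "correction w = Some (s, tl u)" using coeff_nonzero by blast
          from correction_Some[OF w(1) this] hk have hw: "hd w \<notin> C" "k = parent (hd w)" by auto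
          have "hd w = parent k" by (simp add: wa)
          then have "parent k \<notin> C" "parent (parent k) = k" using hw by metis+
          then show False using parent_parent[OF kv k] by blast
        qed
        then show ?thesis by simp
      qed
    qed
    finally show ?thesis using hk by (simp add: coeff_tl)
  qed
  then have "cf (\<chi> (enc w)) b = \<zero>" if "w \<in> words (Suc t)" for w b
    using bad[OF that, of b] that by blast
  then have "\<chi> = \<zero>\<^bsub>PM (Suc t)\<^esub>" by (intro zero_PM_eqI \<chi>) auto
  then have "\<phi> = diff (Suc t) \<psi>" using eq diff_mem[OF \<psi>] by simp
  then show ?thesis using \<psi> by blast
qed

end

section \<open>Koszulness\<close>

context zigzag_coords
begin

section \<open>Finite dimension, nonnegative grading and the semisimple degree 0 part\<close>

abbreviation unit_el :: "'v zbasis \<Rightarrow> 'a" where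
  "unit_el b \<equiv> el (zunit b \<one>)"

lemma unit_el:
  assumes "b \<in> zigzag_basis G C"
  shows "unit_el b \<in> carrier A" "cf (unit_el b) = zunit b \<one>"
  using assms by (auto intro!: el zunit_closed)

lemma finite_dimensional_A: "finite_dimensional K A"
proof -
  let ?B = "zigzag_basis G C"
  have inj: "inj_on unit_el ?B"
  proof (rule inj_onI)
    fix b b' assume b: "b \<in> ?B" "b' \<in> ?B" "unit_el b = unit_el b'"
    then have "zunit b \<one> b = zunit b' \<one> b" using unit_el(2) by metis
    then show "b = b'" by (auto simp: zunit_def split: if_splits)
  qed
  show ?thesis
    unfolding finite_dimensional_def
  proof (intro exI[of _ "unit_el ` ?B"] conjI ballI)
    show "finite (unit_el ` ?B)" using finite_basis by blast
    show "unit_el ` ?B \<subseteq> carrier A" using unit_el(1) by blast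
    fix x assume x: "x \<in> carrier A"
    \<comment> \<open>In \<open>finite_dimensional\<close> the coefficients are indexed by elements
      of the algebra, so the basis label is recovered through the inverse of
      \<open>unit_el\<close>.\<close>
    define c where "c a = cf x (the_inv_into ?B unit_el a)" for a
    have cu: "c (unit_el b) = cf x b" if "b \<in> ?B" for b
      by (simp add: c_def the_inv_into_f_f[OF inj that])
    have ck: "c a \<in> carrier K" for a using x by (simp add: c_def)
    have "x = (\<Oplus>\<^bsub>A\<^esub>a \<in> unit_el ` ?B. c a \<odot>\<^bsub>A\<^esub> a)"
    proof (rule cf_eqI[OF x])
      show "(\<Oplus>\<^bsub>A\<^esub>a \<in> unit_el ` ?B. c a \<odot>\<^bsub>A\<^esub> a) \<in> carrier A"
        using ck unit_el(1) by (intro A.finsum_closed) auto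
      fix b
      have "cf (\<Oplus>\<^bsub>A\<^esub>a \<in> unit_el ` ?B. c a \<odot>\<^bsub>A\<^esub> a) b = (\<Oplus>a \<in> unit_el ` ?B. cf (c a \<odot>\<^bsub>A\<^esub> a) b)"
        by (rule cf_finsum) (use finite_basis ck unit_el(1) in auto)
      also have "\<dots> = (\<Oplus>b' \<in> ?B. cf (c (unit_el b') \<odot>\<^bsub>A\<^esub> unit_el b') b)"
        by (rule finsum_reindex[OF _ inj]) (use ck unit_el(1) in auto)
      also have "\<dots> = (\<Oplus>b' \<in> ?B. if b = b' then cf x b' else \<zero>)"
        by (rule finsum_cong') (use x unit_el ck cu in \<open>auto simp: cf_smult zunit_def\<close>)
      also have "\<dots> = cf x b"
      proof (cases "b \<in> ?B")
        case True
        then show ?thesis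
          using add.finprod_singleton[of b ?B "cf x"] finite_basis x by (simp add: Pi_def)
      next
        case False
        then have "(\<Oplus>b' \<in> ?B. if b = b' then cf x b' else \<zero>) = \<zero>"
          by (intro add.finprod_one_eqI) auto
        then show ?thesis using cf_outside[OF x False] by simp
      qed
      finally show "cf x b = cf (\<Oplus>\<^bsub>A\<^esub>a \<in> unit_el ` ?B. c a \<odot>\<^bsub>A\<^esub> a) b" by simp
    qed
    then show "\<exists>c \<in> unit_el ` ?B \<rightarrow> carrier K. x = (\<Oplus>\<^bsub>A\<^esub>a \<in> unit_el ` ?B. c a \<odot>\<^bsub>A\<^esub> a)"
      using ck by (intro bexI[of _ c]) auto
  qed
qed

lemma nonneg_graded_A: "nonneg_graded A"
  unfolding nonneg_graded_def
proof (intro allI impI equalityI subsetI)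
  fix n :: int and x assume n: "n < 0" and x: "x \<in> grade A n"
  have "0 \<le> zdegree b" for b :: "'v zbasis" by (cases b) auto
  then have "cf x b = \<zero>" for b using x n unfolding grade_iff by (metis not_le)
  then show "x \<in> {\<zero>\<^bsub>A\<^esub>}" using A.grade_closed[OF x] by (auto intro: cf_eq_zeroI)
qed (simp add: A.zero_grade)

abbreviation A0 :: "('k, 'a) graded_module" where
  "A0 \<equiv> A\<lparr>carrier := grade A 0\<rparr>"

lemma grade_neg: "x \<in> grade A n \<Longrightarrow> \<ominus>\<^bsub>A\<^esub> x \<in> grade A n"
  using subgroup.m_inv_closed[OF A.grade_subgroup] by (simp add: a_inv_def)

lemma A0_ring: "ring A0"
proof (rule ringI)
  show "abelian_group A0"
  proof (rule abelian_groupI)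
    show "\<exists>y \<in> carrier A0. y \<oplus>\<^bsub>A0\<^esub> x = \<zero>\<^bsub>A0\<^esub>" if "x \<in> carrier A0" for x
      using that grade_neg A.grade_closed A.l_neg by (intro bexI[of _ "\<ominus>\<^bsub>A\<^esub> x"]) auto
  qed (use A.add_grade A.zero_grade A.grade_closed in \<open>auto simp: A.a_ac\<close>)
  show "Group.monoid A0"
    by (rule monoidI)
      (use A.mult_grade[of _ 0 _ 0] A.one_grade A.grade_closed in \<open>auto simp: A.m_assoc\<close>)
qed (use A.grade_closed in \<open>auto simp: A.l_distr A.r_distr\<close>)

lemma grade_zero_coords:
  assumes "x \<in> grade A 0"
  shows "x \<in> carrier A" "cf x (Arrow i j) = \<zero>" "cf x (Loop i) = \<zero>"
    "i \<notin> pverts G \<Longrightarrow> cf x (Vertex i) = \<zero>"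
proof -
  show x: "x \<in> carrier A" by (rule A.grade_closed[OF assms])
  show "cf x (Arrow i j) = \<zero>" "cf x (Loop i) = \<zero>" using assms unfolding grade_iff by force+
  show "i \<notin> pverts G \<Longrightarrow> cf x (Vertex i) = \<zero>" using cf_outside[OF x] by simp
qed

text \<open>Elements of degree 0 multiply coordinatewise. With \<open>k\<close> the inverse of a
  nonzero coordinate of \<open>x\<close>, this recovers e_i as a multiple of
  \<open>x\<close>.\<close>

lemma scaled_idem_mult:
  assumes k: "k \<in> carrier K" and i: "i \<in> pverts G" and x: "x \<in> grade A 0"
  shows "(k \<odot>\<^bsub>A\<^esub> idem i) \<otimes>\<^bsub>A\<^esub> x = (k \<otimes> cf x (Vertex i)) \<odot>\<^bsub>A\<^esub> idem i"
proof (rule cf_eqI)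
  note x' = grade_zero_coords[OF x] and i' = idem_closed[OF i]
  show "(k \<odot>\<^bsub>A\<^esub> idem i) \<otimes>\<^bsub>A\<^esub> x \<in> carrier A" "(k \<otimes> cf x (Vertex i)) \<odot>\<^bsub>A\<^esub> idem i \<in> carrier A"
    using k x'(1) i' by auto
  show "cf ((k \<odot>\<^bsub>A\<^esub> idem i) \<otimes>\<^bsub>A\<^esub> x) b = cf ((k \<otimes> cf x (Vertex i)) \<odot>\<^bsub>A\<^esub> idem i) b" for b
    using k x' i' i
    by (cases b) (auto simp: cf_mult cf_smult zigzag_mult_simps cf_idem zunit_def intro!: add.finprod_one_eqI)
qed

text \<open>The degree 0 part is a product of copies of the field, one for each vertex. A submodule
  is spanned by the idempotents it contains, and the vectors vanishing at the corresponding vertices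
  form a complement.\<close>

lemma semisimple_A0: "semisimple_ring A0"
proof -
  interpret R: ring A0 by (rule A0_ring)
  let ?M = "regular_module A0"
  have sel: "carrier ?M = grade A 0" "add ?M = add A" "zero ?M = \<zero>\<^bsub>A\<^esub>" "smult ?M = mult A"
    by (simp_all add: regular_module_def)
  have M: "left_module A0 ?M"
  proof (intro left_module.intro left_module_axioms.intro A0_ring)
    show "abelian_group ?M"
    proof (rule abelian_groupI)
      show "\<exists>y \<in> carrier ?M. y \<oplus>\<^bsub>?M\<^esub> x = \<zero>\<^bsub>?M\<^esub>" if "x \<in> carrier ?M" for x
        using that grade_neg A.grade_closed A.l_neg by (intro bexI[of _ "\<ominus>\<^bsub>A\<^esub> x"]) (auto simp: sel)
    qed (use R.a_closed R.zero_closed R.a_assoc R.a_comm R.l_zero in \<open>simp_all add: sel\<close>)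
  qed (use R.m_closed R.l_distr R.r_distr R.m_assoc R.l_one in \<open>simp_all add: sel\<close>)
  have "\<exists>H'. submodule H' A0 ?M \<and> H \<inter> H' = {\<zero>\<^bsub>?M\<^esub>} \<and> H <+>\<^bsub>?M\<^esub> H' = carrier ?M"
    if H: "submodule H A0 ?M" for H
  proof -
    have sg: "subgroup H (add_monoid ?M)" by (rule submodule.axioms(1)[OF H])
    have HD: "H \<subseteq> grade A 0" "\<zero>\<^bsub>A\<^esub> \<in> H" "x \<in> H \<Longrightarrow> y \<in> H \<Longrightarrow> x \<oplus>\<^bsub>A\<^esub> y \<in> H"
      "a \<in> grade A 0 \<Longrightarrow> x \<in> H \<Longrightarrow> a \<otimes>\<^bsub>A\<^esub> x \<in> H" for x y a
      using subgroup.subset[OF sg] subgroup.one_closed[OF sg] subgroup.m_closed[OF sg]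
        submodule.smult_closed[OF H, of a x] by (simp_all add: sel)
    define T where "T = {i \<in> pverts G. idem i \<in> H}"
    have finT: "finite T" unfolding T_def using finite_verts by simp
    have ki: "k \<odot>\<^bsub>A\<^esub> idem i \<in> grade A 0" if "k \<in> carrier K" "i \<in> pverts G" for k i
      using submodule.smult_closed[OF A.grade_subspace that(1) idem_grade[OF that(2)]] .
    \<comment> \<open>A nonzero coordinate is invertible, so multiplying \<open>x\<close> by a
      multiple of e_i would put e_i into \<open>H\<close>.\<close>
    have HT: "cf x (Vertex i) = \<zero>" if x: "x \<in> H" and i: "i \<notin> T" for x i
    proof (rule ccontr)
      let ?k = "cf x (Vertex i)"
      assume nz: "?k \<noteq> \<zero>"
      have x0: "x \<in> grade A 0" using x HD(1) by blast
      have iV: "i \<in> pverts G" using nz grade_zero_coords(4)[OF x0] by blast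
      have kU: "?k \<in> Units K" using nz grade_zero_coords(1)[OF x0] by (simp add: field_Units)
      then have k: "inv ?k \<in> carrier K" "inv ?k \<otimes> ?k = \<one>" by auto
      have "(inv ?k \<odot>\<^bsub>A\<^esub> idem i) \<otimes>\<^bsub>A\<^esub> x \<in> H" by (rule HD(4)[OF ki[OF k(1) iV] x])
      then have "idem i \<in> H"
        using scaled_idem_mult[OF k(1) iV x0] k(2) A.smult_one[OF idem_closed[OF iV]] by simp
      then show False using i iV by (simp add: T_def)
    qed
    define H' where "H' = {x \<in> grade A 0. \<forall>i \<in> T. cf x (Vertex i) = \<zero>}"
    have H'g: "x \<in> H' \<Longrightarrow> x \<in> grade A 0" for x by (simp add: H'_def)
    have cneg: "cf (\<ominus>\<^bsub>A\<^esub> x) b = \<zero>" if "x \<in> carrier A" "cf x b = \<zero>" for x b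
      using cf_add[of "\<ominus>\<^bsub>A\<^esub> x" x b] that by (simp add: A.l_neg)
    have H': "submodule H' A0 ?M"
    proof (intro submodule.intro submodule_axioms.intro)
      interpret MM: abelian_group ?M by (rule left_module.axioms(2)[OF M])
      have inv: "inv\<^bsub>add_monoid ?M\<^esub> x = \<ominus>\<^bsub>A\<^esub> x" if "x \<in> grade A 0" for x
        using MM.minus_equality[of "\<ominus>\<^bsub>A\<^esub> x" x] that grade_neg[OF that] A.l_neg A.grade_closed[OF that]
        by (simp add: sel a_inv_def)
      show "subgroup H' (add_monoid ?M)"
      proof (rule group.subgroupI[OF MM.a_group])
        show "H' \<subseteq> carrier (add_monoid ?M)" using H'g by (auto simp: sel)
        have "\<zero>\<^bsub>A\<^esub> \<in> H'" by (simp add: H'_def A.zero_grade)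
        then show "H' \<noteq> {}" by blast
        show "inv\<^bsub>add_monoid ?M\<^esub> x \<in> H'" if "x \<in> H'" for x
          using that inv[OF H'g[OF that]] grade_neg cneg A.grade_closed by (auto simp: H'_def)
        show "x \<otimes>\<^bsub>add_monoid ?M\<^esub> y \<in> H'" if "x \<in> H'" "y \<in> H'" for x y
          using that A.add_grade A.grade_closed by (auto simp: H'_def sel cf_add)
      qed
      show "a \<odot>\<^bsub>?M\<^esub> x \<in> H'" if "a \<in> carrier A0" "x \<in> H'" for a x
        using that A.mult_grade[of a 0 x 0] A.grade_closed[of a 0] A.grade_closed[of x 0]
        by (auto simp: H'_def sel cf_mult zigzag_mult_simps)
    qed
    moreover have "H \<inter> H' = {\<zero>\<^bsub>?M\<^esub>}"
    proof -
      have "x = \<zero>\<^bsub>A\<^esub>" if "x \<in> H" "x \<in> H'" for x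
      proof (rule cf_eq_zeroI)
        have x0: "x \<in> grade A 0" using that(2) by (rule H'g)
        then show "x \<in> carrier A" by (rule A.grade_closed)
        show "cf x b = \<zero>" for b
          using HT[OF that(1)] that(2) grade_zero_coords(2,3)[OF x0] by (cases b) (auto simp: H'_def)
      qed
      moreover have "\<zero>\<^bsub>A\<^esub> \<in> H'" by (simp add: H'_def A.zero_grade)
      ultimately show ?thesis unfolding sel using HD(2) by blast
    qed
    moreover have "H <+>\<^bsub>?M\<^esub> H' = carrier ?M"
    proof
      show "H <+>\<^bsub>?M\<^esub> H' \<subseteq> carrier ?M"
        using HD(1) H'g A.add_grade by (auto simp: set_add_def set_mult_def sel subset_iff)
      show "carrier ?M \<subseteq> H <+>\<^bsub>?M\<^esub> H'"
      proof
        fix x assume "x \<in> carrier ?M"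
        then have x: "x \<in> grade A 0" by (simp add: sel)
        note x' = grade_zero_coords[OF x]
        let ?y = "\<lambda>S. \<Oplus>\<^bsub>A\<^esub>i \<in> S. cf x (Vertex i) \<odot>\<^bsub>A\<^esub> idem i"
        have kx: "cf x (Vertex i) \<odot>\<^bsub>A\<^esub> idem i \<in> grade A 0" if "i \<in> T" for i
          using that x'(1) by (intro ki) (auto simp: T_def)
        have yH: "?y S \<in> H" if "finite S" "S \<subseteq> T" for S
          using that
        proof (induction S rule: finite_induct)
          case empty then show ?case using HD(2) by simp
        next
          case (insert i S)
          have m: "cf x (Vertex i) \<odot>\<^bsub>A\<^esub> idem i \<in> H" if "i \<in> T" for i
          proof -
            have iV: "i \<in> pverts G" "idem i \<in> H" using that by (auto simp: T_def)
            have "(cf x (Vertex i) \<odot>\<^bsub>A\<^esub> idem i) \<otimes>\<^bsub>A\<^esub> idem i \<in> H" by (rule HD(4)[OF kx[OF that] iV(2)])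
            moreover have "(cf x (Vertex i) \<odot>\<^bsub>A\<^esub> idem i) \<otimes>\<^bsub>A\<^esub> idem i = cf x (Vertex i) \<odot>\<^bsub>A\<^esub> idem i"
              using scaled_idem_mult[OF _ iV(1) idem_grade[OF iV(1)]] x'(1) by (simp add: cf_idem[OF iV(1)] zunit_def)
            ultimately show ?thesis by simp
          qed
          have "(\<lambda>i. cf x (Vertex i) \<odot>\<^bsub>A\<^esub> idem i) \<in> S \<rightarrow> carrier A"
            "cf x (Vertex i) \<odot>\<^bsub>A\<^esub> idem i \<in> carrier A"
            using insert.prems A.grade_closed[OF kx] by blast+
          then show ?case using insert.hyps insert.IH insert.prems HD(3) m by (simp add: A.finsum_insert)
        qed
        let ?h = "?y T"
        have h: "?h \<in> H" by (rule yH[OF finT subset_refl])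
        then have hg: "?h \<in> grade A 0" using HD(1) by blast
        have cfh: "cf ?h (Vertex i) = cf x (Vertex i)" if i: "i \<in> T" for i
        proof -
          have "cf ?h (Vertex i) = (\<Oplus>j \<in> T. cf (cf x (Vertex j) \<odot>\<^bsub>A\<^esub> idem j) (Vertex i))"
            by (rule cf_finsum[OF finT]) (rule A.grade_closed[OF kx])
          also have "\<dots> = cf (cf x (Vertex i) \<odot>\<^bsub>A\<^esub> idem i) (Vertex i)"
            by (rule finsum_eq_single[OF finT i])
              (use i x'(1) in \<open>auto simp: T_def cf_smult idem_closed cf_idem zunit_def\<close>)
          also have "\<dots> = cf x (Vertex i)"
            using i x'(1) by (auto simp: T_def cf_smult idem_closed cf_idem zunit_def)
          finally show ?thesis .
        qed
        let ?h' = "\<ominus>\<^bsub>A\<^esub> ?h \<oplus>\<^bsub>A\<^esub> x"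
        have hc: "?h \<in> carrier A" by (rule A.grade_closed[OF hg])
        have "cf ?h' (Vertex i) = \<zero>" if i: "i \<in> T" for i
        proof -
          have "cf (\<ominus>\<^bsub>A\<^esub> ?h) (Vertex i) \<oplus> cf ?h (Vertex i) = cf (\<ominus>\<^bsub>A\<^esub> ?h \<oplus>\<^bsub>A\<^esub> ?h) (Vertex i)"
            using hc by (simp add: cf_add)
          also have "\<dots> = \<zero>" using hc by (simp add: A.l_neg)
          finally show ?thesis using hc x'(1) cfh[OF i] by (simp add: cf_add)
        qed
        then have "?h' \<in> H'" using A.add_grade[OF grade_neg[OF hg] x] by (simp add: H'_def)
        moreover have "x = ?h \<oplus>\<^bsub>A\<^esub> ?h'" using hc x'(1) by (simp add: A.r_neg2)
        ultimately show "x \<in> H <+>\<^bsub>?M\<^esub> H'"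
          using h by (auto simp: set_add_def set_mult_def sel)
      qed
    qed
    ultimately show ?thesis by blast
  qed
  then show ?thesis unfolding semisimple_ring_def semisimple_module_def using A0_ring M by blast
qed


section \<open>Resolutions of the simple modules\<close>

lemma one_eq_sum_idem: "\<one>\<^bsub>A\<^esub> = (\<Oplus>\<^bsub>A\<^esub>i \<in> pverts G. idem i)"
proof (rule cf_eqI)
  show "(\<Oplus>\<^bsub>A\<^esub>i \<in> pverts G. idem i) \<in> carrier A" by (intro A.finsum_closed) (auto simp: idem_closed)
  fix b
  have "cf (\<Oplus>\<^bsub>A\<^esub>i \<in> pverts G. idem i) b = (\<Oplus>i \<in> pverts G. cf (idem i) b)"
    by (rule cf_finsum[OF finite_verts idem_closed])
  also have "\<dots> = (if b \<in> Vertex ` pverts G then \<one> else \<zero>)"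
  proof (cases "b \<in> Vertex ` pverts G")
    case True
    then obtain i where i: "i \<in> pverts G" "b = Vertex i" by blast
    have "(\<Oplus>i \<in> pverts G. cf (idem i) b) = cf (idem i) b"
      by (rule finsum_eq_single[OF finite_verts i(1)]) (auto simp: cf_idem i zunit_def idem_closed)
    then show ?thesis using True i by (simp add: cf_idem zunit_def)
  next
    case False
    then show ?thesis by (auto simp: cf_idem zunit_def intro!: add.finprod_one_eqI)
  qed
  finally show "cf \<one>\<^bsub>A\<^esub> b = cf (\<Oplus>\<^bsub>A\<^esub>i \<in> pverts G. idem i) b" by (simp add: cf_one)
qed simp

lemma idem_mult_idem: "i \<in> pverts G \<Longrightarrow> idem i \<otimes>\<^bsub>A\<^esub> idem i = idem i"
  by (auto simp: mult_idem_eq_iff idem_closed cf_idem zunit_def)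

text \<open>Every \<open>x\<close> is the sum of the e_i x, so one of these is nonzero. The vertex
  found here is where the words of the resolution end.\<close>

lemma support_vertex_exists:
  assumes S: "graded_left_module A S" and ne: "carrier S \<noteq> {\<zero>\<^bsub>S\<^esub>}"
  obtains i s where "i \<in> pverts G" "s \<in> carrier S" "idem i \<odot>\<^bsub>S\<^esub> s = s" "s \<noteq> \<zero>\<^bsub>S\<^esub>"
proof -
  interpret S: graded_left_module A S by (rule S)
  obtain x where x: "x \<in> carrier S" "x \<noteq> \<zero>\<^bsub>S\<^esub>" using ne S.M.zero_closed by blast
  have "(\<lambda>a. a \<odot>\<^bsub>S\<^esub> x) \<in> hom (add_monoid A) (add_monoid S)"
    using x(1) S.smult_closed S.smult_l_distr by (auto simp: hom_def)
  from hom_add_finsum[OF A.abelian_group_axioms S.M.abelian_group_axioms this finite_verts idem_closed]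
  have sum: "x = (\<Oplus>\<^bsub>S\<^esub>i \<in> pverts G. idem i \<odot>\<^bsub>S\<^esub> x)"
    using S.smult_one[OF x(1)] by (simp add: one_eq_sum_idem)
  have "\<exists>i \<in> pverts G. idem i \<odot>\<^bsub>S\<^esub> x \<noteq> \<zero>\<^bsub>S\<^esub>"
  proof (rule ccontr)
    assume "\<not> ?thesis"
    then have "(\<Oplus>\<^bsub>S\<^esub>i \<in> pverts G. idem i \<odot>\<^bsub>S\<^esub> x) = \<zero>\<^bsub>S\<^esub>" by (intro S.M.add.finprod_one_eqI) auto
    then show False using sum x(2) by simp
  qed
  then obtain i where i: "i \<in> pverts G" "idem i \<odot>\<^bsub>S\<^esub> x \<noteq> \<zero>\<^bsub>S\<^esub>" by blast
  show ?thesis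
  proof (rule that[OF i(1) _ _ i(2)])
    show "idem i \<odot>\<^bsub>S\<^esub> x \<in> carrier S" by (rule S.smult_closed[OF idem_closed[OF i(1)] x(1)])
    show "idem i \<odot>\<^bsub>S\<^esub> (idem i \<odot>\<^bsub>S\<^esub> x) = idem i \<odot>\<^bsub>S\<^esub> x"
      using S.smult_assoc[OF idem_closed[OF i(1)] idem_closed[OF i(1)] x(1)] idem_mult_idem[OF i(1)] by simp
  qed
qed

lemma concentrated_component:
  assumes S: "graded_left_module A S" and conc: "concentrated_in_degree 0 S" and x: "x \<in> carrier S"
  shows "component S x = (\<lambda>n. if n = 0 then x else \<zero>\<^bsub>S\<^esub>)"
proof -
  interpret S: graded_left_module A S by (rule S)
  have z: "component S x n = \<zero>\<^bsub>S\<^esub>" if "n \<noteq> 0" for n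
    using S.M.component_grade[OF x, of n] that conc by (auto simp: concentrated_in_degree_def)
  have "component S x 0 = x"
  proof (cases "component S x 0 = \<zero>\<^bsub>S\<^esub>")
    case True
    then have "component S x n = \<zero>\<^bsub>S\<^esub>" for n using z by (cases "n = 0") auto
    then have "{n. component S x n \<noteq> \<zero>\<^bsub>S\<^esub>} = {}" by simp
    then show ?thesis using S.M.sum_component[OF x] True by simp
  next
    case False
    then have "{n. component S x n \<noteq> \<zero>\<^bsub>S\<^esub>} = {0}" using z by auto
    then show ?thesis
      using S.M.sum_component[OF x] S.M.grade_closed[OF S.M.component_grade[OF x]] by simp
  qed
  then show ?thesis using z by auto
qed

text \<open>A s is a nonzero submodule; it is graded, because in a module concentrated in degree 0
  an element is its own only component.\<close>

lemma simple_generated: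
  fixes S :: "('a, 's) graded_module"
  assumes S: "simple_graded_module A S" and conc: "concentrated_in_degree 0 S"
    and s: "s \<in> carrier S" "s \<noteq> \<zero>\<^bsub>S\<^esub>"
  shows "carrier S = (\<lambda>a. a \<odot>\<^bsub>S\<^esub> s) ` carrier A"
proof -
  have Sm: "graded_left_module A S" using S by (simp add: simple_graded_module_def)
  interpret S: graded_left_module A S by (rule Sm)
  let ?H = "(\<lambda>a. a \<odot>\<^bsub>S\<^esub> s) ` carrier A"
  have H: "?H \<subseteq> carrier S" using S.smult_closed[OF _ s(1)] by blast
  have sub: "submodule ?H A S"
  proof (intro submodule.intro submodule_axioms.intro)
    show "subgroup ?H (add_monoid S)"
    proof (rule group.subgroupI[OF S.M.a_group])
      show "inv\<^bsub>add_monoid S\<^esub> x \<in> ?H" if x: "x \<in> ?H" for x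
      proof -
        obtain a where a: "a \<in> carrier A" "x = a \<odot>\<^bsub>S\<^esub> s" using x by blast
        have "(\<ominus>\<^bsub>A\<^esub> a) \<odot>\<^bsub>S\<^esub> s \<oplus>\<^bsub>S\<^esub> a \<odot>\<^bsub>S\<^esub> s = \<zero>\<^bsub>S\<^esub>"
          using S.smult_l_distr[OF A.a_inv_closed[OF a(1)] a(1) s(1)] S.smult_zero_left[OF s(1)] a(1)
          by (simp add: A.l_neg)
        then have "\<ominus>\<^bsub>S\<^esub> x = (\<ominus>\<^bsub>A\<^esub> a) \<odot>\<^bsub>S\<^esub> s"
          unfolding a(2) using S.smult_closed s(1) a(1) by (intro S.M.minus_equality) auto
        then show ?thesis using a(1) by (auto simp: a_inv_def[symmetric])
      qed
      show "x \<otimes>\<^bsub>add_monoid S\<^esub> y \<in> ?H" if "x \<in> ?H" "y \<in> ?H" for x y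
      proof -
        from that(1) obtain a where "x = a \<odot>\<^bsub>S\<^esub> s" "a \<in> carrier A" by (rule imageE)
        moreover from that(2) obtain b where "y = b \<odot>\<^bsub>S\<^esub> s" "b \<in> carrier A" by (rule imageE)
        ultimately show ?thesis using S.smult_l_distr[of a b s] s(1)
          by (intro image_eqI[of _ _ "a \<oplus>\<^bsub>A\<^esub> b"]) auto
      qed
    qed (use H A.one_closed in auto)
    show "a \<odot>\<^bsub>S\<^esub> x \<in> ?H" if a: "a \<in> carrier A" and x: "x \<in> ?H" for a x
    proof -
      obtain b where b: "b \<in> carrier A" "x = b \<odot>\<^bsub>S\<^esub> s" using x by blast
      then show ?thesis using S.smult_assoc[OF a b(1) s(1)] a
        by (intro image_eqI[of _ _ "a \<otimes>\<^bsub>A\<^esub> b"]) auto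
    qed
  qed
  have "component S x n \<in> ?H" if "x \<in> ?H" for x n
    using that H S.submoduleD(2)[OF sub] concentrated_component[OF Sm conc, of x] by auto
  then have "graded_submodule ?H A S"
    unfolding graded_submodule_def using sub by (intro conjI graded_sub_module[OF Sm sub])
  then have "?H = {\<zero>\<^bsub>S\<^esub>} \<or> ?H = carrier S" using S by (simp add: simple_graded_module_def)
  moreover have "s \<in> ?H" using S.smult_one[OF s(1)] by (intro image_eqI[of _ _ "\<one>\<^bsub>A\<^esub>"]) auto
  ultimately show ?thesis using s(2) by blast
qed

text \<open>As e_r fixes \<open>s\<close>, letting A e_r act on \<open>s\<close> covers the simple
  module. The kernel of this map is the part without vertex coordinate, which is the input of
  \<open>exact_zero\<close>.\<close>

lemma linear_resolution:
  fixes S :: "('a, 's) graded_module"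
  assumes S: "simple_graded_module A S" and conc: "concentrated_in_degree 0 S"
    and s: "s \<in> carrier S" "idem r \<odot>\<^bsub>S\<^esub> s = s" "s \<noteq> \<zero>\<^bsub>S\<^esub>"
  shows "linear_projective_resolution A S PM diff (\<lambda>\<phi>. \<phi> (enc [r]) \<odot>\<^bsub>S\<^esub> s)"
proof -
  have Sm: "graded_left_module A S" using S by (simp add: simple_graded_module_def)
  interpret S: graded_left_module A S by (rule Sm)
  interpret P: graded_left_module A "PM 0" by (rule PM_module)
  let ?e = "\<lambda>\<phi> :: nat \<Rightarrow> 'a. \<phi> (enc [r]) \<odot>\<^bsub>S\<^esub> s"
  have w0: "[r] \<in> words 0" by simp
  have s0: "s \<in> grade S 0"
    using S.M.component_grade[OF s(1), of 0] concentrated_component[OF Sm conc s(1)] by simp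
  \<comment> \<open>The product lies in degree \<open>n\<close>, where the simple module is
    0.\<close>
  have pos_zero: "a \<odot>\<^bsub>S\<^esub> s = \<zero>\<^bsub>S\<^esub>" if "a \<in> grade A n" "n \<noteq> 0" for a n
    using S.smult_grade[OF that(1) s0] that(2) conc by (simp add: concentrated_in_degree_def)
  have e: "?e \<in> graded_hom A (PM 0) S"
    unfolding graded_hom_def hom_def
  proof (intro CollectI conjI allI ballI)
    show "?e \<in> carrier (add_monoid (PM 0)) \<rightarrow> carrier (add_monoid S)"
      using S.smult_closed[OF PM_closed s(1)] by simp
    show "?e ` grade (PM 0) n \<subseteq> grade S n" for n
    proof
      fix x assume "x \<in> ?e ` grade (PM 0) n"
      then obtain \<phi> where "\<phi> \<in> grade (FM 0) n" "x = ?e \<phi>" by (auto simp: PM_sel(4))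
      then show "x \<in> grade S n" using S.smult_grade[OF _ s0, of "\<phi> (enc [r])" n]
        by (simp add: A.free_graded_module_sel(5))
    qed
  qed (use S.smult_l_distr S.smult_assoc PM_closed s(1) in
      \<open>auto simp: PM_sel(2,3) A.free_graded_module_sel(3,4)\<close>)
  have surj: "?e ` carrier (PM 0) = carrier S"
  proof
    show "?e ` carrier (PM 0) \<subseteq> carrier S" using graded_homD(2)[OF e] by blast
    show "carrier S \<subseteq> ?e ` carrier (PM 0)"
    proof
      fix x assume "x \<in> carrier S"
      then obtain a where a: "a \<in> carrier A" "x = a \<odot>\<^bsub>S\<^esub> s"
        using simple_generated[OF S conc s(1,3)] by blast
      \<comment> \<open>Multiplying by e_r moves \<open>a\<close> into A e_r without changing its
        action on \<open>s\<close>.\<close>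
      let ?a = "a \<otimes>\<^bsub>A\<^esub> idem r"
      have ac: "?a \<in> carrier A" using a(1) idem_closed[OF r_vert] by simp
      have tgt: "cf ?a b = \<zero>" if "w \<in> words 0" "target b \<noteq> hd w" for w b
        using that by (simp add: cf_mult_idem[OF a(1) r_vert])
      have \<phi>: "PM_of 0 (\<lambda>_. cf ?a) \<in> carrier (PM 0)"
        by (rule PM_of(1), rule cf_mem[OF ac], rule tgt)
      have "cf (PM_of 0 (\<lambda>_. cf ?a) (enc [r])) = cf ?a"
        by (rule PM_of(2)[OF _ _ w0], rule cf_mem[OF ac], rule tgt)
      then have "PM_of 0 (\<lambda>_. cf ?a) (enc [r]) = ?a"
        by (rule inj_onD[OF cf_inj _ PM_closed[OF \<phi>] ac])
      then have "?e (PM_of 0 (\<lambda>_. cf ?a)) = x"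
        using S.smult_assoc[OF a(1) idem_closed[OF r_vert] s(1)] s(2) a(2) by simp
      then show "x \<in> ?e ` carrier (PM 0)" using \<phi> by blast
    qed
  qed
  have ker: "cf (\<phi> (enc [r])) (Vertex r) = \<zero>" if \<phi>: "\<phi> \<in> carrier (PM 0)" and z: "?e \<phi> = \<zero>\<^bsub>S\<^esub>" for \<phi>
  proof (rule ccontr)
    let ?a = "\<phi> (enc [r])" let ?k = "cf ?a (Vertex r)"
    assume nz: "?k \<noteq> \<zero>"
    have ac: "?a \<in> carrier A" by (rule PM_closed[OF \<phi>])
    \<comment> \<open>The homogeneous components of \<open>?a\<close>. Those of degrees 1 and 2 kill
      \<open>s\<close>, so the component of degree 0 has to kill it too.\<close>
    let ?g = "\<lambda>d b. if zdegree b = d then cf ?a b else \<zero>"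
    define h where "h d = el (?g d)" for d
    have "?g d \<in> carrier (Z C)" for d using cf_mem[OF ac] by (auto simp: model_sel)
    note hd = el[OF this, folded h_def]
    have hg: "h d \<in> grade A d" for d using hd(1) by (auto simp: grade_iff hd(2))
    have "?a = h 0 \<oplus>\<^bsub>A\<^esub> (h 1 \<oplus>\<^bsub>A\<^esub> h 2)"
    proof (rule cf_eqI[OF ac])
      show "h 0 \<oplus>\<^bsub>A\<^esub> (h 1 \<oplus>\<^bsub>A\<^esub> h 2) \<in> carrier A" using hd(1) by simp
      show "cf ?a b = cf (h 0 \<oplus>\<^bsub>A\<^esub> (h 1 \<oplus>\<^bsub>A\<^esub> h 2)) b" for b
        using ac hd(1) by (cases b) (simp_all add: cf_add hd(2))
    qed
    then have "?e \<phi> = h 0 \<odot>\<^bsub>S\<^esub> s"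
      using S.smult_l_distr[OF hd(1) _ s(1)] hd(1) pos_zero[OF hg, of 1] pos_zero[OF hg, of 2]
        S.smult_closed[OF hd(1) s(1)] by simp
    then have hs: "h 0 \<odot>\<^bsub>S\<^esub> s = \<zero>\<^bsub>S\<^esub>" using z by simp
    have "?k \<in> Units K" using nz ac by (simp add: field_Units)
    then have k: "inv ?k \<in> carrier K" "inv ?k \<otimes> ?k = \<one>" by auto
    have "cf (h 0) (Vertex r) = ?k" by (simp add: hd(2))
    \<comment> \<open>If the vertex coordinate were nonzero, e_r would be a multiple of
      \<open>h 0\<close> and would kill \<open>s\<close> as well.\<close>
    then have m: "(inv ?k \<odot>\<^bsub>A\<^esub> idem r) \<otimes>\<^bsub>A\<^esub> h 0 = idem r"
      using scaled_idem_mult[OF k(1) r_vert hg] k(2) A.smult_one[OF idem_closed[OF r_vert]] by simp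
    have "idem r \<odot>\<^bsub>S\<^esub> s = ((inv ?k \<odot>\<^bsub>A\<^esub> idem r) \<otimes>\<^bsub>A\<^esub> h 0) \<odot>\<^bsub>S\<^esub> s" by (simp only: m)
    also have "\<dots> = (inv ?k \<odot>\<^bsub>A\<^esub> idem r) \<odot>\<^bsub>S\<^esub> (h 0 \<odot>\<^bsub>S\<^esub> s)"
      by (rule S.smult_assoc[OF _ hd(1) s(1)]) (use k(1) idem_closed[OF r_vert] in simp)
    also have "\<dots> = \<zero>\<^bsub>S\<^esub>" unfolding hs using k(1) idem_closed[OF r_vert] by (intro S.smult_zero_right) simp
    finally show False using s(2,3) by simp
  qed
  \<comment> \<open>The matrix entries of the differential have degree 1, so they kill
    \<open>s\<close>.\<close>
  have ed: "?e (diff 0 \<psi>) = \<zero>\<^bsub>S\<^esub>" if \<psi>: "\<psi> \<in> carrier (PM (Suc 0))" for \<psi>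
  proof -
    have dm: "dmat 0 n \<in> carrier (PM 0)" if "n \<in> enc ` words (Suc 0)" for n
      using that dmat_PM(1) by blast
    have sub: "n \<in> enc ` words (Suc 0)" if "\<psi> n \<noteq> \<zero>\<^bsub>A\<^esub>" for n
      using \<psi> that unfolding PM_carrier by blast
    have "?e (diff 0 \<psi>) = free_extension A S (\<lambda>n. ?e (dmat 0 n)) \<psi>"
      unfolding diff_def
      by (rule graded_hom_free_extension[OF PM_module Sm e subsetD[OF PM_sel(5) \<psi>] dm])
    also have "\<dots> = \<zero>\<^bsub>S\<^esub>"
      unfolding free_extension_def
    proof (rule S.M.add.finprod_one_eqI)
      fix n assume "n \<in> {n. \<psi> n \<noteq> \<zero>\<^bsub>A\<^esub>}"
      then obtain w where w: "w \<in> words (Suc 0)" "n = enc w" using sub by blast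
      have "dmat 0 n \<in> grade (FM 0) 1" using dmat_grade[OF w(1)] by (simp add: w(2) PM_sel(4))
      then have "dmat 0 n (enc [r]) \<in> grade A 1" by (simp add: A.free_graded_module_sel(5))
      then have "?e (dmat 0 n) = \<zero>\<^bsub>S\<^esub>" by (rule pos_zero) simp
      then show "\<psi> n \<odot>\<^bsub>S\<^esub> ?e (dmat 0 n) = \<zero>\<^bsub>S\<^esub>" using S.smult_zero_right[OF PM_closed[OF \<psi>]] by simp
    qed
    finally show ?thesis .
  qed
  show ?thesis
    unfolding linear_projective_resolution_def
  proof (intro conjI allI)
    show "graded_projective A (PM t)" for t
      unfolding PM_def by (rule free_summand.projective_summand[OF PM_summand])
    show "generated_in_degree (int t) A (PM t)" for t
      unfolding PM_def by (rule free_summand.generated_summand[OF PM_summand]) simp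
    show "diff t \<in> graded_hom A (PM (Suc t)) (PM t)" for t by (rule diff_hom)
    show "?e \<in> graded_hom A (PM 0) S" by (rule e)
    show "?e ` carrier (PM 0) = carrier S" by (rule surj)
    show "diff 0 ` carrier (PM 1) = {x \<in> carrier (PM 0). ?e x = \<zero>\<^bsub>S\<^esub>}"
      unfolding One_nat_def using diff_mem ed exact_zero ker by blast
    show "diff (Suc t) ` carrier (PM (Suc (Suc t))) = {x \<in> carrier (PM (Suc t)). diff t x = \<zero>\<^bsub>PM t\<^esub>}" for t
      using diff_mem diff_diff exact_Suc by blast
  qed
qed

end

theorem theorem3:
  fixes K :: "('k, 'd) ring_scheme" and G :: "'v pair_pre_digraph" and C :: "'v set"
  assumes "field K"
    and "pair_graph G" and "Digraph_Component.connected (with_proj G)"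
    and "C \<subseteq> pverts G" and "C \<noteq> {}"
  shows "koszul TYPE('s) K (zigzag_algebra_vc K G C)"
proof -
  interpret connected_zigzag_graph K G by (rule connected_zigzag_graphI) (fact assms)+
  let ?A = "zigzag_algebra_vc K G C"
  obtain h where A: "graded_algebra K ?A" and h: "graded_epi K ?A (Z C) h" "inj_on h (carrier ?A)"
    using zigzag_algebra_vc_coords[OF assms(4)] by blast
  have coords: "zigzag_coords K G C r ?A h" if "r \<in> pverts G" for r
    by (intro zigzag_coords.intro zigzag_words.intro zigzag_words_axioms.intro
        zigzag_coords_axioms.intro connected_zigzag_graph_axioms assms(4,5) that A h)
  \<comment> \<open>Some vertex serves as base point for the statements about the algebra itself;
    for each simple module the base point \<open>r\<close> is then chosen anew.\<close>
  obtain i where i: "i \<in> pverts G" using nonempty_verts by blast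
  interpret zigzag_coords K G C i ?A h by (rule coords[OF i])
  show ?thesis
    unfolding koszul_def
  proof (intro conjI allI impI)
    fix S :: "(('v list \<Rightarrow> 'k) set set, 's) graded_module"
    assume S: "simple_graded_module ?A S \<and> concentrated_in_degree 0 S"
    then have "graded_left_module ?A S" "carrier S \<noteq> {\<zero>\<^bsub>S\<^esub>}"
      by (simp_all add: simple_graded_module_def)
    then obtain r s where r: "r \<in> pverts G"
      and s: "s \<in> carrier S" "idem r \<odot>\<^bsub>S\<^esub> s = s" "s \<noteq> \<zero>\<^bsub>S\<^esub>"
      by (rule support_vertex_exists)
    interpret R: zigzag_coords K G C r ?A h by (rule coords[OF r])
    show "\<exists>(P :: nat \<Rightarrow> (('v list \<Rightarrow> 'k) set set, nat \<Rightarrow> ('v list \<Rightarrow> 'k) set set) graded_module) d e.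
        linear_projective_resolution ?A S P d e"
      using R.linear_resolution[of S s] S s by blast
  qed (rule A finite_dimensional_A nonneg_graded_A semisimple_A0)+
qed

end
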